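(* In the setting below, let $\theta\in\mathcal O_{K_1}$ be admissible and $\mathfrak R_\theta:=k(\sqrt[3]{\pi_1},\sqrt[3]{\pi_2},\sqrt[3]{\theta})$. Then: (1) $\mathfrak R_\theta=k(\sqrt[3]{\theta^{(1)}},\sqrt[3]{\theta^{(2)}},\sqrt[3]{\theta^{(3)}})$, where $\theta^{(1)}=\theta$, $\theta^{(2)}=\tau(\theta)$, $\theta^{(3)}=\tau^2(\theta)$; (2) $\mathfrak R_\theta/k$ is a Galois extension which is unramified outside $\mathfrak p_1$ and $\mathfrak p_2$, and the ramification index of each $\mathfrak p_i$ ($i=1,2$) is $3$; (3) $\mathrm{Gal}(\mathfrak R_\theta/k)$ is isomorphic to $N_3(\mathbb F_3)$.
   Context: $k=\mathbb Q(\zeta_3)$, $\zeta_3=\frac{-1+\sqrt{-3}}{2}$, $\mathcal O_k=\mathbb Z[\zeta_3]$. Let $\mathfrak p_1,\mathfrak p_2$ be distinct finite primes of $k$ not above $3$ with $\mathrm N\mathfrak p_i\equiv1\bmod9$, and $\pi_i\in\mathcal O_k$ the unique generators of $\mathfrak p_i$ with $\pi_i\equiv1\bmod(3\sqrt{-3})$. Assume $\pi_1$ is a cube in $k_{\mathfrak p_2}^\times$ and $\pi_2$ is a cube in $k_{\mathfrak p_1}^\times$. Let $K_1=k(\sqrt[3]{\pi_1})$ and $\tau\in\mathrm{Gal}(K_1/k)$ with $\tau(\sqrt[3]{\pi_1})=\zeta_3\sqrt[3]{\pi_1}$. Fix a prime $\mathfrak P$ of $K_1$ over $\mathfrak p_2$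 and set $\mathfrak P^{(1)}=\mathfrak P$, $\mathfrak P^{(2)}=\tau(\mathfrak P)$, $\mathfrak P^{(3)}=\tau^2(\mathfrak P)$ (the three primes of $K_1$ above $\mathfrak p_2$). Call $\theta\in\mathcal O_{K_1}$ admissible if $\theta=\zeta_3^c\,\alpha^2\tau(\alpha)$ for some $c\in\{0,1,2\}$ and some $\alpha\in\mathcal O_{K_1}$ with $\mathrm N_{K_1/k}(\alpha)=\pi_2\beta^3$ for some $\beta\in k$ and $(\alpha)=\mathfrak P^a\mathfrak B^b$ with $3\nmid a$, $\mathfrak B$ an ideal coprime to $3$, $3\mid b$; and moreover there exists $\eta\in\mathcal O_{K_1}$ with $\eta^3\equiv\theta\bmod (3\sqrt{-3})\mathcal O_{K_1}$. $N_3(\mathbb F_3)$ is the group of $3\times3$ upper triangular unipotent matrices over $\mathbb F_3$. *)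

theory Defs
  imports "HOL-Analysis.Analysis" "HOL-Library.Numeral_Type" "HOL-Algebra.Group"
begin

text \<open>All number fields are realised as subfields of the complex numbers.\<close>

definition zeta3 :: complex where
  "zeta3 = (-1 + \<i> * complex_of_real (sqrt 3)) / 2"

definition sqrt_m3 :: complex where
  "sqrt_m3 = \<i> * complex_of_real (sqrt 3)"

definition alg_int :: "complex \<Rightarrow> bool" where
  "alg_int x \<longleftrightarrow> (\<exists>p :: int poly. lead_coeff p = 1 \<and> poly (map_poly of_int p) x = 0)"

definition is_subfield :: "complex set \<Rightarrow> bool" where
  "is_subfield F \<longleftrightarrow> 0 \<in> F \<and> 1 \<in> F \<and> (\<forall>x\<in>F. \<forall>y\<in>F. x + y \<in> F \<and> x - y \<in> F \<and> x * y \<in> F)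
     \<and> (\<forall>x\<in>F. x \<noteq> 0 \<longrightarrow> inverse x \<in> F)"

definition gen_field :: "complex set \<Rightarrow> complex set" where
  "gen_field S = \<Inter> {F. is_subfield F \<and> S \<subseteq> F}"

definition kk :: "complex set" where
  "kk = gen_field {zeta3}"

definition intO :: "complex set \<Rightarrow> complex set" where
  "intO F = {x \<in> F. alg_int x}"

definition ideal_in :: "complex set \<Rightarrow> complex set \<Rightarrow> bool" where
  "ideal_in S I \<longleftrightarrow> I \<subseteq> S \<and> 0 \<in> I \<and> (\<forall>x\<in>I. \<forall>y\<in>I. x + y \<in> I) \<and> (\<forall>r\<in>S. \<forall>x\<in>I. r * x \<in> I)"

definition gen_ideal :: "complex set \<Rightarrow> complex set \<Rightarrow> complex set" where
  "gen_ideal S X = \<Inter> {I. ideal_in S I \<and> X \<subseteq> I}"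

definition principal :: "complex set \<Rightarrow> complex \<Rightarrow> complex set" where
  "principal S a = {r * a | r. r \<in> S}"

definition imult :: "complex set \<Rightarrow> complex set \<Rightarrow> complex set \<Rightarrow> complex set" where
  "imult S I J = gen_ideal S {a * b | a b. a \<in> I \<and> b \<in> J}"

definition ipow :: "complex set \<Rightarrow> complex set \<Rightarrow> nat \<Rightarrow> complex set" where
  "ipow S I n = ((imult S I) ^^ n) S"

definition prime_ideal_in :: "complex set \<Rightarrow> complex set \<Rightarrow> bool" where
  "prime_ideal_in S P \<longleftrightarrow> ideal_in S P \<and> P \<noteq> S \<and> P \<noteq> {0} \<and>
     (\<forall>a\<in>S. \<forall>b\<in>S. a * b \<in> P \<longrightarrow> a \<in> P \<or> b \<in> P)"

definition ideal_norm :: "complex set \<Rightarrow> complex set \<Rightarrow> nat" where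
  "ideal_norm S I = card ((\<lambda>x. (\<lambda>y. x + y) ` I) ` S)"

definition ram_index :: "complex set \<Rightarrow> complex set \<Rightarrow> complex set \<Rightarrow> nat" where
  "ram_index S Q p = (GREATEST e. gen_ideal S p \<subseteq> ipow S Q e)"

text \<open>For \<open>x \<in> O_k\<close> and a finite prime \<open>p\<close> of \<open>O_k\<close>: \<open>x\<close> is a cube in the completion \<open>k_p\<close>.
  Since \<open>O_k\<close> is dense in the compact ring \<open>O_p\<close> and \<open>O_p\<close> is integrally closed, this holds
  iff \<open>x\<close> is a \<open>p\<close>-adic limit of cubes of elements of \<open>O_k\<close>.\<close>
definition local_cube :: "complex set \<Rightarrow> complex set \<Rightarrow> complex \<Rightarrow> bool" where
  "local_cube S p x \<longleftrightarrow> (\<forall>n. \<exists>y\<in>S. x - y ^ 3 \<in> ipow S p n)"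

definition Aut :: "complex set \<Rightarrow> complex set \<Rightarrow> (complex \<Rightarrow> complex) set" where
  "Aut F E = {\<sigma>. \<sigma> \<in> extensional E \<and> bij_betw \<sigma> E E \<and>
     (\<forall>x\<in>E. \<forall>y\<in>E. \<sigma> (x + y) = \<sigma> x + \<sigma> y \<and> \<sigma> (x * y) = \<sigma> x * \<sigma> y) \<and> \<sigma> 1 = 1 \<and>
     (\<forall>x\<in>F. \<sigma> x = x)}"

definition finite_ext :: "complex set \<Rightarrow> complex set \<Rightarrow> bool" where
  "finite_ext F E \<longleftrightarrow> (\<exists>B. finite B \<and> B \<subseteq> E \<and>
     E = {(\<Sum>b\<in>B. c b * b) | c. \<forall>b\<in>B. c b \<in> F})"

definition galois_ext :: "complex set \<Rightarrow> complex set \<Rightarrow> bool" where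
  "galois_ext F E \<longleftrightarrow> is_subfield F \<and> is_subfield E \<and> F \<subseteq> E \<and> finite_ext F E \<and>
     {x \<in> E. \<forall>\<sigma>\<in>Aut F E. \<sigma> x = x} = F"

definition Gal :: "complex set \<Rightarrow> complex set \<Rightarrow> (complex \<Rightarrow> complex) monoid" where
  "Gal F E = \<lparr>carrier = Aut F E, mult = (\<lambda>\<sigma> \<tau>. restrict (\<sigma> \<circ> \<tau>) E), one = restrict id E\<rparr>"

definition rel_norm :: "complex set \<Rightarrow> complex set \<Rightarrow> complex \<Rightarrow> complex" where
  "rel_norm F E a = (\<Prod>\<sigma>\<in>Aut F E. \<sigma> a)"

definition N3F3 :: "((3 ^ 3) ^ 3) monoid" where
  "N3F3 = \<lparr>carrier = {A. \<forall>i j. (j < i \<longrightarrow> A $ i $ j = 0) \<and> (i = j \<longrightarrow> A $ i $ j = 1)},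
           mult = (\<lambda>A B. A ** B), one = mat 1\<rparr>"

definition admissible ::
  "complex \<Rightarrow> complex set \<Rightarrow> (complex \<Rightarrow> complex) \<Rightarrow> complex set \<Rightarrow> complex \<Rightarrow> bool" where
  "admissible \<pi>2 K1 \<tau> P \<theta> \<longleftrightarrow> \<theta> \<in> intO K1 \<and>
     (\<exists>c::nat. \<exists>\<alpha>\<in>intO K1. c < 3 \<and> \<theta> = zeta3 ^ c * \<alpha>\<^sup>2 * \<tau> \<alpha> \<and>
        (\<exists>\<beta>\<in>kk. rel_norm kk K1 \<alpha> = \<pi>2 * \<beta> ^ 3) \<and>
        (\<exists>a b :: nat. \<exists>B. \<not> 3 dvd a \<and> 3 dvd b \<and> ideal_in (intO K1) B \<and> B \<noteq> {0} \<and>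
           gen_ideal (intO K1) (B \<union> principal (intO K1) 3) = intO K1 \<and>
           principal (intO K1) \<alpha> = imult (intO K1) (ipow (intO K1) P a) (ipow (intO K1) B b))) \<and>
     (\<exists>\<eta>\<in>intO K1. \<eta> ^ 3 - \<theta> \<in> principal (intO K1) (3 * sqrt_m3))"

end

theory Submission
  imports Defs "Jordan_Normal_Form.Char_Poly"
begin

text \<open>
  The field \<open>R\<close> is a tower of three cubic Kummer extensions. Since
  \<open>\<tau> \<theta> / \<theta> = N \<alpha> / \<alpha> ^ 3\<close> equals \<open>\<pi>2\<close> up to a cube, every automorphism of
  \<open>k(r1, r2)\<close> extends to \<open>R\<close>; the extension of \<open>r1 \<mapsto> zeta3 * r1\<close> multiplies \<open>t\<close> by
  \<open>r2 * \<beta> / \<alpha>\<close>, which the automorphism \<open>r2 \<mapsto> zeta3 * r2\<close> does not fix, and this gives the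
  Heisenberg group.

  For the ramification no Dedekind theory is needed: it suffices that the prime \<open>Q\<close> is generated
  locally by an element \<open>w\<close> with \<open>w ^ e\<close> a generator of \<open>Q \<inter> Ok\<close>. Such a \<open>w\<close> exists
  in \<open>k(r1)\<close> above \<open>\<pi>1\<close>, in \<open>k(r2)\<close> above \<open>\<pi>2\<close>, and in \<open>k\<close> otherwise, and a trace
  argument transports it to \<open>R\<close> once every nontrivial automorphism \<open>\<sigma>\<close> over that field moves
  some integer \<open>y\<close> modulo \<open>Q\<close>. For the automorphisms moving only \<open>t\<close>, such a
  \<open>y\<close> comes from the congruence \<open>\<eta> ^ 3 \<equiv> \<theta>\<close> above 3, and elsewhere from a conjugate of
  \<open>\<theta>\<close> that is a unit times a cube at \<open>Q\<close>.
\<close>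

section \<open>Algebraic integers\<close>

text \<open>The delicate generator is \<open>t\<close>. At primes above p2 the valuation of \<theta>
  need not be divisible by 3, because P divides \<alpha> to an exponent prime to 3. However,
  \<open>T i * t\<close>, with \<open>T i\<close> in k(r1, r2), is a cube root of the i-th conjugate
  of \<theta>, and an automorphism over k(r1, r2) multiplies it by the same root of unity as
  \<open>t\<close>. So any one conjugate of \<theta> may be tested, and the norm condition on
  \<alpha> forces one of the three to have valuation divisible by 3. Valuations are therefore needed
  only in k and k(r1), where uniformizers are explicit; their existence is inherited through the
  norm from the Euclidean ring of Eisenstein integers. In R itself, powers of Q are controlled only
  by their containment in the local multiples of powers of w. The base fields reflect inertia: above
  p1 or p2 the automorphisms that may act trivially modulo Q are those moving the corresponding
  root, so the field generated by this root is taken as base and the automorphisms over it are shown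
  to act nontrivially.\<close>

lemma alg_int_iff: "alg_int x \<longleftrightarrow> algebraic_int x"
  unfolding alg_int_def algebraic_int_altdef_ipoly by auto

text \<open>The determinant trick: \<open>v\<close> is an eigenvector of an integer matrix, so
  \<open>x\<close> is a root of its characteristic polynomial, which is monic with integer
  coefficients.\<close>

lemma alg_int_of_eigenvalue:
  fixes v :: "nat \<Rightarrow> complex" and A :: "nat \<Rightarrow> nat \<Rightarrow> int"
  assumes eq: "\<And>i. i < n \<Longrightarrow> x * v i = (\<Sum>j<n. of_int (A i j) * v j)"
    and nz: "i0 < n" "v i0 \<noteq> 0"
  shows "alg_int x"
proof -
  let ?A = "Matrix.mat n n (\<lambda>(i,j). A i j)"
  let ?B = "map_mat (of_int :: int \<Rightarrow> complex) ?A"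
  let ?v = "Matrix.vec n v"
  have B: "?B \<in> carrier_mat n n" by simp
  have "eigenvector ?B ?v x"
    unfolding eigenvector_def
  proof (intro conjI)
    show "?v \<in> carrier_vec (dim_row ?B)" by simp
    show "?v \<noteq> 0\<^sub>v (dim_row ?B)"
      using nz by (metis dim_row_mat(1) index_map_mat(2) index_vec index_zero_vec(1))
    show "?B *\<^sub>v ?v = x \<cdot>\<^sub>v ?v"
      by (rule eq_vecI) (auto simp: scalar_prod_def eq lessThan_atLeast0)
  qed
  hence "poly (char_poly ?B) x = 0"
    using eigenvalue_root_char_poly[OF B] unfolding eigenvalue_def by blast
  moreover have "char_poly ?B = map_poly of_int (char_poly ?A)"
    by (rule of_int_hom.char_poly_hom[of _ n]) simp
  moreover have "lead_coeff (char_poly ?A) = 1"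
    using degree_monic_char_poly[of ?A n] by simp
  ultimately show ?thesis unfolding alg_int_def by auto
qed

section \<open>Rings of complex numbers that are finitely generated as abelian groups\<close>

definition is_subring :: "complex set \<Rightarrow> bool" where
  "is_subring S \<longleftrightarrow> 0 \<in> S \<and> 1 \<in> S \<and> (\<forall>x\<in>S. \<forall>y\<in>S. x + y \<in> S \<and> x - y \<in> S \<and> x * y \<in> S)"

lemma is_subringD:
  assumes "is_subring S"
  shows "0 \<in> S" "1 \<in> S" "\<And>x y. x \<in> S \<Longrightarrow> y \<in> S \<Longrightarrow> x + y \<in> S"
    "\<And>x y. x \<in> S \<Longrightarrow> y \<in> S \<Longrightarrow> x - y \<in> S" "\<And>x y. x \<in> S \<Longrightarrow> y \<in> S \<Longrightarrow> x * y \<in> S"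
    "\<And>x. x \<in> S \<Longrightarrow> - x \<in> S" "\<And>x n. x \<in> S \<Longrightarrow> x ^ n \<in> S"
    "\<And>f A. (\<And>a. a \<in> A \<Longrightarrow> f a \<in> S) \<Longrightarrow> sum f A \<in> S"
    "\<And>f A. (\<And>a. a \<in> A \<Longrightarrow> f a \<in> S) \<Longrightarrow> prod f A \<in> S"
proof -
  show basic: "0 \<in> S" "1 \<in> S" "\<And>x y. x \<in> S \<Longrightarrow> y \<in> S \<Longrightarrow> x + y \<in> S"
    "\<And>x y. x \<in> S \<Longrightarrow> y \<in> S \<Longrightarrow> x - y \<in> S" "\<And>x y. x \<in> S \<Longrightarrow> y \<in> S \<Longrightarrow> x * y \<in> S"
    using assms unfolding is_subring_def by auto
  show "\<And>x. x \<in> S \<Longrightarrow> - x \<in> S" using basic(1,4) by (metis diff_0)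
  show "x ^ n \<in> S" if "x \<in> S" for x n using that by (induction n) (auto intro: basic)
  show "sum f A \<in> S" if "\<And>a. a \<in> A \<Longrightarrow> f a \<in> S" for f and A :: "'a set"
    using that by (induction A rule: infinite_finite_induct) (auto intro: basic)
  show "prod f A \<in> S" if "\<And>a. a \<in> A \<Longrightarrow> f a \<in> S" for f and A :: "'b set"
    using that by (induction A rule: infinite_finite_induct) (auto intro: basic)
qed

text \<open>The sum runs over all of \<open>B\<close>, as in \<open>finite_ext\<close>; it is 0 for
  infinite \<open>B\<close>, so this is the usual span only when \<open>B\<close> is finite.\<close>

definition lin_span :: "complex set \<Rightarrow> complex set \<Rightarrow> complex set" where
  "lin_span S B = {(\<Sum>b\<in>B. c b * b) | c. \<forall>b\<in>B. c b \<in> S}"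

lemma lin_spanE:
  assumes "x \<in> lin_span S B"
  obtains c where "\<forall>b\<in>B. c b \<in> S" "x = (\<Sum>b\<in>B. c b * b)"
  using assms unfolding lin_span_def by blast

lemma lin_span_add:
  assumes "is_subring S" "x \<in> lin_span S B" "y \<in> lin_span S B" shows "x + y \<in> lin_span S B"
proof -
  obtain c d where "\<forall>b\<in>B. c b \<in> S" "x = (\<Sum>b\<in>B. c b * b)" "\<forall>b\<in>B. d b \<in> S" "y = (\<Sum>b\<in>B. d b * b)"
    using assms unfolding lin_span_def by blast
  thus ?thesis unfolding lin_span_def
    by (auto intro!: exI[of _ "\<lambda>b. c b + d b"] is_subringD[OF assms(1)]
             simp: algebra_simps sum.distrib)
qed

lemma lin_span_scale:
  assumes "is_subring S" "a \<in> S" "x \<in> lin_span S B" shows "a * x \<in> lin_span S B"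
proof -
  obtain c where "\<forall>b\<in>B. c b \<in> S" "x = (\<Sum>b\<in>B. c b * b)"
    using assms unfolding lin_span_def by blast
  thus ?thesis unfolding lin_span_def
    by (auto intro!: exI[of _ "\<lambda>b. a * c b"] is_subringD[OF assms(1)] assms(2)
             simp: sum_distrib_left mult.assoc)
qed

lemma lin_span_0: "is_subring S \<Longrightarrow> 0 \<in> lin_span S B"
  unfolding lin_span_def by (auto intro!: exI[of _ "\<lambda>_. 0"] is_subringD)

lemma lin_span_base:
  assumes "is_subring S" "finite B" "b \<in> B" shows "b \<in> lin_span S B"
proof -
  have "(\<Sum>a\<in>B. (if a = b then 1 else 0) * a) = (\<Sum>a\<in>B. if a = b then a else 0)"
    by (rule sum.cong) auto
  also have "\<dots> = b" using assms by simp
  finally show ?thesis unfolding lin_span_def using is_subringD(1,2)[OF assms(1)]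
    by (auto intro!: exI[of _ "\<lambda>a. if a = b then 1 else 0"])
qed

lemma lin_span_subset:
  assumes "0 \<in> N" "\<And>x y. x \<in> N \<Longrightarrow> y \<in> N \<Longrightarrow> x + y \<in> N" "\<And>a b. a \<in> S \<Longrightarrow> b \<in> B \<Longrightarrow> a * b \<in> N"
  shows "lin_span S B \<subseteq> N"
proof -
  have "sum f A \<in> N" if "\<And>a. a \<in> A \<Longrightarrow> f a \<in> N" for f and A :: "complex set"
    using that by (induction A rule: infinite_finite_induct) (auto intro: assms)
  thus ?thesis using assms(3) by (auto elim!: lin_spanE)
qed

text \<open>Serves twice: to keep a ring finitely generated over the integers when a root is
  adjoined, and to show that the tower of three cubic extensions is finite.\<close>

lemma lin_span_trans:
  assumes S: "is_subring S" and fin: "finite B" "finite D"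
  shows "lin_span (lin_span S B) D = lin_span S ((\<lambda>(b,d). b * d) ` (B \<times> D))" (is "?L = ?R")
proof
  have finBD: "finite ((\<lambda>(b,d). b * d) ` (B \<times> D))" using fin by simp
  show "?L \<subseteq> ?R"
  proof (rule lin_span_subset)
    fix a d assume ad: "a \<in> lin_span S B" "d \<in> D"
    have "lin_span S B \<subseteq> {a. a * d \<in> ?R}"
    proof (rule lin_span_subset)
      fix s b assume sb: "s \<in> S" "b \<in> B"
      have "b * d \<in> ?R" by (rule lin_span_base[OF S finBD]) (use sb ad in auto)
      from lin_span_scale[OF S sb(1) this] show "s * b \<in> {a. a * d \<in> ?R}" by (simp add: mult.assoc)
    qed (auto simp: lin_span_0[OF S] distrib_right intro: lin_span_add[OF S])
    with ad show "a * d \<in> ?R" by blast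
  qed (auto simp: lin_span_0[OF S] intro: lin_span_add[OF S])
  show "?R \<subseteq> ?L"
  proof (rule lin_span_subset)
    \<comment> \<open>\<open>lin_span S B\<close> is not assumed to be a ring, so the closure lemmas
      for spans do not apply to the outer span; its closure under addition is checked
      directly.\<close>
    have "0 = (\<Sum>b\<in>D. 0 * b)" "\<forall>b\<in>D. 0 \<in> lin_span S B" using lin_span_0[OF S] by auto
    thus "0 \<in> ?L" unfolding lin_span_def[of _ D] mem_Collect_eq by (intro exI conjI)
    show "x + y \<in> ?L" if "x \<in> ?L" "y \<in> ?L" for x y
    proof -
      obtain c where c: "\<forall>b\<in>D. c b \<in> lin_span S B" "x = (\<Sum>b\<in>D. c b * b)"
        using \<open>x \<in> ?L\<close> by (rule lin_spanE)
      obtain e where e: "\<forall>b\<in>D. e b \<in> lin_span S B" "y = (\<Sum>b\<in>D. e b * b)"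
        using \<open>y \<in> ?L\<close> by (rule lin_spanE)
      have "x + y = (\<Sum>b\<in>D. (c b + e b) * b)"
        unfolding c(2) e(2) by (simp add: distrib_right sum.distrib)
      moreover have "\<forall>b\<in>D. c b + e b \<in> lin_span S B" using c(1) e(1) lin_span_add[OF S] by blast
      ultimately show ?thesis unfolding lin_span_def[of _ D] mem_Collect_eq by (intro exI conjI)
    qed
    fix a x assume "a \<in> S" "x \<in> (\<lambda>(b,d). b * d) ` (B \<times> D)"
    then obtain b d where bd: "a \<in> S" "b \<in> B" "d \<in> D" "x = b * d" by auto
    have ab: "a * b \<in> lin_span S B" using bd by (intro lin_span_scale[OF S] lin_span_base[OF S fin(1)])
    have "(\<Sum>e\<in>D. (if e = d then a * b else 0) * e) = (\<Sum>e\<in>D. if e = d then a * b * e else 0)"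
      by (rule sum.cong) auto
    also have "\<dots> = a * x" using bd fin by (simp add: mult.assoc)
    finally have "a * x = (\<Sum>e\<in>D. (if e = d then a * b else 0) * e)" by simp
    moreover have "\<forall>e\<in>D. (if e = d then a * b else 0) \<in> lin_span S B"
      using ab lin_span_0[OF S] by simp
    ultimately show "a * x \<in> ?L" unfolding lin_span_def[of _ D] mem_Collect_eq by (intro exI conjI)
  qed
qed

definition fg_ring :: "complex set \<Rightarrow> bool" where
  "fg_ring M \<longleftrightarrow> is_subring M \<and> (\<exists>B. finite B \<and> M = lin_span \<int> B)"

lemma is_subring_Ints: "is_subring \<int>"
  unfolding is_subring_def by auto

text \<open>Multiplication by \<open>x\<close> expresses each generator of \<open>M\<close> as an
  integral combination of generators; these are not all 0, because \<open>M\<close> contains 1, so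
  the determinant trick applies.\<close>

lemma fg_ring_alg_int:
  assumes "fg_ring M" "x \<in> M" shows "alg_int x"
proof -
  obtain B where M: "is_subring M" "finite B" "M = lin_span \<int> B"
    using assms unfolding fg_ring_def by blast
  obtain f where f: "bij_betw f {..<card B} B"
    using ex_bij_betw_nat_finite[OF M(2)] by (auto simp: lessThan_atLeast0)
  have BM: "b \<in> M" if "b \<in> B" for b
    using lin_span_base[OF is_subring_Ints M(2) that] M(3) by simp
  have "\<exists>A. x * f i = (\<Sum>j<card B. of_int (A j) * f j)" if "i < card B" for i
  proof -
    have "f i \<in> B" using f that by (auto simp: bij_betw_def)
    hence "x * f i \<in> M" using assms(2) BM is_subringD[OF M(1)] by blast
    then obtain c where c: "\<forall>b\<in>B. c b \<in> \<int>" "x * f i = (\<Sum>b\<in>B. c b * b)"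
      using M(3) unfolding lin_span_def by blast
    have "(\<Sum>b\<in>B. c b * b) = (\<Sum>j<card B. c (f j) * f j)"
      using sum.reindex_bij_betw[OF f, of "\<lambda>b. c b * b"] by simp
    also have "\<dots> = (\<Sum>j<card B. of_int \<lfloor>Re (c (f j))\<rfloor> * f j)"
    proof (rule sum.cong)
      fix j assume "j \<in> {..<card B}"
      hence "f j \<in> B" using f by (auto simp: bij_betw_def)
      hence "c (f j) \<in> \<int>" using c by blast
      thus "c (f j) * f j = of_int \<lfloor>Re (c (f j))\<rfloor> * f j" by (auto elim!: Ints_cases)
    qed simp
    finally show ?thesis using c(2) by (intro exI[of _ "\<lambda>j. \<lfloor>Re (c (f j))\<rfloor>"]) simp
  qed
  then obtain A where A: "\<And>i. i < card B \<Longrightarrow> x * f i = (\<Sum>j<card B. of_int (A i j) * f j)" by metis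
  have "\<exists>i<card B. f i \<noteq> 0"
  proof (rule ccontr)
    assume *: "\<not> ?thesis"
    have "b = 0" if "b \<in> B" for b
    proof -
      from that f obtain i where "i < card B" "b = f i" unfolding bij_betw_def by blast
      thus ?thesis using * by auto
    qed
    hence "M \<subseteq> {0}" unfolding M(3) lin_span_def by (auto intro!: sum.neutral)
    thus False using is_subringD(2)[OF M(1)] by auto
  qed
  then obtain i where "i < card B" "f i \<noteq> 0" by blast
  thus ?thesis using alg_int_of_eigenvalue[of "card B" x f A i] A by blast
qed

text \<open>The monic equation of degree d rewrites \<open>x ^ d\<close> through lower powers, so
  the \<open>M\<close>-span of the powers below d is closed under multiplication by
  \<open>x\<close>, hence a ring. Transitivity of spans makes it finitely generated over the
  integers.\<close>

lemma fg_ring_adjoin_root: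
  assumes M: "fg_ring M" and p: "lead_coeff p = 1" "\<And>i. coeff p i \<in> M" "poly p x = 0"
  shows "\<exists>M'. fg_ring M' \<and> M \<subseteq> M' \<and> x \<in> M'"
proof -
  define d where "d = degree p"
  define D where "D = (\<lambda>i. x ^ i) ` {..<d}"
  define N where "N = lin_span M D"
  obtain B where B: "finite B" "M = lin_span \<int> B" using M unfolding fg_ring_def by blast
  have Mr: "is_subring M" using M unfolding fg_ring_def by blast
  have d: "d > 0"
  proof (rule ccontr)
    assume "\<not> d > 0"
    hence "degree p = 0" unfolding d_def by simp
    then obtain a where "p = [:a:]" using degree_eq_zeroE by blast
    thus False using p by simp
  qed
  have fD: "finite D" unfolding D_def by simp
  note N_add = lin_span_add[OF Mr, of _ D, folded N_def]
  note N_scale = lin_span_scale[OF Mr, of _ _ D, folded N_def]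
  have N0: "0 \<in> N" unfolding N_def by (rule lin_span_0[OF Mr])
  have N_base: "x ^ i \<in> N" if "i < d" for i
    unfolding N_def by (rule lin_span_base[OF Mr fD]) (use that in \<open>auto simp: D_def\<close>)
  have N_sum: "sum f A \<in> N" if "\<And>a. a \<in> A \<Longrightarrow> f a \<in> N" for f and A :: "nat set"
    using that by (induction A rule: infinite_finite_induct) (auto intro: N0 N_add)
  have xd: "x ^ d \<in> N"
  proof -
    have "0 = (\<Sum>i\<le>d. coeff p i * x ^ i)" using p(3) by (simp add: poly_altdef d_def)
    also have "\<dots> = (\<Sum>i<d. coeff p i * x ^ i) + x ^ d"
      using p(1) by (simp add: d_def lessThan_Suc_atMost[symmetric])
    finally have "x ^ d = (\<Sum>i<d. (- coeff p i) * x ^ i)"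
      by (simp add: sum_negf eq_neg_iff_add_eq_0 add.commute)
    also have "\<dots> \<in> N"
      by (rule N_sum) (intro N_scale N_base is_subringD(6)[OF Mr] p(2), simp)
    finally show ?thesis .
  qed
  have xN: "x * y \<in> N" if "y \<in> N" for y
  proof -
    have "N \<subseteq> {y. x * y \<in> N}" unfolding N_def[of]
    proof (subst N_def[symmetric], rule lin_span_subset, goal_cases)
      case (3 a b)
      then obtain i where i: "i < d" "b = x ^ i" unfolding D_def by auto
      have "x ^ Suc i \<in> N" using i xd N_base[of "Suc i"] by (cases "Suc i = d") auto
      from N_scale[OF 3(1) this] show ?case using i by (simp add: mult_ac N_def)
    qed (auto simp: N0 distrib_left intro: N_add)
    thus ?thesis using that by blast
  qed
  have xiN: "x ^ i * y \<in> N" if "y \<in> N" for i y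
    using that by (induction i) (auto simp: mult.assoc intro: xN)
  have mult: "z * y \<in> N" if zy: "z \<in> N" "y \<in> N" for z y
  proof -
    have "lin_span M D \<subseteq> {z. z * y \<in> N}"
    proof (rule lin_span_subset)
      fix a b assume "a \<in> M" "b \<in> D"
      thus "a * b \<in> {z. z * y \<in> N}"
        using N_scale xiN[OF zy(2)] by (auto simp: D_def mult.assoc)
    qed (auto simp: N0 distrib_right intro: N_add)
    thus ?thesis using zy unfolding N_def by blast
  qed
  have one: "1 \<in> N" using N_base[of 0] d by simp
  have MN: "M \<subseteq> N" using N_scale[OF _ one] by auto
  have "is_subring N" unfolding is_subring_def
  proof (intro conjI ballI)
    fix a b assume ab: "a \<in> N" "b \<in> N"
    have "(-1) * b \<in> N" by (rule N_scale[OF _ ab(2)]) (simp add: is_subringD[OF Mr])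
    from N_add[OF ab(1) this] show "a - b \<in> N" by simp
  qed (auto intro: N0 one N_add mult)
  moreover have "N = lin_span \<int> ((\<lambda>(b,d). b * d) ` (B \<times> D))"
    unfolding N_def by (subst B(2)) (rule lin_span_trans[OF is_subring_Ints B(1) fD])
  moreover have "finite ((\<lambda>(b,d). b * d) ` (B \<times> D))" using B(1) fD by simp
  ultimately have "fg_ring N" unfolding fg_ring_def by blast
  moreover have "x \<in> N" using xN[OF one] by simp
  ultimately show ?thesis using MN by blast
qed

lemma fg_ring_Ints: "fg_ring \<int>"
proof -
  have "\<int> = lin_span \<int> {1}" unfolding lin_span_def by auto
  thus ?thesis unfolding fg_ring_def using is_subring_Ints by blast
qed

lemma fg_ring_containing:
  assumes "finite T" "\<And>x. x \<in> T \<Longrightarrow> alg_int x"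
  shows "\<exists>M. fg_ring M \<and> T \<subseteq> M"
  using assms
proof (induction T rule: finite_induct)
  case empty thus ?case using fg_ring_Ints by blast
next
  case (insert x T)
  then obtain M where M: "fg_ring M" "T \<subseteq> M" by auto
  have "algebraic_int x" using insert.prems alg_int_iff by blast
  then obtain p where p: "lead_coeff p = 1" "\<forall>i. coeff p i \<in> \<int>" "poly p x = 0"
    by (auto elim: algebraic_int.cases)
  have "\<int> \<subseteq> M"
  proof
    fix a :: complex assume "a \<in> \<int>"
    have Mr: "is_subring M" using M(1) unfolding fg_ring_def by blast
    note R = is_subringD[OF Mr]
    have n: "of_nat n \<in> M" for n by (induction n) (auto intro: R)
    from \<open>a \<in> \<int>\<close> obtain k where "a = of_int k" by (auto elim: Ints_cases)
    thus "a \<in> M" using n R(6) by (cases k rule: int_cases2) auto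
  qed
  hence "\<exists>M'. fg_ring M' \<and> M \<subseteq> M' \<and> x \<in> M'"
    using fg_ring_adjoin_root[OF M(1) p(1) _ p(3)] p(2) by blast
  thus ?case using M(2) by blast
qed

text \<open>Transitivity of integrality: the finitely many coefficients lie in one finitely
  generated ring, to which the root can be adjoined.\<close>

lemma alg_int_monic_root:
  assumes p: "lead_coeff p = 1" "\<And>i. alg_int (coeff p i)" "poly p x = 0"
  shows "alg_int x"
proof -
  have fin: "finite (insert 0 (set (coeffs p)))" by simp
  have a: "y \<in> insert 0 (set (coeffs p)) \<Longrightarrow> alg_int y" for y
    using p(2) unfolding range_coeff[symmetric] by blast
  obtain M where M: "fg_ring M" "insert 0 (set (coeffs p)) \<subseteq> M"
    using fg_ring_containing[OF fin a] by blast
  have "coeff p i \<in> M" for i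
    using M(2) range_coeff[of p] by blast
  from fg_ring_adjoin_root[OF M(1) p(1) this p(3)] show ?thesis
    using fg_ring_alg_int by blast
qed

lemma alg_int_ring:
  assumes "alg_int x" "alg_int y"
  shows "alg_int (x + y)" "alg_int (x - y)" "alg_int (x * y)"
proof -
  obtain M where M: "fg_ring M" "{x, y} \<subseteq> M"
    using fg_ring_containing[of "{x, y}"] assms by auto
  hence "is_subring M" unfolding fg_ring_def by blast
  from is_subringD[OF this] M(2) have "x + y \<in> M" "x - y \<in> M" "x * y \<in> M" by auto
  thus "alg_int (x + y)" "alg_int (x - y)" "alg_int (x * y)"
    using fg_ring_alg_int[OF M(1)] by auto
qed

lemma alg_int_of_int [simp]: "alg_int (of_int n)"
  unfolding alg_int_iff by (rule int_imp_algebraic_int) simp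

lemma alg_int_simps [simp]: "alg_int 0" "alg_int 1" "alg_int (numeral n)"
  using alg_int_of_int[of 0] alg_int_of_int[of 1] alg_int_of_int[of "numeral n"] by simp_all

lemma is_subring_alg_int: "is_subring {x. alg_int x}"
  unfolding is_subring_def using alg_int_ring by auto

lemma alg_int_root:
  assumes "alg_int (x ^ n)" "n > 0" shows "alg_int x"
proof (rule alg_int_monic_root)
  let ?p = "monom 1 n - [:x ^ n:]"
  have c: "coeff ?p i = (if i = n then 1 else if i = 0 then - (x ^ n) else 0)" for i
    using assms(2) by (cases i) auto
  have "degree ?p = n"
  proof (rule antisym)
    have "\<forall>i>n. coeff ?p i = 0" unfolding c by simp
    thus "degree ?p \<le> n" by (rule degree_le)
    show "n \<le> degree ?p" by (rule le_degree) (unfold c, simp)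
  qed
  thus "lead_coeff ?p = 1" unfolding c by simp
  show "poly ?p x = 0" by (simp add: poly_monom)
  have "alg_int (- (x ^ n))" using is_subringD(6)[OF is_subring_alg_int] assms by simp
  thus "alg_int (coeff ?p i)" for i unfolding c by simp
qed

section \<open>Subfields of the complex numbers\<close>

lemma is_subfield_imp_subring: "is_subfield F \<Longrightarrow> is_subring F"
  unfolding is_subfield_def is_subring_def by auto

lemma is_subfieldD:
  assumes "is_subfield F"
  shows "0 \<in> F" "1 \<in> F" "\<And>x y. x \<in> F \<Longrightarrow> y \<in> F \<Longrightarrow> x + y \<in> F"
    "\<And>x y. x \<in> F \<Longrightarrow> y \<in> F \<Longrightarrow> x - y \<in> F" "\<And>x y. x \<in> F \<Longrightarrow> y \<in> F \<Longrightarrow> x * y \<in> F"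
    "\<And>x. x \<in> F \<Longrightarrow> - x \<in> F" "\<And>x n. x \<in> F \<Longrightarrow> x ^ n \<in> F"
    "\<And>f A. (\<And>a. a \<in> A \<Longrightarrow> f a \<in> F) \<Longrightarrow> sum f A \<in> F"
    "\<And>f A. (\<And>a. a \<in> A \<Longrightarrow> f a \<in> F) \<Longrightarrow> prod f A \<in> F"
    "\<And>x. x \<in> F \<Longrightarrow> inverse x \<in> F" "\<And>x y. x \<in> F \<Longrightarrow> y \<in> F \<Longrightarrow> x / y \<in> F"
    "\<And>n. of_int n \<in> F" "\<And>n. numeral n \<in> F"
proof -
  note R = is_subringD[OF is_subfield_imp_subring[OF assms]]
  show "0 \<in> F" "1 \<in> F" "\<And>x y. x \<in> F \<Longrightarrow> y \<in> F \<Longrightarrow> x + y \<in> F"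
    "\<And>x y. x \<in> F \<Longrightarrow> y \<in> F \<Longrightarrow> x - y \<in> F" "\<And>x y. x \<in> F \<Longrightarrow> y \<in> F \<Longrightarrow> x * y \<in> F"
    "\<And>x. x \<in> F \<Longrightarrow> - x \<in> F" "\<And>x n. x \<in> F \<Longrightarrow> x ^ n \<in> F"
    "\<And>f A. (\<And>a. a \<in> A \<Longrightarrow> f a \<in> F) \<Longrightarrow> sum f A \<in> F"
    "\<And>f A. (\<And>a. a \<in> A \<Longrightarrow> f a \<in> F) \<Longrightarrow> prod f A \<in> F"
    by (fact R)+
  show inv: "inverse x \<in> F" if "x \<in> F" for x
    using that assms unfolding is_subfield_def by (cases "x = 0") auto
  show "x / y \<in> F" if "x \<in> F" "y \<in> F" for x y
    unfolding divide_inverse using that inv R(5) by blast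
  have n: "of_nat n \<in> F" for n by (induction n) (auto intro: R)
  show "of_int n \<in> F" for n using n R(6) by (cases n rule: int_cases2) auto
  show "numeral n \<in> F" for n using n[of "numeral n"] by simp
qed

lemma gen_field_subfield: "is_subfield (gen_field S)"
  unfolding gen_field_def is_subfield_def by auto

lemma gen_field_superset: "S \<subseteq> gen_field S"
  unfolding gen_field_def by auto

lemma gen_field_least: "is_subfield F \<Longrightarrow> S \<subseteq> F \<Longrightarrow> gen_field S \<subseteq> F"
  unfolding gen_field_def by auto

lemma intO_subring: "is_subfield F \<Longrightarrow> is_subring (intO F)"
  using is_subringD[OF is_subring_alg_int] is_subfieldD
  unfolding intO_def is_subring_def by auto

section \<open>Cube roots of unity\<close>

lemma zeta3_sum: "1 + zeta3 + zeta3\<^sup>2 = 0"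
  unfolding zeta3_def by (simp add: complex_eq_iff power2_eq_square field_simps)

lemma zeta3_cube: "zeta3 ^ 3 = 1"
  using zeta3_sum by Groebner_Basis.algebra

lemma zeta3_neq: "zeta3 \<noteq> 0" "zeta3 \<noteq> 1" "zeta3\<^sup>2 \<noteq> 1"
proof -
  show z: "zeta3 \<noteq> 0" "zeta3 \<noteq> 1" unfolding zeta3_def by (auto simp: complex_eq_iff)
  show "zeta3\<^sup>2 \<noteq> 1"
  proof
    assume "zeta3\<^sup>2 = 1"
    with zeta3_cube have "zeta3 = 1" by Groebner_Basis.algebra
    with z show False by simp
  qed
qed

lemma sqrt_m3_zeta3: "sqrt_m3 = 1 + 2 * zeta3"
  unfolding zeta3_def sqrt_m3_def by (simp add: diff_divide_distrib)

lemma sqrt_m3_sq: "sqrt_m3\<^sup>2 = - 3"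
  unfolding sqrt_m3_def by (simp add: power_mult_distrib flip: of_real_power)

lemma sqrt_m3_neq_0: "sqrt_m3 \<noteq> 0"
  using sqrt_m3_sq by auto

lemma alg_int_zeta3: "alg_int zeta3"
  by (rule alg_int_root[of _ 3]) (simp_all add: zeta3_cube)

lemma alg_int_sqrt_m3: "alg_int sqrt_m3"
  unfolding sqrt_m3_zeta3 using is_subringD[OF is_subring_alg_int] alg_int_zeta3 by simp

lemma cube_eq_cases:
  fixes x y :: complex
  assumes "x ^ 3 = y ^ 3"
  shows "\<exists>i<3. x = zeta3 ^ i * y"
proof -
  have "(x - y) * (x - zeta3 * y) * (x - zeta3\<^sup>2 * y) = 0"
    using assms zeta3_sum by Groebner_Basis.algebra
  hence "x = zeta3 ^ 0 * y \<or> x = zeta3 ^ 1 * y \<or> x = zeta3 ^ 2 * y" by auto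
  moreover have "(0::nat) < 3" "(1::nat) < 3" "(2::nat) < 3" by auto
  ultimately show ?thesis by blast
qed

lemma zeta3_power_mod: "zeta3 ^ n = zeta3 ^ (n mod 3)"
proof -
  have "zeta3 ^ n = zeta3 ^ (3 * (n div 3) + n mod 3)" by simp
  also have "\<dots> = zeta3 ^ (n mod 3)" by (simp only: power_add power_mult zeta3_cube) simp
  finally show ?thesis .
qed

section \<open>Adjoining a cube root to a field containing the cube roots of unity\<close>

text \<open>If \<open>F\<close> contains \<open>zeta3\<close> and \<open>r ^ 3\<close>, this is the
  field F(r), and it collapses to \<open>F\<close> when \<open>r\<close> lies in \<open>F\<close>.
  The coordinate form makes conjugation and comparison of coefficients directly computable.\<close>

definition adj :: "complex set \<Rightarrow> complex \<Rightarrow> complex set" where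
  "adj F r = {u + v * r + w * r\<^sup>2 | u v w. u \<in> F \<and> v \<in> F \<and> w \<in> F}"

lemma adjI: "u \<in> F \<Longrightarrow> v \<in> F \<Longrightarrow> w \<in> F \<Longrightarrow> u + v * r + w * r\<^sup>2 \<in> adj F r"
  unfolding adj_def by blast

lemma adjE:
  assumes "x \<in> adj F r"
  obtains u v w where "u \<in> F" "v \<in> F" "w \<in> F" "x = u + v * r + w * r\<^sup>2"
  using assms unfolding adj_def by blast

lemma adj_superset: assumes "is_subfield F" shows "F \<subseteq> adj F r" "r \<in> adj F r"
proof -
  note S = is_subfieldD[OF assms]
  show "F \<subseteq> adj F r" using adjI[OF _ S(1,1), of _ r] by auto
  show "r \<in> adj F r" using adjI[OF S(1,2,1), of r] by simp
qed

lemma adj_least: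
  assumes "is_subfield E" "F \<subseteq> E" "r \<in> E" shows "adj F r \<subseteq> E"
  using assms(2,3) is_subfieldD(3,5,7)[OF assms(1)] by (auto elim!: adjE intro!: is_subfieldD(3,5,7)[OF assms(1)])

text \<open>A relation that involves the square of \<open>r\<close> becomes r^2 = a + b r;
  multiplying by \<open>r\<close> and reducing leaves a linear relation, which forces a = -b^2 and
  r^3 = (-b)^3. Then \<open>r\<close> is -b times a cube root of unity and lies in
  \<open>F\<close>.\<close>

lemma adj_independent:
  assumes F: "is_subfield F" "zeta3 \<in> F" and r: "r ^ 3 \<in> F" "r \<notin> F"
    and uvw: "u \<in> F" "v \<in> F" "w \<in> F" "u + v * r + w * r\<^sup>2 = 0"
  shows "u = 0 \<and> v = 0 \<and> w = 0"
proof -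
  note S = is_subfieldD[OF F(1)]
  have lin: "a = 0 \<and> b = 0" if "a \<in> F" "b \<in> F" "a + b * r = 0" for a b
  proof (cases "b = 0")
    case False
    hence "r = - a / b" using that(3) by (simp add: field_simps eq_neg_iff_add_eq_0)
    hence "r \<in> F" using that S(6,11) by blast
    thus ?thesis using r by simp
  qed (use that in simp)
  show ?thesis
  proof (cases "w = 0")
    case False
    define a b where "a = - u / w" and "b = - v / w"
    have ab: "a \<in> F" "b \<in> F" unfolding a_def b_def using uvw S(6,11) by blast+
    have r2: "r\<^sup>2 = a + b * r" using uvw(4) False unfolding a_def b_def
      by (simp add: field_simps) (metis add.assoc add.commute add_eq_0_iff)
    have "(a * b - r ^ 3) + (a + b\<^sup>2) * r = 0" using r2 by Groebner_Basis.algebra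
    with lin[of "a * b - r ^ 3" "a + b\<^sup>2"] ab r have "a * b = r ^ 3" "a + b\<^sup>2 = 0"
      using S by auto
    hence "r ^ 3 = (- b) ^ 3" by Groebner_Basis.algebra
    from cube_eq_cases[OF this] obtain i where "r = zeta3 ^ i * (- b)" by blast
    hence "r \<in> F" using ab F(2) S(5,6,7) by blast
    thus ?thesis using r by simp
  qed (use lin[of u v] uvw in simp)
qed

lemma adj_unique:
  assumes F: "is_subfield F" "zeta3 \<in> F" and r: "r ^ 3 \<in> F" "r \<notin> F"
    and uvw: "u \<in> F" "v \<in> F" "w \<in> F" "u' \<in> F" "v' \<in> F" "w' \<in> F"
    and eq: "u + v * r + w * r\<^sup>2 = u' + v' * r + w' * r\<^sup>2"
  shows "u = u' \<and> v = v' \<and> w = w'"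
proof -
  have "(u - u') + (v - v') * r + (w - w') * r\<^sup>2 = 0" using eq by Groebner_Basis.algebra
  from adj_independent[OF F r _ _ _ this] show ?thesis using uvw is_subfieldD[OF F(1)] by auto
qed

lemma adj_trivial: assumes "is_subfield F" "r \<in> F" shows "adj F r = F"
  using adj_least[OF assms(1) order_refl assms(2)] adj_superset[OF assms(1)] by blast

lemma adj_mult:
  assumes F: "is_subfield F" and r: "r ^ 3 \<in> F" and xy: "x \<in> adj F r" "y \<in> adj F r"
  shows "x * y \<in> adj F r"
proof -
  note S = is_subfieldD[OF F]
  obtain u v w where x: "u \<in> F" "v \<in> F" "w \<in> F" "x = u + v * r + w * r\<^sup>2" using xy(1) by (rule adjE)
  obtain u' v' w' where y: "u' \<in> F" "v' \<in> F" "w' \<in> F" "y = u' + v' * r + w' * r\<^sup>2"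
    using xy(2) by (rule adjE)
  have "x * y = (u * u' + r ^ 3 * (v * w' + w * v')) + (u * v' + v * u' + r ^ 3 * (w * w')) * r
      + (u * w' + v * v' + w * u') * r\<^sup>2"
    unfolding x y by Groebner_Basis.algebra
  also have "\<dots> \<in> adj F r" by (rule adjI) (intro S x y r)+
  finally show ?thesis .
qed

lemma adj_subfield:
  assumes F: "is_subfield F" "zeta3 \<in> F" and r: "r ^ 3 \<in> F"
  shows "is_subfield (adj F r)"
proof (cases "r \<in> F")
  case True
  thus ?thesis using adj_trivial F by simp
next
  case False
  note S = is_subfieldD[OF F(1)]
  have inv: "inverse x \<in> adj F r" if x: "x \<in> adj F r" "x \<noteq> 0" for x
  proof -
    obtain u v w where uvw: "u \<in> F" "v \<in> F" "w \<in> F" and xx: "x = u + v * r + w * r\<^sup>2"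
      using x(1) by (rule adjE)
    \<comment> \<open>\<open>N\<close> is the norm of \<open>x\<close> to \<open>F\<close> and
      \<open>y\<close> the product of its other two conjugates, under r -> zeta3 r and r -> zeta3^2
      r. Each conjugate is nonzero by independence of 1, r, r^2, so \<open>N\<close> can be inverted
      in \<open>F\<close>.\<close>
    define N where "N = u ^ 3 + r ^ 3 * v ^ 3 + (r ^ 3)\<^sup>2 * w ^ 3 - 3 * r ^ 3 * u * v * w"
    define y where "y = (u\<^sup>2 - r ^ 3 * v * w) + (r ^ 3 * w\<^sup>2 - u * v) * r + (v\<^sup>2 - u * w) * r\<^sup>2"
    have xy: "x * y = N" unfolding xx y_def N_def by Groebner_Basis.algebra
    have yy: "y = (u + (v * zeta3) * r + (w * zeta3\<^sup>2) * r\<^sup>2) * (u + (v * zeta3\<^sup>2) * r + (w * zeta3) * r\<^sup>2)"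
      unfolding y_def using zeta3_sum by Groebner_Basis.algebra
    have "y \<noteq> 0"
    proof
      assume "y = 0"
      then consider "u + (v * zeta3) * r + (w * zeta3\<^sup>2) * r\<^sup>2 = 0" | "u + (v * zeta3\<^sup>2) * r + (w * zeta3) * r\<^sup>2 = 0"
        unfolding yy by auto
      hence "u = 0 \<and> v = 0 \<and> w = 0"
      proof cases
        case 1
        from adj_independent[OF F r False _ _ _ 1] show ?thesis using uvw S F(2) zeta3_neq by auto
      next
        case 2
        from adj_independent[OF F r False _ _ _ 2] show ?thesis using uvw S F(2) zeta3_neq by auto
      qed
      thus False using x xx by simp
    qed
    hence "N \<noteq> 0" using xy x by auto
    hence "inverse x = inverse N * y" using xy x(2) by (simp add: field_simps)
    also have "\<dots> = inverse N * (u\<^sup>2 - r ^ 3 * v * w) + (inverse N * (r ^ 3 * w\<^sup>2 - u * v)) * r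
        + (inverse N * (v\<^sup>2 - u * w)) * r\<^sup>2" unfolding y_def by Groebner_Basis.algebra
    also have "\<dots> \<in> adj F r" unfolding N_def by (rule adjI) (intro S uvw r)+
    finally show ?thesis .
  qed
  show ?thesis unfolding is_subfield_def
  proof (intro conjI ballI impI)
    fix x y assume xy: "x \<in> adj F r" "y \<in> adj F r"
    show "x * y \<in> adj F r" by (rule adj_mult[OF F(1) r xy])
    obtain u v w where x: "u \<in> F" "v \<in> F" "w \<in> F" "x = u + v * r + w * r\<^sup>2" using xy(1) by (rule adjE)
    obtain u' v' w' where y: "u' \<in> F" "v' \<in> F" "w' \<in> F" "y = u' + v' * r + w' * r\<^sup>2"
      using xy(2) by (rule adjE)
    have "x + y = (u + u') + (v + v') * r + (w + w') * r\<^sup>2" unfolding x y by Groebner_Basis.algebra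
    also have "\<dots> \<in> adj F r" by (rule adjI) (intro S x y)+
    finally show "x + y \<in> adj F r" .
    have "x - y = (u - u') + (v - v') * r + (w - w') * r\<^sup>2" unfolding x y by Groebner_Basis.algebra
    also have "\<dots> \<in> adj F r" by (rule adjI) (intro S x y)+
    finally show "x - y \<in> adj F r" .
  qed (use inv adj_superset[OF F(1), of r] S(1,2) in auto)
qed

section \<open>Embeddings of fields and their extension to a cubic radical\<close>

definition fhom :: "complex set \<Rightarrow> (complex \<Rightarrow> complex) \<Rightarrow> bool" where
  "fhom F \<phi> \<longleftrightarrow> \<phi> 1 = 1 \<and> (\<forall>x\<in>F. \<forall>y\<in>F. \<phi> (x + y) = \<phi> x + \<phi> y \<and> \<phi> (x * y) = \<phi> x * \<phi> y)"

lemma fhomD: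
  assumes F: "is_subfield F" and h: "fhom F \<phi>"
  shows "\<phi> 1 = 1" "\<And>x y. x \<in> F \<Longrightarrow> y \<in> F \<Longrightarrow> \<phi> (x + y) = \<phi> x + \<phi> y"
    "\<And>x y. x \<in> F \<Longrightarrow> y \<in> F \<Longrightarrow> \<phi> (x * y) = \<phi> x * \<phi> y" "\<phi> 0 = 0"
    "\<And>x. x \<in> F \<Longrightarrow> \<phi> (- x) = - \<phi> x" "\<And>x y. x \<in> F \<Longrightarrow> y \<in> F \<Longrightarrow> \<phi> (x - y) = \<phi> x - \<phi> y"
    "\<And>x n. x \<in> F \<Longrightarrow> \<phi> (x ^ n) = \<phi> x ^ n" "\<And>x. x \<in> F \<Longrightarrow> \<phi> (inverse x) = inverse (\<phi> x)"
    "\<And>x y. x \<in> F \<Longrightarrow> y \<in> F \<Longrightarrow> \<phi> (x / y) = \<phi> x / \<phi> y"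
    "\<And>x. x \<in> F \<Longrightarrow> \<phi> x = 0 \<longleftrightarrow> x = 0" "\<And>n. \<phi> (of_int n) = of_int n"
    "\<And>x y. x \<in> F \<Longrightarrow> y \<in> F \<Longrightarrow> \<phi> x = \<phi> y \<longleftrightarrow> x = y"
    "\<And>n. \<phi> (numeral n) = numeral n"
proof -
  note S = is_subfieldD[OF F]
  show one: "\<phi> 1 = 1" and add: "\<And>x y. x \<in> F \<Longrightarrow> y \<in> F \<Longrightarrow> \<phi> (x + y) = \<phi> x + \<phi> y"
    and mult: "\<And>x y. x \<in> F \<Longrightarrow> y \<in> F \<Longrightarrow> \<phi> (x * y) = \<phi> x * \<phi> y"
    using h unfolding fhom_def by auto
  show zero: "\<phi> 0 = 0" using add[OF S(1,1)] by simp
  show neg: "\<phi> (- x) = - \<phi> x" if "x \<in> F" for x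
    using add[OF that S(6)[OF that]] zero by (simp add: eq_neg_iff_add_eq_0 add.commute)
  show diff: "\<phi> (x - y) = \<phi> x - \<phi> y" if "x \<in> F" "y \<in> F" for x y
    using add[OF that(1) S(6)[OF that(2)]] neg[OF that(2)] by simp
  show "\<phi> (x ^ n) = \<phi> x ^ n" if "x \<in> F" for x n
    by (induction n) (auto simp: one mult that S(7))
  show ker: "\<phi> x = 0 \<longleftrightarrow> x = 0" if "x \<in> F" for x
  proof
    assume "\<phi> x = 0"
    show "x = 0"
    proof (rule ccontr)
      assume "x \<noteq> 0"
      hence "\<phi> x * \<phi> (inverse x) = 1" using mult[OF that S(10)[OF that]] one by simp
      thus False using \<open>\<phi> x = 0\<close> by simp
    qed
  qed (simp add: zero)
  show inv: "\<phi> (inverse x) = inverse (\<phi> x)" if "x \<in> F" for x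
  proof (cases "x = 0")
    case False
    hence "\<phi> x * \<phi> (inverse x) = 1" using mult[OF that S(10)[OF that]] one by simp
    thus ?thesis by (metis inverse_unique)
  qed (simp add: zero)
  show "\<phi> (x / y) = \<phi> x / \<phi> y" if "x \<in> F" "y \<in> F" for x y
    unfolding divide_inverse using that by (simp add: mult inv S)
  have n: "\<phi> (of_nat n) = of_nat n" for n
    using S(12)[of "int _"] by (induction n) (auto simp: zero one add S(2))
  show "\<phi> (of_int n) = of_int n" for n
    using S(12)[of "int _"] by (cases n rule: int_cases2) (auto simp: n neg)
  show "\<phi> (numeral k) = numeral k" for k using n[of "numeral k"] by simp
  show "\<phi> x = \<phi> y \<longleftrightarrow> x = y" if "x \<in> F" "y \<in> F" for x y
    using ker[OF S(4)[OF that]] diff[OF that] by auto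
qed

lemma fhom_subset: "fhom E \<phi> \<Longrightarrow> F \<subseteq> E \<Longrightarrow> fhom F \<phi>"
  unfolding fhom_def by blast

lemma fhom_image_subfield:
  assumes F: "is_subfield F" and h: "fhom F \<phi>"
  shows "is_subfield (\<phi> ` F)"
proof -
  note S = is_subfieldD[OF F] and H = fhomD[OF F h]
  show ?thesis unfolding is_subfield_def
  proof (intro conjI ballI impI)
    fix x y assume "x \<in> \<phi> ` F" "y \<in> \<phi> ` F"
    then obtain a b where ab: "a \<in> F" "b \<in> F" "x = \<phi> a" "y = \<phi> b" by blast
    show "x + y \<in> \<phi> ` F" "x - y \<in> \<phi> ` F" "x * y \<in> \<phi> ` F"
      using ab H(2)[OF ab(1,2), symmetric] H(6)[OF ab(1,2), symmetric] H(3)[OF ab(1,2), symmetric] S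
      by auto
    show "inverse x \<in> \<phi> ` F" using ab H(8)[OF ab(1), symmetric] S by auto
  next
    show "0 \<in> \<phi> ` F" "1 \<in> \<phi> ` F" using H(4) H(1) S(1,2) by (metis image_eqI)+
  qed
qed

text \<open>An embedding fixes the integers, so a monic integer equation for \<open>x\<close> also
  holds for its image.\<close>

lemma fhom_alg_int:
  assumes F: "is_subfield F" and h: "fhom F \<phi>" and x: "x \<in> F" "alg_int x"
  shows "alg_int (\<phi> x)"
proof -
  note S = is_subfieldD[OF F] and H = fhomD[OF F h]
  obtain p :: "int poly" where p: "lead_coeff p = 1" "poly (map_poly of_int p) x = 0"
    using x(2) unfolding alg_int_def by blast
  have "poly (map_poly of_int q) x \<in> F \<and> \<phi> (poly (map_poly of_int q) x) = poly (map_poly of_int q) (\<phi> x)"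
    for q :: "int poly"
    by (induction q) (auto simp: map_poly_pCons H x S)
  hence "poly (map_poly of_int p) (\<phi> x) = 0" using p(2) H(4) by metis
  thus ?thesis unfolding alg_int_def using p(1) by blast
qed

lemma fhom_adj_eq:
  assumes F: "is_subfield F" "zeta3 \<in> F" and r: "r ^ 3 \<in> F"
    and h: "fhom (adj F r) \<phi>" "fhom (adj F r) \<psi>" "\<And>x. x \<in> F \<Longrightarrow> \<phi> x = \<psi> x" "\<phi> r = \<psi> r"
    and x: "x \<in> adj F r"
  shows "\<phi> x = \<psi> x"
proof -
  have E: "is_subfield (adj F r)" by (rule adj_subfield[OF F r])
  note S = is_subfieldD[OF E]
  note H1 = fhomD[OF E h(1)] and H2 = fhomD[OF E h(2)]
  note sub = adj_superset[OF F(1), of r]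
  obtain u v w where uvw: "u \<in> F" "v \<in> F" "w \<in> F" "x = u + v * r + w * r\<^sup>2" using x by (rule adjE)
  have "u \<in> adj F r" "v \<in> adj F r" "w \<in> adj F r" "r \<in> adj F r" using uvw sub by auto
  thus ?thesis unfolding uvw(4) by (simp add: H1 H2 S h(3,4) uvw)
qed

text \<open>The extension is defined on coordinates, which are unique because \<open>r\<close> is
  not in \<open>F\<close>. The condition on \<open>s ^ 3\<close> is exactly what makes it respect
  the reduction of r^3 in products.\<close>

lemma fhom_extend:
  assumes F: "is_subfield F" "zeta3 \<in> F" and r: "r ^ 3 \<in> F" "r \<notin> F"
    and h: "fhom F \<phi>" and s: "s ^ 3 = \<phi> (r ^ 3)"
  shows "\<exists>\<psi>. fhom (adj F r) \<psi> \<and> (\<forall>x\<in>F. \<psi> x = \<phi> x) \<and> \<psi> r = s"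
proof -
  note S = is_subfieldD[OF F(1)] and H = fhomD[OF F(1) h]
  define \<psi> where "\<psi> x = (THE y. \<exists>u v w. u \<in> F \<and> v \<in> F \<and> w \<in> F \<and> x = u + v * r + w * r\<^sup>2 \<and>
      y = \<phi> u + \<phi> v * s + \<phi> w * s\<^sup>2)" for x
  have \<psi>: "\<psi> (u + v * r + w * r\<^sup>2) = \<phi> u + \<phi> v * s + \<phi> w * s\<^sup>2" if "u \<in> F" "v \<in> F" "w \<in> F" for u v w
    unfolding \<psi>_def
  proof (rule the_equality)
    fix y assume "\<exists>a b c. a \<in> F \<and> b \<in> F \<and> c \<in> F \<and> u + v * r + w * r\<^sup>2 = a + b * r + c * r\<^sup>2 \<and>
      y = \<phi> a + \<phi> b * s + \<phi> c * s\<^sup>2"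
    thus "y = \<phi> u + \<phi> v * s + \<phi> w * s\<^sup>2" using adj_unique[OF F r that] by blast
  qed (use that in blast)
  have \<psi>F: "\<psi> x = \<phi> x" if "x \<in> F" for x using \<psi>[OF that S(1,1)] by (simp add: H)
  have "\<psi> r = s" using \<psi>[OF S(1,2,1)] by (simp add: H)
  moreover have "fhom (adj F r) \<psi>" unfolding fhom_def
  proof (intro conjI ballI)
    show "\<psi> 1 = 1" using \<psi>F S(2) H by simp
    fix x y assume xy: "x \<in> adj F r" "y \<in> adj F r"
    obtain u v w where x: "u \<in> F" "v \<in> F" "w \<in> F" "x = u + v * r + w * r\<^sup>2" using xy(1) by (rule adjE)
    obtain u' v' w' where y: "u' \<in> F" "v' \<in> F" "w' \<in> F" "y = u' + v' * r + w' * r\<^sup>2"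
      using xy(2) by (rule adjE)
    have \<psi>x: "\<psi> x = \<phi> u + \<phi> v * s + \<phi> w * s\<^sup>2" and \<psi>y: "\<psi> y = \<phi> u' + \<phi> v' * s + \<phi> w' * s\<^sup>2"
      using \<psi> x y by auto
    have "x + y = (u + u') + (v + v') * r + (w + w') * r\<^sup>2" unfolding x y by Groebner_Basis.algebra
    also have "\<psi> \<dots> = \<phi> (u + u') + \<phi> (v + v') * s + \<phi> (w + w') * s\<^sup>2" by (rule \<psi>) (intro S x y)+
    also have "\<dots> = \<psi> x + \<psi> y" unfolding \<psi>x \<psi>y using x(1-3) y(1-3) by (simp add: H algebra_simps)
    finally show "\<psi> (x + y) = \<psi> x + \<psi> y" .
    have "x * y = (u * u' + r ^ 3 * (v * w' + w * v')) + (u * v' + v * u' + r ^ 3 * (w * w')) * r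
        + (u * w' + v * v' + w * u') * r\<^sup>2" unfolding x y by Groebner_Basis.algebra
    also have "\<psi> \<dots> = \<phi> (u * u' + r ^ 3 * (v * w' + w * v')) + \<phi> (u * v' + v * u' + r ^ 3 * (w * w')) * s
        + \<phi> (u * w' + v * v' + w * u') * s\<^sup>2" by (rule \<psi>) (intro S x y r)+
    also have "\<dots> = (\<phi> u * \<phi> u' + s ^ 3 * (\<phi> v * \<phi> w' + \<phi> w * \<phi> v'))
        + (\<phi> u * \<phi> v' + \<phi> v * \<phi> u' + s ^ 3 * (\<phi> w * \<phi> w')) * s
        + (\<phi> u * \<phi> w' + \<phi> v * \<phi> v' + \<phi> w * \<phi> u') * s\<^sup>2"
      using x y r S by (simp add: H(2,3) s del: power_mult_distrib)
    also have "\<dots> = (\<phi> u + \<phi> v * s + \<phi> w * s\<^sup>2) * (\<phi> u' + \<phi> v' * s + \<phi> w' * s\<^sup>2)" by Groebner_Basis.algebra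
    also have "\<dots> = \<psi> x * \<psi> y" unfolding \<psi>x \<psi>y ..
    finally show "\<psi> (x * y) = \<psi> x * \<psi> y" .
  qed
  ultimately show ?thesis using \<psi>F by blast
qed

text \<open>Comparing coordinates, invariance multiplies those of r and r^2 by nontrivial roots of
  unity, so they vanish. Applied repeatedly, this descends through the tower one generator at a
  time.\<close>

lemma adj_fixed:
  assumes F: "is_subfield F" "zeta3 \<in> F" and r: "r ^ 3 \<in> F" "r \<noteq> 0" and E: "adj F r \<subseteq> E" "is_subfield E"
    and h: "fhom E \<phi>" "\<And>x. x \<in> F \<Longrightarrow> \<phi> x = x" "\<phi> r = zeta3 * r"
    and x: "x \<in> adj F r" "\<phi> x = x"
  shows "x \<in> F"
proof -
  note S = is_subfieldD[OF F(1)] and H = fhomD[OF E(2) h(1)] and SE = is_subfieldD[OF E(2)]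
  obtain u v w where uvw: "u \<in> F" "v \<in> F" "w \<in> F" "x = u + v * r + w * r\<^sup>2" using x(1) by (rule adjE)
  have FE: "F \<subseteq> E" "r \<in> E" using E adj_superset[OF F(1), of r] by auto
  hence mem: "u \<in> E" "v \<in> E" "w \<in> E" using uvw by auto
  have 1: "u + v * r + w * r\<^sup>2 = u + v * (zeta3 * r) + w * (zeta3 * r)\<^sup>2"
    using x(2) unfolding uvw(4) by (simp add: H SE mem FE h(2,3) uvw)
  show ?thesis
  proof (cases "r \<in> F")
    case False
    have "u + v * r + w * r\<^sup>2 = u + (v * zeta3) * r + (w * zeta3\<^sup>2) * r\<^sup>2"
      using 1 by Groebner_Basis.algebra
    from adj_unique[OF F r(1) False _ _ _ _ _ _ this] have "v = v * zeta3" "w = w * zeta3\<^sup>2"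
      using uvw S F(2) by auto
    hence "v = 0" "w = 0" using zeta3_neq by auto
    thus ?thesis using uvw by simp
  qed (use adj_trivial[OF F(1)] x in blast)
qed

section \<open>Ideals and local uniformizers\<close>

lemma gen_ideal_superset: "X \<subseteq> gen_ideal S X"
  unfolding gen_ideal_def by auto

lemma gen_ideal_least: "ideal_in S I \<Longrightarrow> X \<subseteq> I \<Longrightarrow> gen_ideal S X \<subseteq> I"
  unfolding gen_ideal_def by auto

lemma ideal_in_self: "is_subring S \<Longrightarrow> ideal_in S S"
  unfolding ideal_in_def is_subring_def by auto

lemma gen_ideal_ideal:
  assumes "is_subring S" "X \<subseteq> S" shows "ideal_in S (gen_ideal S X)"
  unfolding ideal_in_def
proof (intro conjI)
  show "gen_ideal S X \<subseteq> S" by (rule gen_ideal_least[OF ideal_in_self[OF assms(1)] assms(2)])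
qed (auto simp: gen_ideal_def ideal_in_def)

lemma ideal_inD:
  assumes "ideal_in S I"
  shows "I \<subseteq> S" "0 \<in> I" "\<And>x y. x \<in> I \<Longrightarrow> y \<in> I \<Longrightarrow> x + y \<in> I"
    "\<And>r x. r \<in> S \<Longrightarrow> x \<in> I \<Longrightarrow> r * x \<in> I"
  using assms unfolding ideal_in_def by auto

lemma imult_ideal:
  assumes "is_subring S" "ideal_in S I" "ideal_in S J" shows "ideal_in S (imult S I J)"
  unfolding imult_def
  using ideal_inD(1)[OF assms(2)] ideal_inD(1)[OF assms(3)] is_subringD(5)[OF assms(1)]
  by (intro gen_ideal_ideal[OF assms(1)]) auto

lemma imult_memI: "a \<in> I \<Longrightarrow> b \<in> J \<Longrightarrow> a * b \<in> imult S I J"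
  unfolding imult_def by (rule subsetD[OF gen_ideal_superset]) auto

lemma imult_least: "ideal_in S K \<Longrightarrow> (\<And>a b. a \<in> I \<Longrightarrow> b \<in> J \<Longrightarrow> a * b \<in> K) \<Longrightarrow> imult S I J \<subseteq> K"
  unfolding imult_def by (rule gen_ideal_least) auto

lemma ipow_simps: "ipow S I 0 = S" "ipow S I (Suc n) = imult S I (ipow S I n)"
  unfolding ipow_def by auto

lemma ipow_ideal:
  assumes "is_subring S" "ideal_in S I" shows "ideal_in S (ipow S I n)"
  by (induction n) (auto simp: ipow_simps intro: ideal_in_self imult_ideal assms)

lemma ipow_memI: assumes "is_subring S" "x \<in> I" shows "x ^ n \<in> ipow S I n"
  by (induction n) (auto simp: ipow_simps intro: imult_memI assms is_subringD)

lemma prime_idealD: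
  assumes S: "is_subring S" and Q: "prime_ideal_in S Q"
  shows "ideal_in S Q" "Q \<subseteq> S" "1 \<notin> Q" "\<And>a b. a \<in> S \<Longrightarrow> b \<in> S \<Longrightarrow> a * b \<in> Q \<Longrightarrow> a \<in> Q \<or> b \<in> Q"
    "\<And>x y. x \<in> Q \<Longrightarrow> y \<in> Q \<Longrightarrow> x + y \<in> Q" "\<And>x y. x \<in> Q \<Longrightarrow> y \<in> Q \<Longrightarrow> x - y \<in> Q"
    "\<And>r x. r \<in> S \<Longrightarrow> x \<in> Q \<Longrightarrow> r * x \<in> Q" "\<And>r x. r \<in> S \<Longrightarrow> x \<in> Q \<Longrightarrow> x * r \<in> Q" "0 \<in> Q"
    "\<And>x n. x \<in> S \<Longrightarrow> x ^ n \<in> Q \<Longrightarrow> x \<in> Q"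
    "\<And>f A. (\<And>a. a \<in> A \<Longrightarrow> f a \<in> Q) \<Longrightarrow> sum f A \<in> Q"
proof -
  show I: "ideal_in S Q" and pr: "\<And>a b. a \<in> S \<Longrightarrow> b \<in> S \<Longrightarrow> a * b \<in> Q \<Longrightarrow> a \<in> Q \<or> b \<in> Q"
    using Q unfolding prime_ideal_in_def by auto
  show "Q \<subseteq> S" "0 \<in> Q" and add: "\<And>x y. x \<in> Q \<Longrightarrow> y \<in> Q \<Longrightarrow> x + y \<in> Q"
    and mult: "\<And>r x. r \<in> S \<Longrightarrow> x \<in> Q \<Longrightarrow> r * x \<in> Q"
    using ideal_inD[OF I] by auto
  show "\<And>r x. r \<in> S \<Longrightarrow> x \<in> Q \<Longrightarrow> x * r \<in> Q" using mult by (simp add: mult.commute)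
  show "x - y \<in> Q" if "x \<in> Q" "y \<in> Q" for x y
    using add[OF that(1) mult[OF is_subringD(6)[OF S is_subringD(2)[OF S]] that(2)]] by simp
  show one: "1 \<notin> Q"
  proof
    assume "1 \<in> Q"
    hence "S \<subseteq> Q" using mult[of _ 1] by auto
    thus False using \<open>Q \<subseteq> S\<close> Q unfolding prime_ideal_in_def by auto
  qed
  show "x \<in> S \<Longrightarrow> x ^ n \<in> Q \<Longrightarrow> x \<in> Q" for x n
    by (induction n) (use one pr is_subringD(7)[OF S] in auto)
  show "(\<And>a. a \<in> A \<Longrightarrow> f a \<in> Q) \<Longrightarrow> sum f A \<in> Q" for f and A :: "'a set"
    by (induction A rule: infinite_finite_induct) (auto simp: \<open>0 \<in> Q\<close> intro: add)
qed

lemma prime_ideal_compl: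
  assumes S: "is_subring S" and Q: "prime_ideal_in S Q"
  shows "1 \<in> S - Q" "\<And>a b. a \<in> S - Q \<Longrightarrow> b \<in> S - Q \<Longrightarrow> a * b \<in> S - Q"
    "\<And>a n. a \<in> S - Q \<Longrightarrow> a ^ n \<in> S - Q"
    "\<And>f A. (\<And>a. a \<in> A \<Longrightarrow> f a \<in> S - Q) \<Longrightarrow> prod f A \<in> S - Q"
proof -
  show one: "1 \<in> S - Q" using prime_idealD(3)[OF S Q] is_subringD(2)[OF S] by simp
  show mult: "\<And>a b. a \<in> S - Q \<Longrightarrow> b \<in> S - Q \<Longrightarrow> a * b \<in> S - Q"
    using prime_idealD(4)[OF S Q] is_subringD(5)[OF S] by blast
  show "\<And>a n. a \<in> S - Q \<Longrightarrow> a ^ n \<in> S - Q"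
    using prime_idealD(10)[OF S Q] is_subringD(7)[OF S] by blast
  show "(\<And>a. a \<in> A \<Longrightarrow> f a \<in> S - Q) \<Longrightarrow> prod f A \<in> S - Q" for f and A :: "'a set"
    by (induction A rule: infinite_finite_induct) (use one mult in auto)
qed

text \<open>\<open>w\<close> generates \<open>Q\<close> after localisation at \<open>Q\<close>.\<close>
definition local_unif :: "complex set \<Rightarrow> complex set \<Rightarrow> complex \<Rightarrow> bool" where
  "local_unif S Q w \<longleftrightarrow> w \<in> Q \<and> w \<noteq> 0 \<and> (\<exists>e\<in>S - Q. \<forall>x\<in>Q. \<exists>s\<in>S. e * x = w * s)"

text \<open>The contraction to \<open>S\<close> of the ideal generated by \<open>w ^ n\<close> in
  the localisation at \<open>Q\<close>. Being an ideal, it bounds ideal powers, which are defined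
  only through generated ideals.\<close>

definition local_multiples :: "complex set \<Rightarrow> complex set \<Rightarrow> complex \<Rightarrow> nat \<Rightarrow> complex set" where
  "local_multiples S Q w n = {x \<in> S. \<exists>e\<in>S - Q. \<exists>s\<in>S. e * x = w ^ n * s}"

lemma local_multiples_ideal:
  assumes S: "is_subring S" and Q: "prime_ideal_in S Q"
  shows "ideal_in S (local_multiples S Q w n)"
  unfolding ideal_in_def
proof (intro conjI ballI)
  note R = is_subringD[OF S] and C = prime_ideal_compl[OF S Q]
  show "local_multiples S Q w n \<subseteq> S" unfolding local_multiples_def by blast
  show "0 \<in> local_multiples S Q w n"
    unfolding local_multiples_def using R(1) C(1) by (auto intro!: bexI[of _ 1] bexI[of _ 0])
  fix x y assume "x \<in> local_multiples S Q w n" "y \<in> local_multiples S Q w n"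
  then obtain e s e' s' where *: "x \<in> S" "y \<in> S" "e \<in> S - Q" "e' \<in> S - Q" "s \<in> S" "s' \<in> S"
    "e * x = w ^ n * s" "e' * y = w ^ n * s'"
    unfolding local_multiples_def by blast
  have "(e * e') * (x + y) = e' * (e * x) + e * (e' * y)" by (simp add: algebra_simps)
  also have "\<dots> = w ^ n * (e' * s + e * s')" unfolding *(7,8) by (simp add: algebra_simps)
  finally have "(e * e') * (x + y) = w ^ n * (e' * s + e * s')" .
  moreover have "e' * s + e * s' \<in> S" using * R(3,5) by blast
  ultimately show "x + y \<in> local_multiples S Q w n"
    unfolding local_multiples_def using * C(2)[OF *(3,4)] R(3) by blast
next
  note R = is_subringD[OF S]
  fix r x assume r: "r \<in> S" and "x \<in> local_multiples S Q w n"
  then obtain e s where *: "x \<in> S" "e \<in> S - Q" "s \<in> S" "e * x = w ^ n * s"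
    unfolding local_multiples_def by blast
  have "e * (r * x) = w ^ n * (r * s)" using *(4) by (metis mult.left_commute)
  thus "r * x \<in> local_multiples S Q w n" unfolding local_multiples_def using * r R(5) by blast
qed

text \<open>Only generators need checking. The exponent \<open>n\<close> is 1 for powers of a prime
  with uniformizer \<open>w\<close>, and the least valuation of an element when \<open>I\<close> is
  a general ideal.\<close>

lemma local_multiples_ipow:
  assumes S: "is_subring S" and Q: "prime_ideal_in S Q" and I: "I \<subseteq> local_multiples S Q w n"
  shows "ipow S I k \<subseteq> local_multiples S Q w (k * n)"
proof (induction k)
  case 0
  show ?case unfolding ipow_simps local_multiples_def using prime_ideal_compl(1)[OF S Q]
    by (auto intro!: bexI[of _ 1])
next
  case (Suc k)
  show ?case unfolding ipow_simps
  proof (rule imult_least[OF local_multiples_ideal[OF S Q]])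
    fix a b assume "a \<in> I" "b \<in> ipow S I k"
    then obtain e s e' s' where *: "a \<in> S" "b \<in> S" "e \<in> S - Q" "e' \<in> S - Q" "s \<in> S" "s' \<in> S"
      "e * a = w ^ n * s" "e' * b = w ^ (k * n) * s'"
      using I Suc.IH unfolding local_multiples_def by blast
    have "(e * e') * (a * b) = (e * a) * (e' * b)" by (simp only: mult_ac)
    also have "\<dots> = w ^ (Suc k * n) * (s * s')" unfolding *(7,8) by (simp add: power_add mult_ac)
    finally show "a * b \<in> local_multiples S Q w (Suc k * n)"
      unfolding local_multiples_def
      using * prime_ideal_compl(2)[OF S Q *(3,4)] is_subringD(5)[OF S] by blast
  qed
qed

text \<open>\<open>w ^ m\<close> lies in the m-th power of \<open>Q\<close>. If it lay in a higher
  power, it would be a multiple of \<open>w ^ (m + 1)\<close> up to a factor outside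
  \<open>Q\<close>, and cancelling \<open>w ^ m\<close> would put that factor into
  \<open>Q\<close>.\<close>

lemma ram_index_local_unif:
  assumes S: "is_subring S" and Q: "prime_ideal_in S Q" and w: "local_unif S Q w"
    and p: "w ^ m \<in> p" "\<And>x. x \<in> p \<Longrightarrow> \<exists>s\<in>S. x = s * w ^ m"
  shows "ram_index S Q p = m"
  unfolding ram_index_def
proof (rule Greatest_equality)
  note R = is_subringD[OF S] and D = prime_idealD[OF S Q]
  obtain e where e: "e \<in> S - Q" "\<forall>x\<in>Q. \<exists>s\<in>S. e * x = w * s" and wQ: "w \<in> Q" "w \<noteq> 0"
    using w unfolding local_unif_def by blast
  have Q1: "Q \<subseteq> local_multiples S Q w 1"
    using e D(2) unfolding local_multiples_def power_one_right by blast
  have I: "ideal_in S (ipow S Q n)" for n by (rule ipow_ideal[OF S D(1)])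
  show "gen_ideal S p \<subseteq> ipow S Q m"
    by (rule gen_ideal_least[OF I]) (use p(2) ideal_inD(4)[OF I] ipow_memI[OF S wQ(1)] in blast)
  fix n assume "gen_ideal S p \<subseteq> ipow S Q n"
  hence "w ^ m \<in> ipow S Q n" using p(1) gen_ideal_superset by blast
  then obtain e s where s: "e \<in> S - Q" "s \<in> S" "e * w ^ m = w ^ n * s"
    using local_multiples_ipow[OF S Q Q1, of n] unfolding local_multiples_def by auto
  show "n \<le> m"
  proof (rule ccontr)
    assume "\<not> n \<le> m"
    then obtain k where k: "n = m + Suc k" using less_imp_Suc_add by (metis add_Suc_right not_le)
    have "e = w * (w ^ k * s)" using s(3) wQ(2) unfolding k by (simp add: power_add field_simps)
    also have "\<dots> \<in> Q" by (rule D(8)) (use wQ(1) D(2) s(2) R(5,7) in auto)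
    finally show False using s(1) by blast
  qed
qed

text \<open>For \<open>x\<close> in the intersection of the conjugates of \<open>Q\<close>, all traces of multiples of \<open>x\<close> are
  invariants in \<open>Q\<close>; the choice of the elements \<open>y \<sigma>\<close> allows one to eliminate all conjugates from
  these traces but \<open>x\<close> itself.\<close>
lemma trivial_inertia_local_unif:
  fixes H :: "(complex \<Rightarrow> complex) set"
  assumes S: "is_subring S" and Q: "prime_ideal_in S Q"
    and H: "finite H" "\<iota> \<in> H" "\<And>x. x \<in> S \<Longrightarrow> \<iota> x = x"
      "\<And>\<sigma> x. \<sigma> \<in> H \<Longrightarrow> x \<in> S \<Longrightarrow> \<sigma> x \<in> S"
      "\<And>\<sigma> x y. \<sigma> \<in> H \<Longrightarrow> x \<in> S \<Longrightarrow> y \<in> S \<Longrightarrow> \<sigma> (x * y) = \<sigma> x * \<sigma> y"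
      "\<And>\<sigma> x. \<sigma> \<in> H \<Longrightarrow> x \<in> S \<Longrightarrow> \<sigma> (\<sigma> (\<sigma> x)) = x"
    and tr: "\<And>x. x \<in> S \<Longrightarrow> (\<Sum>\<sigma>\<in>H. \<sigma> x) \<in> A"
    and y: "\<And>\<sigma>. \<sigma> \<in> H \<Longrightarrow> \<sigma> \<noteq> \<iota> \<Longrightarrow> \<exists>y\<in>S. \<sigma> y - y \<notin> Q"
    and w: "w \<in> Q" "w \<noteq> 0" and f: "f \<in> S - Q" "\<And>a. a \<in> Q \<Longrightarrow> a \<in> A \<Longrightarrow> \<exists>s\<in>S. f * a = w * s"
  shows "local_unif S Q w"
proof -
  note R = is_subringD[OF S] and D = prime_idealD[OF S Q] and C = prime_ideal_compl[OF S Q]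
  \<comment> \<open>Either some element outside \<open>Q\<close> is sent into \<open>Q\<close> by
    \<sigma> and serves as multiplier, or \<sigma> preserves the complement of \<open>Q\<close>;
    then, as the third iterate of \<sigma> is the identity, it also maps \<open>Q\<close> into
    itself. The product \<open>c0\<close> of these multipliers pushes \<open>Q\<close> into all
    conjugates at once.\<close>
  have "\<exists>c\<in>S - Q. \<forall>x\<in>Q. \<sigma> (c * x) \<in> Q" if s: "\<sigma> \<in> H" for \<sigma>
  proof (cases "\<exists>c\<in>S - Q. \<sigma> c \<in> Q")
    case True
    then obtain c where c: "c \<in> S - Q" "\<sigma> c \<in> Q" by blast
    have "\<sigma> (c * x) \<in> Q" if "x \<in> Q" for x
    proof -
      have x: "x \<in> S" using that D(2) by blast
      have "\<sigma> (c * x) = \<sigma> c * \<sigma> x" using H(5)[OF s _ x] c(1) by blast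
      thus ?thesis using D(8)[OF H(4)[OF s x] c(2)] by simp
    qed
    thus ?thesis using c by blast
  next
    case False
    have "\<sigma> x \<in> Q" if "x \<in> Q" for x
    proof -
      have x: "x \<in> S" using that D(2) by blast
      have "\<sigma> (\<sigma> (\<sigma> x)) \<in> Q" using H(6)[OF s x] that by simp
      thus ?thesis using False H(4)[OF s] x by blast
    qed
    thus ?thesis using C(1) by (intro bexI[of _ 1]) auto
  qed
  then obtain c where c: "\<And>\<sigma>. \<sigma> \<in> H \<Longrightarrow> c \<sigma> \<in> S - Q" "\<And>\<sigma> x. \<sigma> \<in> H \<Longrightarrow> x \<in> Q \<Longrightarrow> \<sigma> (c \<sigma> * x) \<in> Q"
    by metis
  define c0 where "c0 = prod c H"
  have c0: "c0 \<in> S - Q" unfolding c0_def by (rule C(4)) (rule c(1))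
  have c0x: "\<sigma> (c0 * x) \<in> Q" if s: "\<sigma> \<in> H" and x: "x \<in> Q" for \<sigma> x
  proof -
    have c0x: "c0 * x = prod c (H - {\<sigma>}) * (c \<sigma> * x)"
      unfolding c0_def using H(1) s by (simp add: prod.remove[of H \<sigma>])
    have "prod c (H - {\<sigma>}) \<in> S - Q" by (rule C(4)) (use c(1) in blast)
    moreover have "c \<sigma> * x \<in> S" using c(1)[OF s] x D(2) R(5) by blast
    ultimately have "\<sigma> (c0 * x) = \<sigma> (prod c (H - {\<sigma>})) * \<sigma> (c \<sigma> * x)"
      unfolding c0x using H(5)[OF s] by blast
    thus ?thesis using D(7) H(4)[OF s] \<open>prod c (H - {\<sigma>}) \<in> S - Q\<close> c(2)[OF s x] by auto
  qed
  obtain y where y: "\<And>\<sigma>. \<sigma> \<in> H \<Longrightarrow> \<sigma> \<noteq> \<iota> \<Longrightarrow> y \<sigma> \<in> S \<and> \<sigma> (y \<sigma>) - y \<sigma> \<notin> Q" using y by metis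
  define E where "E = {z \<in> S. \<exists>s\<in>S. f * z = w * s}"
  have E_diff: "a - b \<in> E" if "a \<in> E" "b \<in> E" for a b
  proof -
    from that obtain s s' where "a \<in> S" "b \<in> S" "s \<in> S" "s' \<in> S" "f * a = w * s" "f * b = w * s'"
      unfolding E_def by blast
    thus ?thesis unfolding E_def using R(4) by (auto simp: right_diff_distrib intro!: bexI[of _ "s - s'"])
  qed
  have E_mult: "r * a \<in> E" if "r \<in> S" "a \<in> E" for a r
  proof -
    from that obtain s where "a \<in> S" "s \<in> S" "f * a = w * s" unfolding E_def by blast
    moreover from this(3) have "f * (r * a) = w * (r * s)" by Groebner_Basis.algebra
    ultimately show ?thesis unfolding E_def using R(5) \<open>r \<in> S\<close> by blast
  qed
  \<comment> \<open>A weighted trace: the weight of the conjugate \<rho> vanishes as soon as \<rho>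
    is in \<open>T\<close>. For \<open>T = H - {\<iota>}\<close> only the identity survives, with
    weight \<open>d\<close> outside \<open>Q\<close>.\<close>
  define L where "L T z = (\<Sum>\<rho>\<in>H. (\<Prod>\<sigma>\<in>T. \<sigma> (y \<sigma>) - \<rho> (y \<sigma>)) * \<rho> z)" for T z
  have L: "L T (c0 * x * z) \<in> E" if "finite T" "T \<subseteq> H - {\<iota>}" "x \<in> Q" "z \<in> S" for T x z
    using that(1,2,4)
  proof (induction T arbitrary: z rule: finite_induct)
    case empty
    have xz: "x * z \<in> Q" using D(8) empty.prems(2) that(3) by blast
    have "\<rho> (c0 * x * z) \<in> Q" if "\<rho> \<in> H" for \<rho> using c0x[OF that xz] by (simp add: mult.assoc)
    hence "L {} (c0 * x * z) \<in> Q" unfolding L_def by (simp add: D(11))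
    moreover have "L {} (c0 * x * z) \<in> A" unfolding L_def
      using tr[of "c0 * x * z"] c0 R(5) that(3) empty.prems(2) D(2) by auto
    ultimately show ?case unfolding E_def using f(2) D(2) by blast
  next
    case (insert \<sigma> T)
    hence s: "\<sigma> \<in> H" "\<sigma> \<noteq> \<iota>" "T \<subseteq> H - {\<iota>}" by auto
    have yS: "y \<sigma> \<in> S" "\<sigma> (y \<sigma>) \<in> S" using y[OF s(1,2)] H(4)[OF s(1)] by auto
    have S': "c0 * x * z \<in> S" using c0 that(3) insert.prems(2) R(5) D(2) by blast
    \<comment> \<open>The new factor splits: its constant term comes out of the sum, and
      \<open>\<rho> (y \<sigma>)\<close> is absorbed into the argument of \<rho>. By induction the
      weighted traces are \<open>S\<close>-linear combinations of ordinary traces.\<close>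
    have "L (insert \<sigma> T) (c0 * x * z) = \<sigma> (y \<sigma>) * L T (c0 * x * z) - L T (c0 * x * (y \<sigma> * z))"
      unfolding L_def sum_distrib_left sum_subtractf[symmetric]
    proof (rule sum.cong)
      fix \<rho> assume r: "\<rho> \<in> H"
      have "\<rho> (c0 * x * (y \<sigma> * z)) = \<rho> (y \<sigma>) * \<rho> (c0 * x * z)"
        using H(5)[OF r yS(1) S'] by (simp add: mult_ac)
      thus "(\<Prod>\<sigma>\<in>insert \<sigma> T. \<sigma> (y \<sigma>) - \<rho> (y \<sigma>)) * \<rho> (c0 * x * z) =
        \<sigma> (y \<sigma>) * ((\<Prod>\<sigma>\<in>T. \<sigma> (y \<sigma>) - \<rho> (y \<sigma>)) * \<rho> (c0 * x * z)) -
        (\<Prod>\<sigma>\<in>T. \<sigma> (y \<sigma>) - \<rho> (y \<sigma>)) * \<rho> (c0 * x * (y \<sigma> * z))"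
        using insert.hyps by (simp add: algebra_simps)
    qed simp
    moreover have "\<sigma> (y \<sigma>) * L T (c0 * x * z) \<in> E"
      by (rule E_mult[OF yS(2)]) (rule insert.IH[OF s(3) insert.prems(2)])
    moreover have "L T (c0 * x * (y \<sigma> * z)) \<in> E"
      by (rule insert.IH[OF s(3) R(5)[OF yS(1) insert.prems(2)]])
    ultimately show ?case using E_diff by simp
  qed
  define d where "d = (\<Prod>\<sigma>\<in>H - {\<iota>}. \<sigma> (y \<sigma>) - y \<sigma>)"
  have d: "d \<in> S - Q" unfolding d_def by (rule C(4)) (use y H(4) R(4) in blast)
  have Lfull: "L (H - {\<iota>}) z = d * z" if "z \<in> S" for z
  proof -
    have "L (H - {\<iota>}) z = (\<Sum>\<rho>\<in>{\<iota>}. (\<Prod>\<sigma>\<in>H - {\<iota>}. \<sigma> (y \<sigma>) - \<rho> (y \<sigma>)) * \<rho> z)"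
      unfolding L_def
      by (rule sum.mono_neutral_right) (use H(1,2) in \<open>auto intro!: prod_zero\<close>)
    also have "\<dots> = d * z" unfolding d_def using H(3) that y by (auto intro!: prod.cong)
    finally show ?thesis .
  qed
  have "\<exists>s\<in>S. (f * (d * c0)) * x = w * s" if "x \<in> Q" for x
  proof -
    have "L (H - {\<iota>}) (c0 * x * 1) \<in> E" by (rule L) (use H(1) that R(2) in auto)
    moreover have "c0 * x \<in> S" using c0 that R(5) D(2) by blast
    ultimately have "d * (c0 * x) \<in> E" using Lfull by simp
    thus ?thesis unfolding E_def by (auto simp: mult_ac)
  qed
  moreover have "f * (d * c0) \<in> S - Q" by (intro C f(1) d c0)
  ultimately show ?thesis unfolding local_unif_def using w by blast
qed

section \<open>Valuations relative to a local uniformizer\<close>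

text \<open>The valuation at \<open>Q\<close> as a relation: \<open>x\<close> is
  \<open>w ^ n\<close> times a unit of the localisation. Whether such an \<open>n\<close> exists,
  and is unique, depends on \<open>w\<close> and \<open>x\<close> and is settled separately.\<close>

definition local_val :: "complex set \<Rightarrow> complex set \<Rightarrow> complex \<Rightarrow> complex \<Rightarrow> nat \<Rightarrow> bool" where
  "local_val S Q w x n \<longleftrightarrow> (\<exists>u\<in>S - Q. \<exists>s\<in>S - Q. u * x = w ^ n * s)"

lemma local_val_mult:
  assumes S: "is_subring S" and Q: "prime_ideal_in S Q"
    and "local_val S Q w x m" "local_val S Q w y n"
  shows "local_val S Q w (x * y) (m + n)"
proof -
  obtain u s u' s' where *: "u \<in> S - Q" "s \<in> S - Q" "u' \<in> S - Q" "s' \<in> S - Q"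
    "u * x = w ^ m * s" "u' * y = w ^ n * s'"
    using assms(3,4) unfolding local_val_def by blast
  have "(u * u') * (x * y) = (u * x) * (u' * y)" by (simp only: mult_ac)
  also have "\<dots> = w ^ (m + n) * (s * s')" unfolding *(5,6) power_add by (simp only: mult_ac)
  finally have "(u * u') * (x * y) = w ^ (m + n) * (s * s')" .
  thus ?thesis unfolding local_val_def using prime_ideal_compl(2)[OF S Q] * by blast
qed

lemma local_val_power:
  assumes S: "is_subring S" and Q: "prime_ideal_in S Q" and x: "local_val S Q w x m"
  shows "local_val S Q w (x ^ n) (n * m)"
proof (induction n)
  case 0
  show ?case unfolding local_val_def using prime_ideal_compl(1)[OF S Q] by auto
qed (use local_val_mult[OF S Q x] in auto)

lemma local_val_unit:
  assumes S: "is_subring S" and Q: "prime_ideal_in S Q" and "x \<in> S - Q"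
  shows "local_val S Q w x 0"
  unfolding local_val_def using prime_ideal_compl(1)[OF S Q] assms(3)
  by (intro bexI[of _ 1] bexI[of _ x]) auto

lemma local_val_self:
  assumes S: "is_subring S" and Q: "prime_ideal_in S Q"
  shows "local_val S Q w w 1"
  unfolding local_val_def using prime_ideal_compl(1)[OF S Q]
  by (intro bexI[of _ 1]) auto

lemma local_val_unique:
  assumes S: "is_subring S" and Q: "prime_ideal_in S Q" and w: "w \<in> Q" "w \<noteq> 0"
    and x: "local_val S Q w x m" "local_val S Q w x n"
  shows "m = n"
proof -
  have False if lt: "m < n" and v: "local_val S Q w x m" "local_val S Q w x n" for m n
  proof -
    note R = is_subringD[OF S] and D = prime_idealD[OF S Q]
    obtain u s u' s' where *: "u \<in> S - Q" "s \<in> S - Q" "u' \<in> S - Q" "s' \<in> S - Q"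
      "u * x = w ^ m * s" "u' * x = w ^ n * s'"
      using v unfolding local_val_def by blast
    obtain k where k: "n = m + Suc k" using lt less_imp_Suc_add by auto
    have "w ^ m * (s * u') = (u * x) * u'" unfolding *(5) by (simp only: mult_ac)
    also have "\<dots> = (u' * x) * u" by (simp only: mult_ac)
    also have "\<dots> = w ^ n * (s' * u)" unfolding *(6) by (simp only: mult_ac)
    finally have "w ^ m * (s * u') = w ^ m * (w * (w ^ k * (s' * u)))" unfolding k power_add by simp
    hence "s * u' = w * (w ^ k * (s' * u))" using w(2) by simp
    also have "\<dots> \<in> Q" by (rule D(8)) (use * w D(2) R(5,7) in auto)
    finally show False using prime_ideal_compl(2)[OF S Q, of s u'] * by blast
  qed
  from this[of m n] this[of n m] x show ?thesis by (cases m n rule: linorder_cases) auto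
qed

text \<open>The multiple \<open>x * y\<close> of known valuation \<open>n\<close> bounds how often
  \<open>w\<close> can be divided out of \<open>x\<close>, since each division lowers
  \<open>n\<close>; no Noetherian argument is needed. Later \<open>y\<close> is the product of the
  other conjugates of \<open>x\<close>.\<close>

lemma local_val_exists:
  assumes S: "is_subring S" and Q: "prime_ideal_in S Q" and w: "local_unif S Q w"
    and xy: "x \<in> S" "y \<in> S" "local_val S Q w (x * y) n"
  shows "\<exists>j. local_val S Q w x j"
  using xy
proof (induction n arbitrary: x)
  note R = is_subringD[OF S] and D = prime_idealD[OF S Q] and C = prime_ideal_compl[OF S Q]
  case 0
  then obtain u s where us: "u \<in> S - Q" "s \<in> S - Q" "u * (x * y) = s" unfolding local_val_def by auto
  have "x \<notin> Q"
  proof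
    assume "x \<in> Q"
    hence "u * (x * y) \<in> Q" using us 0 D(7,8) by blast
    thus False using us by simp
  qed
  thus ?case using local_val_unit[OF S Q] 0 by blast
next
  note R = is_subringD[OF S] and D = prime_idealD[OF S Q] and C = prime_ideal_compl[OF S Q]
  case (Suc n)
  show ?case
  proof (cases "x \<in> Q")
    case True
    obtain e where e: "e \<in> S - Q" "\<And>x. x \<in> Q \<Longrightarrow> \<exists>s\<in>S. e * x = w * s" and wQ: "w \<in> Q" "w \<noteq> 0"
      using w unfolding local_unif_def by blast
    obtain z where z: "z \<in> S" "e * x = w * z" using e(2)[OF True] by blast
    obtain u s where us: "u \<in> S - Q" "s \<in> S - Q" "u * (x * y) = w ^ Suc n * s"
      using Suc.prems(3) unfolding local_val_def by blast
    have "w * (u * (z * y)) = e * (u * (x * y))" using z(2) by Groebner_Basis.algebra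
    also have "\<dots> = w * (w ^ n * (e * s))" using us(3) by (simp add: mult_ac)
    finally have "u * (z * y) = w ^ n * (e * s)" using wQ(2) by simp
    hence "local_val S Q w (z * y) n" unfolding local_val_def using us C(2)[OF e(1)] by blast
    then obtain j where "local_val S Q w z j" using Suc.IH[OF z(1) Suc.prems(2)] by blast
    then obtain u' s' where us': "u' \<in> S - Q" "s' \<in> S - Q" "u' * z = w ^ j * s'"
      unfolding local_val_def by blast
    have "(u' * e) * x = w ^ Suc j * s'" using us'(3) z(2) by (simp add: mult_ac) (metis mult.left_commute)
    hence "local_val S Q w x (Suc j)" unfolding local_val_def using us' C(2)[OF _ e(1)] by blast
    thus ?thesis by blast
  next
    case False
    thus ?thesis using local_val_unit[OF S Q] Suc.prems by blast
  qed
qed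

section \<open>The ring of Eisenstein integers\<close>

lemma kk_subfield: "is_subfield kk" and zeta3_in_kk: "zeta3 \<in> kk"
  unfolding kk_def using gen_field_subfield gen_field_superset by auto

lemma kk_coords:
  assumes "x \<in> kk"
  shows "\<exists>a\<in>\<rat>. \<exists>b\<in>\<rat>. x = complex_of_real a + complex_of_real b * zeta3"
proof -
  let ?F = "{complex_of_real a + complex_of_real b * zeta3 | a b. a \<in> \<rat> \<and> b \<in> \<rat>}"
  have FI: "complex_of_real a + complex_of_real b * zeta3 \<in> ?F" if "a \<in> \<rat>" "b \<in> \<rat>" for a b
    using that by blast
  have "is_subfield ?F" unfolding is_subfield_def
  proof (intro conjI ballI impI)
    show "0 \<in> ?F" "1 \<in> ?F"
      using FI[of 0 0] FI[of 1 0] by simp_all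
    fix x assume "x \<in> ?F"
    then obtain a b where x: "x = complex_of_real a + complex_of_real b * zeta3" "a \<in> \<rat>" "b \<in> \<rat>" by blast
    show "inverse x \<in> ?F" if "x \<noteq> 0"
    proof -
      define n where "n = a\<^sup>2 - a * b + b\<^sup>2"
      have n0: "n \<noteq> 0"
      proof
        assume "n = 0"
        \<comment> \<open>The left side is four times the norm form \<open>n\<close>, written as a
          positively weighted sum of squares.\<close>
        hence "(2 * a - b)\<^sup>2 + 3 * b\<^sup>2 = 0" unfolding n_def by (simp add: power2_eq_square algebra_simps)
        hence "b = 0" "a = 0" by (auto simp: add_nonneg_eq_0_iff)
        thus False using x that by simp
      qed
      have "x * (complex_of_real (a - b) + complex_of_real (- b) * zeta3) = complex_of_real n"
        unfolding x n_def of_real_diff of_real_add of_real_mult of_real_power of_real_minus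
        using zeta3_sum by Groebner_Basis.algebra
      hence "inverse x = (complex_of_real (a - b) + complex_of_real (- b) * zeta3) / complex_of_real n"
        using that n0 by (simp add: field_simps)
      also have "\<dots> = complex_of_real ((a - b) / n) + complex_of_real (- b / n) * zeta3"
        by (simp add: add_divide_distrib diff_divide_distrib)
      finally show ?thesis using x unfolding n_def by fastforce
    qed
    fix y assume "y \<in> ?F"
    then obtain c d where y: "y = complex_of_real c + complex_of_real d * zeta3" "c \<in> \<rat>" "d \<in> \<rat>" by blast
    have "x + y = complex_of_real (a + c) + complex_of_real (b + d) * zeta3"
      unfolding x y by (simp add: algebra_simps)
    thus "x + y \<in> ?F" using x y by (blast intro: Rats_add)
    have "x - y = complex_of_real (a - c) + complex_of_real (b - d) * zeta3"
      unfolding x y by (simp add: algebra_simps)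
    thus "x - y \<in> ?F" using x y by (blast intro: Rats_diff)
    have "x * y = complex_of_real (a * c - b * d) + complex_of_real (a * d + b * c - b * d) * zeta3"
      unfolding x y of_real_diff of_real_add of_real_mult using zeta3_sum by Groebner_Basis.algebra
    thus "x * y \<in> ?F" using x y by (blast intro: Rats_add Rats_diff Rats_mult)
  qed
  moreover have "zeta3 \<in> ?F" using FI[of 0 1] by simp
  ultimately have "kk \<subseteq> ?F" unfolding kk_def by (intro gen_field_least) auto
  thus ?thesis using assms by blast
qed

lemma cnj_zeta3: "cnj zeta3 = zeta3\<^sup>2"
  unfolding zeta3_def by (simp add: complex_eq_iff power2_eq_square field_simps)

lemma cmod_zeta3_coords: "(cmod (complex_of_real a + complex_of_real b * zeta3))\<^sup>2 = a\<^sup>2 - a * b + b\<^sup>2"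
proof -
  have "complex_of_real ((cmod (complex_of_real a + complex_of_real b * zeta3))\<^sup>2) =
      (complex_of_real a + complex_of_real b * zeta3) * (complex_of_real a + complex_of_real b * zeta3\<^sup>2)"
    unfolding complex_norm_square by (simp add: cnj_zeta3)
  also have "\<dots> = complex_of_real (a\<^sup>2 - a * b + b\<^sup>2)"
    unfolding of_real_diff of_real_add of_real_mult of_real_power
    using zeta3_sum by Groebner_Basis.algebra
  finally show ?thesis by (simp only: of_real_eq_iff)
qed

lemma cnj_kk: assumes "x \<in> kk" shows "cnj x \<in> kk"
proof -
  obtain a b where x: "x = complex_of_real a + complex_of_real b * zeta3" "a \<in> \<rat>" "b \<in> \<rat>"
    using kk_coords[OF assms] by blast
  note S = is_subfieldD[OF kk_subfield]
  have Q: "complex_of_real q \<in> kk" if "q \<in> \<rat>" for q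
    using that by (auto elim!: Rats_cases' intro!: S(11,12) simp: of_real_divide)
  show ?thesis unfolding x by (simp add: cnj_zeta3 Q x S zeta3_in_kk)
qed

definition eis_norm :: "complex \<Rightarrow> nat" where
  "eis_norm x = nat \<lfloor>(cmod x)\<^sup>2\<rfloor>"

text \<open>The squared modulus is \<open>x\<close> times its complex conjugate, hence both rational
  and an algebraic integer, so the floor in the definition of \<open>eis_norm\<close> loses
  nothing.\<close>

lemma eis_norm:
  assumes "x \<in> intO kk" shows "real (eis_norm x) = (cmod x)\<^sup>2"
proof -
  have x: "x \<in> kk" "alg_int x" using assms unfolding intO_def by auto
  obtain a b where ab: "x = complex_of_real a + complex_of_real b * zeta3" "a \<in> \<rat>" "b \<in> \<rat>"
    using kk_coords[OF x(1)] by blast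
  have "(cmod x)\<^sup>2 \<in> \<rat>" unfolding ab(1) cmod_zeta3_coords using ab by simp
  moreover have "alg_int (complex_of_real ((cmod x)\<^sup>2))"
    unfolding complex_norm_square
    using alg_int_ring(3)[OF x(2), of "cnj x"] x(2) unfolding alg_int_iff by simp
  ultimately have "(cmod x)\<^sup>2 \<in> \<int>" unfolding alg_int_iff algebraic_int_of_real_iff
    by (rule rational_algebraic_int_is_int[rotated])
  then obtain n where "(cmod x)\<^sup>2 = of_int n" by (auto elim: Ints_cases)
  moreover from this have "n \<ge> 0" by (metis of_int_0_le_iff zero_le_power2)
  ultimately show ?thesis unfolding eis_norm_def by simp
qed

text \<open>Rounding both coordinates leaves errors of at most 1/2, for which the norm form is at
  most 3/4. This is the Euclidean property.\<close>

lemma eisenstein_approx: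
  assumes "x \<in> kk" shows "\<exists>z\<in>intO kk. cmod (x - z) < 1"
proof -
  obtain a b where x: "x = complex_of_real a + complex_of_real b * zeta3"
    using kk_coords[OF assms] by blast
  define z where "z = complex_of_int (round a) + complex_of_int (round b) * zeta3"
  define c d where "c = a - of_int (round a)" and "d = b - of_int (round b)"
  have cd: "\<bar>c\<bar> \<le> 1/2" "\<bar>d\<bar> \<le> 1/2"
    unfolding c_def d_def using of_int_round_abs_le[of a] of_int_round_abs_le[of b]
    by (simp_all add: abs_minus_commute)
  have "x - z = complex_of_real c + complex_of_real d * zeta3"
    unfolding x z_def c_def d_def by (simp add: algebra_simps)
  hence "(cmod (x - z))\<^sup>2 = c\<^sup>2 - c * d + d\<^sup>2" by (simp add: cmod_zeta3_coords)
  also have "\<dots> \<le> \<bar>c\<bar>\<^sup>2 + \<bar>c\<bar> * \<bar>d\<bar> + \<bar>d\<bar>\<^sup>2"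
    using abs_ge_minus_self[of "c * d"] by (simp add: abs_mult)
  also have "\<dots> \<le> (1/2)\<^sup>2 + (1/2) * (1/2) + (1/2)\<^sup>2"
    using cd by (intro add_mono power_mono mult_mono) auto
  also have "\<dots> < 1" by (simp add: power2_eq_square)
  finally have "cmod (x - z) < 1" by (simp add: power2_less_1_iff)
  moreover have "z \<in> intO kk"
    unfolding z_def intO_def using is_subfieldD[OF kk_subfield] zeta3_in_kk
      is_subringD(3,5)[OF is_subring_alg_int] alg_int_zeta3 by simp
  ultimately show ?thesis by blast
qed

lemma Ok_subring: "is_subring (intO kk)"
  by (rule intO_subring[OF kk_subfield])

lemma principal_mem: "x \<in> principal S a \<longleftrightarrow> (\<exists>s\<in>S. x = s * a)"
  unfolding principal_def by blast

lemma Ok_principal: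
  assumes I: "ideal_in (intO kk) I" shows "\<exists>g\<in>I. I = principal (intO kk) g"
proof (cases "I \<subseteq> {0}")
  case True
  hence "I = {0}" using ideal_inD(2)[OF I] by auto
  moreover have "principal (intO kk) 0 = {0}"
    unfolding principal_def using is_subringD(1)[OF Ok_subring] by auto
  ultimately show ?thesis by blast
next
  case False
  note R = is_subringD[OF Ok_subring] and D = ideal_inD[OF I]
  from False obtain g where g: "g \<in> I \<and> g \<noteq> 0" and min: "\<And>h. h \<in> I \<and> h \<noteq> 0 \<Longrightarrow> eis_norm g \<le> eis_norm h"
    using ex_has_least_nat[of "\<lambda>h. h \<in> I \<and> h \<noteq> 0" _ eis_norm] by blast
  have gO: "g \<in> intO kk" using g D(1) by blast
  have "x \<in> principal (intO kk) g" if x: "x \<in> I" for x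
  proof -
    have "x / g \<in> kk" using x g D(1) is_subfieldD(11)[OF kk_subfield] unfolding intO_def by blast
    then obtain z where z: "z \<in> intO kk" "cmod (x / g - z) < 1" using eisenstein_approx by blast
    have "(- z) * g \<in> I" using D(4) R(6) z(1) g by blast
    from D(3)[OF x this] have y: "x - z * g \<in> I" by simp
    have "x - z * g = (x / g - z) * g" using g by (simp add: field_simps)
    hence "cmod (x - z * g) < cmod g" using z(2) g by (simp add: norm_mult)
    hence "(cmod (x - z * g))\<^sup>2 < (cmod g)\<^sup>2" by (simp add: power_strict_mono)
    hence "eis_norm (x - z * g) < eis_norm g"
      using eis_norm[OF gO] eis_norm[of "x - z * g"] y D(1) by (metis of_nat_less_iff subsetD)
    hence "x - z * g = 0" using min[of "x - z * g"] y by force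
    thus ?thesis using z(1) unfolding principal_mem by auto
  qed
  moreover have "principal (intO kk) g \<subseteq> I" using D(4) g unfolding principal_def by blast
  ultimately show ?thesis using g by blast
qed

lemma Ok_prime_generator:
  assumes p: "prime_ideal_in (intO kk) p"
  obtains g where "g \<in> p" "g \<noteq> 0" "p = principal (intO kk) g"
proof -
  obtain g where g: "g \<in> p" "p = principal (intO kk) g"
    using Ok_principal[OF prime_idealD(1)[OF Ok_subring p]] by blast
  moreover have "g \<noteq> 0"
  proof
    assume "g = 0"
    hence "p \<subseteq> {0}" using g(2) unfolding principal_def by auto
    thus False using p prime_idealD(9)[OF Ok_subring p] unfolding prime_ideal_in_def by blast
  qed
  ultimately show ?thesis using that by blast
qed

text \<open>Write g = s g' for the two generators. If g' were outside \<open>p\<close>, primality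
  would put s into \<open>p\<close>, and cancelling g would make g' a unit.\<close>

lemma Ok_prime_maximal:
  assumes p: "prime_ideal_in (intO kk) p" "prime_ideal_in (intO kk) p'" "p \<subseteq> p'"
  shows "p = p'"
proof -
  obtain g where g: "g \<in> p" "g \<noteq> 0" "p = principal (intO kk) g" using p(1) by (rule Ok_prime_generator)
  obtain g' where g': "g' \<in> p'" "p' = principal (intO kk) g'" using p(2) by (rule Ok_prime_generator)
  note D = prime_idealD[OF Ok_subring p(1)] and D' = prime_idealD[OF Ok_subring p(2)]
  have "g \<in> principal (intO kk) g'" using g(1) p(3) g'(2) by blast
  then obtain s where s: "s \<in> intO kk" "g = s * g'" unfolding principal_mem by blast
  have "g' \<in> p"
  proof (rule ccontr)
    assume "g' \<notin> p"
    hence "s \<in> p" using D(4)[of s g'] s g(1) g'(1) D'(2) by blast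
    then obtain t where t: "t \<in> intO kk" "s = t * g" unfolding g(3) principal_mem by blast
    hence "1 = t * g'" using s(2) g(2) by (simp add: mult_ac)
    thus False using D'(3) D'(7)[OF t(1) g'(1)] by simp
  qed
  hence "p' \<subseteq> p" using D(7) unfolding g'(2) principal_def by blast
  thus ?thesis using p(3) by blast
qed

lemma Ok_local_val_exists:
  assumes p: "prime_ideal_in (intO kk) p" and g: "p = principal (intO kk) g"
    and x: "x \<in> intO kk" "x \<noteq> 0"
  shows "\<exists>n. local_val (intO kk) p g x n"
  using x
proof (induction "eis_norm x" arbitrary: x rule: less_induct)
  case less
  note R = is_subringD[OF Ok_subring] and D = prime_idealD[OF Ok_subring p]
  show ?case
  proof (cases "x \<in> p")
    case True
    then obtain y where y: "y \<in> intO kk" "x = y * g" unfolding g principal_mem by blast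
    have gp: "g \<in> p" unfolding g principal_mem using R(2) by (intro bexI[of _ 1]) auto
    have gO: "g \<in> intO kk" using gp D(2) by blast
    have y0: "y \<noteq> 0" "g \<noteq> 0" using less.prems y by auto
    \<comment> \<open>An element of norm 1 is a unit with its complex conjugate as inverse. Hence
      division by \<open>g\<close> strictly decreases the norm and the induction terminates.\<close>
    have "eis_norm g \<noteq> 1"
    proof
      assume "eis_norm g = 1"
      hence "(cmod g)\<^sup>2 = 1" using eis_norm[OF gO] by simp
      hence "cnj g * g = 1" using complex_norm_square[of g] by (simp add: mult.commute flip: of_real_power)
      moreover have "cnj g \<in> intO kk" using gO cnj_kk unfolding intO_def alg_int_iff by simp
      ultimately show False using D(3) D(7)[OF _ gp] by metis
    qed
    moreover have pos: "eis_norm g > 0" "eis_norm y > 0"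
      using eis_norm[OF gO] eis_norm[OF y(1)] y0 by (metis of_nat_0_less_iff zero_less_norm_iff zero_less_power)+
    moreover have "real (eis_norm x) = real (eis_norm y * eis_norm g)"
      using eis_norm[OF gO] eis_norm[OF y(1)] eis_norm[OF less.prems(1)] y(2)
      by (simp add: norm_mult power_mult_distrib)
    hence "eis_norm x = eis_norm y * eis_norm g" by (simp only: of_nat_eq_iff)
    ultimately have "eis_norm y < eis_norm x" by simp
    from less.hyps[OF this y(1) y0(1)] obtain n where "local_val (intO kk) p g y n" by blast
    from local_val_mult[OF Ok_subring p this local_val_self[OF Ok_subring p]]
    show ?thesis unfolding y(2) by blast
  next
    case False
    thus ?thesis using local_val_unit[OF Ok_subring p] less.prems by blast
  qed
qed

section \<open>Cubic Kummer extensions of the Eisenstein field\<close>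

lemma kummer_conjugation:
  assumes F: "is_subfield F" "zeta3 \<in> F" and r: "r ^ 3 \<in> F" "r \<notin> F"
  shows "\<exists>\<psi>. fhom (adj F r) \<psi> \<and> (\<forall>x\<in>adj F r. \<psi> x \<in> adj F r) \<and>
    (\<forall>u\<in>F. \<forall>v\<in>F. \<forall>w\<in>F. \<psi> (u + v * r + w * r\<^sup>2) = u + (v * zeta3) * r + (w * zeta3\<^sup>2) * r\<^sup>2)"
proof -
  have "fhom F (\<lambda>x. x)" unfolding fhom_def by simp
  then obtain \<psi> where \<psi>: "fhom (adj F r) \<psi>" "\<And>x. x \<in> F \<Longrightarrow> \<psi> x = x" "\<psi> r = zeta3 * r"
    using fhom_extend[OF F r, of "\<lambda>x. x" "zeta3 * r"] by (auto simp: power_mult_distrib zeta3_cube)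
  note E = adj_subfield[OF F r(1)]
  note SF = is_subfieldD[OF F(1)] and SE = is_subfieldD[OF E] and H = fhomD[OF E \<psi>(1)]
  have sub: "F \<subseteq> adj F r" "r \<in> adj F r" by (rule adj_superset[OF F(1)])+
  have *: "\<psi> (u + v * r + w * r\<^sup>2) = u + (v * zeta3) * r + (w * zeta3\<^sup>2) * r\<^sup>2"
    if uvw: "u \<in> F" "v \<in> F" "w \<in> F" for u v w
  proof -
    have m: "u \<in> adj F r" "v \<in> adj F r" "w \<in> adj F r" using uvw sub by auto
    show ?thesis by (simp add: H SE m sub \<psi>(2,3) uvw power_mult_distrib mult_ac)
  qed
  have "\<psi> x \<in> adj F r" if "x \<in> adj F r" for x
  proof -
    obtain u v w where uvw: "u \<in> F" "v \<in> F" "w \<in> F" "x = u + v * r + w * r\<^sup>2"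
      using \<open>x \<in> adj F r\<close> by (rule adjE)
    show ?thesis unfolding uvw(4) *[OF uvw(1-3)] by (rule adjI) (intro SF uvw F(2))+
  qed
  thus ?thesis using \<psi>(1) * by blast
qed

lemma subring_numeral: assumes "is_subring S" shows "numeral n \<in> S"
proof -
  have "of_nat k \<in> S" for k by (induction k) (auto intro: is_subringD[OF assms])
  from this[of "numeral n"] show ?thesis by simp
qed

text \<open>A nontrivial \<open>zeta3 ^ i - 1\<close> divides 3, so it is a unit at
  \<open>Q\<close>. An automorphism multiplying \<open>y\<close> by \<open>zeta3 ^ i\<close>
  therefore moves \<open>y\<close> modulo \<open>Q\<close>.\<close>

lemma zeta3_diff_notin:
  assumes S: "is_subring S" "zeta3 \<in> S" and Q: "prime_ideal_in S Q" "3 \<notin> Q"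
    and y: "y \<in> S" "y \<notin> Q" and i: "zeta3 ^ i \<noteq> 1"
  shows "zeta3 ^ i * y - y \<notin> Q"
proof
  assume a: "zeta3 ^ i * y - y \<in> Q"
  note R = is_subringD[OF S(1)] and D = prime_idealD[OF S(1) Q(1)]
  have *: "(zeta3 - 1) * (zeta3\<^sup>2 - 1) = 3" using zeta3_sum by Groebner_Basis.algebra
  have "i mod 3 < 3" by simp
  hence "i mod 3 = 0 \<or> i mod 3 = 1 \<or> i mod 3 = 2" by linarith
  hence "zeta3 ^ i = zeta3 \<or> zeta3 ^ i = zeta3\<^sup>2" 
    using zeta3_power_mod[of i] i by (metis power_0 power_one_right)
  hence "(zeta3\<^sup>2 - 1) * (zeta3 ^ i * y - y) = 3 * y \<or> (zeta3 - 1) * (zeta3 ^ i * y - y) = 3 * y"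
  proof
    assume "zeta3 ^ i = zeta3"
    hence "(zeta3\<^sup>2 - 1) * (zeta3 ^ i * y - y) = ((zeta3 - 1) * (zeta3\<^sup>2 - 1)) * y" by (simp add: algebra_simps)
    thus ?thesis unfolding * by simp
  next
    assume "zeta3 ^ i = zeta3\<^sup>2"
    hence "(zeta3 - 1) * (zeta3 ^ i * y - y) = ((zeta3 - 1) * (zeta3\<^sup>2 - 1)) * y" by (simp add: algebra_simps)
    thus ?thesis unfolding * by simp
  qed
  moreover have "zeta3\<^sup>2 - 1 \<in> S" "zeta3 - 1 \<in> S" by (intro R S(2))+
  ultimately have "3 * y \<in> Q" using D(7)[OF _ a] by metis
  moreover have "3 \<in> S" by (rule subring_numeral[OF S(1)])
  ultimately show False using D(4) Q(2) y by blast
qed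

lemma intO_mono: "F \<subseteq> E \<Longrightarrow> intO F \<subseteq> intO E"
  unfolding intO_def by blast

lemma intO_zeta3: "zeta3 \<in> F \<Longrightarrow> zeta3 \<in> intO F"
  unfolding intO_def using alg_int_zeta3 by simp

lemma kk_least: "is_subfield F \<Longrightarrow> zeta3 \<in> F \<Longrightarrow> kk \<subseteq> F"
  unfolding kk_def by (rule gen_field_least) auto

locale kummer =
  fixes r :: complex
  assumes r3: "r ^ 3 \<in> intO kk" and r_notin: "r \<notin> kk"
begin

abbreviation "KF \<equiv> adj kk r"
abbreviation "KO \<equiv> intO (adj kk r)"

lemma r3k: "r ^ 3 \<in> kk"
  using r3 unfolding intO_def by blast

lemma r_neq_0: "r \<noteq> 0"
  using r_notin is_subfieldD(1)[OF kk_subfield] by auto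

lemma KF_subfield: "is_subfield KF"
  by (rule adj_subfield[OF kk_subfield zeta3_in_kk r3k])

lemma KO_subring: "is_subring KO"
  by (rule intO_subring[OF KF_subfield])

lemma kk_sub: "kk \<subseteq> KF" and r_in: "r \<in> KF"
  using adj_superset[OF kk_subfield] by auto

lemma Ok_sub: "intO kk \<subseteq> KO"
  by (rule intO_mono[OF kk_sub])

lemma r_KO: "r \<in> KO"
  unfolding intO_def using r_in alg_int_root[of r 3] r3 by (auto simp: intO_def)

lemma zeta3_KO: "zeta3 \<in> KO"
  using intO_zeta3 kk_sub zeta3_in_kk by blast

text \<open>A generator of the Galois group of k(r) over k, chosen once as a total function whose
  values matter only on \<open>KF\<close>. The given \<tau> agrees with it there, see
  \<open>conj_eq\<close>.\<close>

definition conj :: "complex \<Rightarrow> complex" where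
  "conj = (SOME \<psi>. fhom KF \<psi> \<and> (\<forall>x\<in>KF. \<psi> x \<in> KF) \<and>
    (\<forall>u\<in>kk. \<forall>v\<in>kk. \<forall>w\<in>kk. \<psi> (u + v * r + w * r\<^sup>2) = u + (v * zeta3) * r + (w * zeta3\<^sup>2) * r\<^sup>2))"

lemma conj: "fhom KF conj" "\<And>x. x \<in> KF \<Longrightarrow> conj x \<in> KF"
  "\<And>u v w. u \<in> kk \<Longrightarrow> v \<in> kk \<Longrightarrow> w \<in> kk \<Longrightarrow>
    conj (u + v * r + w * r\<^sup>2) = u + (v * zeta3) * r + (w * zeta3\<^sup>2) * r\<^sup>2"
  using someI_ex[OF kummer_conjugation[OF kk_subfield zeta3_in_kk r3k r_notin], folded conj_def] by auto

lemma conj_KO: "x \<in> KO \<Longrightarrow> conj x \<in> KO"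
  unfolding intO_def using conj(2) fhom_alg_int[OF KF_subfield conj(1)] by blast

lemma conj_r: "conj r = zeta3 * r"
  using conj(3)[of 0 1 0] is_subfieldD[OF kk_subfield] by simp

lemma conj_kk: "x \<in> kk \<Longrightarrow> conj x = x"
  using conj(3)[of x 0 0] is_subfieldD[OF kk_subfield] by simp

lemma conj2:
  assumes "u \<in> kk" "v \<in> kk" "w \<in> kk"
  shows "conj (conj (u + v * r + w * r\<^sup>2)) = u + (v * zeta3\<^sup>2) * r + (w * zeta3) * r\<^sup>2"
proof -
  note S = is_subfieldD[OF kk_subfield]
  have "conj (conj (u + v * r + w * r\<^sup>2)) = u + (v * zeta3 * zeta3) * r + (w * zeta3\<^sup>2 * zeta3\<^sup>2) * r\<^sup>2"
    unfolding conj(3)[OF assms] by (rule conj(3)) (intro S assms zeta3_in_kk)+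
  also have "\<dots> = u + (v * zeta3\<^sup>2) * r + (w * zeta3) * r\<^sup>2"
    using zeta3_sum by Groebner_Basis.algebra
  finally show ?thesis .
qed

lemma conj3: assumes "x \<in> KF" shows "conj (conj (conj x)) = x"
proof -
  note S = is_subfieldD[OF kk_subfield]
  obtain u v w where uvw: "u \<in> kk" "v \<in> kk" "w \<in> kk" "x = u + v * r + w * r\<^sup>2" using assms by (rule adjE)
  have "conj (conj (conj x)) = u + (v * zeta3 * zeta3\<^sup>2) * r + (w * zeta3\<^sup>2 * zeta3) * r\<^sup>2"
    unfolding uvw(4) conj(3)[OF uvw(1-3)] by (rule conj2) (intro S uvw zeta3_in_kk)+
  also have "\<dots> = x" unfolding uvw(4) using zeta3_sum by Groebner_Basis.algebra
  finally show ?thesis .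
qed

text \<open>The Lagrange resolvents of \<open>x\<close> are integral and equal, up to powers of
  \<open>r\<close>, three times its coordinates. So \<open>3 * r ^ 3\<close> clears all
  denominators, and the constant coordinate becomes the trace.\<close>

lemma coords_integral:
  assumes x: "x \<in> KO"
  obtains U V W where "U \<in> intO kk" "V \<in> intO kk" "W \<in> intO kk"
    "r ^ 3 * (3 * x) = r ^ 3 * U + V * r + W * r\<^sup>2" "U = x + conj x + conj (conj x)"
proof -
  note S = is_subfieldD[OF kk_subfield] and R = is_subringD[OF is_subring_alg_int, unfolded mem_Collect_eq]
  have xF: "x \<in> KF" and xa: "alg_int x" using x unfolding intO_def by auto
  obtain u v w where uvw: "u \<in> kk" "v \<in> kk" "w \<in> kk" "x = u + v * r + w * r\<^sup>2" using xF by (rule adjE)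
  have c1: "conj x = u + (v * zeta3) * r + (w * zeta3\<^sup>2) * r\<^sup>2" unfolding uvw(4) by (rule conj(3)[OF uvw(1-3)])
  have c2: "conj (conj x) = u + (v * zeta3\<^sup>2) * r + (w * zeta3) * r\<^sup>2" unfolding uvw(4) by (rule conj2[OF uvw(1-3)])
  have a: "alg_int (conj x)" "alg_int (conj (conj x))" "alg_int r"
    using conj_KO x r_KO unfolding intO_def by blast+
  have "3 * u = x + conj x + conj (conj x)"
    unfolding c2 unfolding c1 unfolding uvw(4) using zeta3_sum by Groebner_Basis.algebra
  moreover have "3 * (r ^ 3 * v) = r\<^sup>2 * (x + zeta3\<^sup>2 * conj x + zeta3 * conj (conj x))"
    unfolding c2 unfolding c1 unfolding uvw(4) using zeta3_sum by Groebner_Basis.algebra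
  moreover have "3 * (r ^ 3 * w) = r * (x + zeta3 * conj x + zeta3\<^sup>2 * conj (conj x))"
    unfolding c2 unfolding c1 unfolding uvw(4) using zeta3_sum by Groebner_Basis.algebra
  ultimately have "alg_int (3 * u)" "alg_int (3 * (r ^ 3 * v))" "alg_int (3 * (r ^ 3 * w))"
    using a xa alg_int_zeta3 by (simp_all add: R)
  moreover have "3 * u \<in> kk" "3 * (r ^ 3 * v) \<in> kk" "3 * (r ^ 3 * w) \<in> kk"
    using uvw r3k by (simp_all add: S)
  ultimately have "3 * u \<in> intO kk" "3 * (r ^ 3 * v) \<in> intO kk" "3 * (r ^ 3 * w) \<in> intO kk"
    unfolding intO_def by auto
  moreover have "r ^ 3 * (3 * x) = r ^ 3 * (3 * u) + (3 * (r ^ 3 * v)) * r + (3 * (r ^ 3 * w)) * r\<^sup>2"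
    unfolding uvw(4) by (simp add: algebra_simps)
  ultimately show ?thesis using \<open>3 * u = _\<close> that by blast
qed

lemma trace_Ok: assumes "x \<in> KO" shows "x + conj x + conj (conj x) \<in> intO kk"
proof -
  obtain U V W where "U \<in> intO kk" "V \<in> intO kk" "W \<in> intO kk"
    "r ^ 3 * (3 * x) = r ^ 3 * U + V * r + W * r\<^sup>2" "U = x + conj x + conj (conj x)"
    using assms by (rule coords_integral)
  thus ?thesis by blast
qed

lemma norm_Ok: assumes "x \<in> KO" shows "x * (conj x * conj (conj x)) \<in> intO kk"
proof -
  note S = is_subfieldD[OF kk_subfield] and R = is_subringD[OF KO_subring]
  have xF: "x \<in> KF" using assms unfolding intO_def by auto
  obtain u v w where uvw: "u \<in> kk" "v \<in> kk" "w \<in> kk" "x = u + v * r + w * r\<^sup>2" using xF by (rule adjE)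
  have c1: "conj x = u + (v * zeta3) * r + (w * zeta3\<^sup>2) * r\<^sup>2" unfolding uvw(4) by (rule conj(3)[OF uvw(1-3)])
  have c2: "conj (conj x) = u + (v * zeta3\<^sup>2) * r + (w * zeta3) * r\<^sup>2" unfolding uvw(4) by (rule conj2[OF uvw(1-3)])
  have "x * (conj x * conj (conj x)) = u ^ 3 + r ^ 3 * v ^ 3 + (r ^ 3)\<^sup>2 * w ^ 3 - 3 * r ^ 3 * u * v * w"
    unfolding c2 unfolding c1 unfolding uvw(4) using zeta3_sum by Groebner_Basis.algebra
  also have "\<dots> \<in> kk" by (intro S uvw r3k)
  finally show ?thesis using R(5)[OF assms R(5)[OF conj_KO[OF assms] conj_KO[OF conj_KO[OF assms]]]]
    unfolding intO_def by blast
qed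

text \<open>In the equation for \<open>r ^ 3 * (3 * x)\<close>, first \<open>V\<close>, then
  \<open>W\<close>, then \<open>U\<close> is seen to be a multiple of \<open>r\<close> or otherwise
  in \<open>q\<close>. Lying in k, each is then divisible by \<open>r ^ 3\<close>, and what remains
  shows that \<open>r\<close> divides \<open>3 * x\<close>; 3 is a unit at \<open>q\<close>.\<close>

lemma tame_local_unif:
  assumes q: "prime_ideal_in KO q" "q \<inter> intO kk = principal (intO kk) (r ^ 3)" "3 \<notin> q"
  shows "local_unif KO q r"
proof -
  note R = is_subringD[OF KO_subring] and D = prime_idealD[OF KO_subring q(1)]
  have "r ^ 3 \<in> principal (intO kk) (r ^ 3)"
    unfolding principal_mem using is_subringD(2)[OF Ok_subring] by (intro bexI[of _ 1]) auto
  hence rq: "r \<in> q" using D(10)[OF r_KO] q(2) by blast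
  have in_q: "\<exists>s\<in>intO kk. z = s * r ^ 3" if "z \<in> q" "z \<in> intO kk" for z
    using that q(2) principal_mem by blast
  have three: "3 \<in> KO" by (rule subring_numeral[OF KO_subring])
  have "\<exists>s\<in>KO. 3 * x = r * s" if x: "x \<in> q" for x
  proof -
    have xO: "x \<in> KO" using x D(2) by blast
    obtain U V W where UVW: "U \<in> intO kk" "V \<in> intO kk" "W \<in> intO kk"
      "r ^ 3 * (3 * x) = r ^ 3 * U + V * r + W * r\<^sup>2" using xO by (rule coords_integral)
    have mem: "U \<in> KO" "V \<in> KO" "W \<in> KO" using UVW Ok_sub by auto
    have "r * V = r * (r * (r * (3 * x - U) - W))" using UVW(4) by Groebner_Basis.algebra
    hence V: "V = r * (r * (3 * x - U) - W)" using r_neq_0 by simp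
    also have "\<dots> \<in> q" by (rule D(8)) (intro R r_KO xO mem three rq)+
    finally obtain V' where V': "V' \<in> intO kk" "V = V' * r ^ 3" using in_q UVW(2) by blast
    have mem': "V' \<in> KO" using V' Ok_sub by auto
    have "r\<^sup>2 * W = r\<^sup>2 * (r * (3 * x - U - V' * r))" using UVW(4) V'(2) by Groebner_Basis.algebra
    hence W: "W = r * (3 * x - U - V' * r)" using r_neq_0 by simp
    also have "\<dots> \<in> q" by (rule D(8)) (intro R r_KO xO mem mem' three rq)+
    finally obtain W' where W': "W' \<in> intO kk" "W = W' * r ^ 3" using in_q UVW(3) by blast
    have mem'': "W' \<in> KO" using W' Ok_sub by auto
    have "r ^ 3 * U = r ^ 3 * (3 * x - r * (V' + W' * r))"
      using UVW(4) V'(2) W'(2) by Groebner_Basis.algebra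
    hence U: "U = 3 * x - r * (V' + W' * r)" using r_neq_0 by simp
    also have "\<dots> \<in> q"
      by (intro D(6) D(7)[OF three] D(8)[OF _ rq] x) (intro R mem' mem'' r_KO)
    finally obtain U' where U': "U' \<in> intO kk" "U = U' * r ^ 3" using in_q UVW(1) by blast
    have "3 * x = r * (U' * r\<^sup>2 + V' + W' * r)" using U U'(2) by Groebner_Basis.algebra
    moreover have "U' * r\<^sup>2 + V' + W' * r \<in> KO"
      using U' Ok_sub mem' mem'' r_KO by (intro R) auto
    ultimately show ?thesis by blast
  qed
  thus ?thesis unfolding local_unif_def using rq r_neq_0 three q(3) by blast
qed

text \<open>Both \<open>r\<close> and 3 are units at \<open>q\<close>, so every nontrivial
  conjugation moves \<open>r\<close> modulo \<open>q\<close>. The trace argument then transports the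
  generator \<open>g\<close> from k to k(r).\<close>

lemma unram_local_unif:
  assumes q: "prime_ideal_in KO q" "q \<inter> intO kk = principal (intO kk) g" "3 \<notin> q"
    and g: "g \<noteq> 0" and r: "r \<notin> q"
  shows "local_unif KO q g"
proof -
  note R = is_subringD[OF KO_subring] and C = prime_ideal_compl[OF KO_subring q(1)]
  note Hm = fhomD[OF KF_subfield conj(1)]
  let ?H = "{(\<lambda>x. x), conj, conj \<circ> conj}"
  have KOF: "x \<in> KF" if "x \<in> KO" for x using that unfolding intO_def by blast
  have cr2: "conj (conj r) = zeta3 ^ 2 * r"
    using Hm(3)[of zeta3 r] r_in zeta3_in_kk kk_sub
    by (simp add: conj_r conj_kk power2_eq_square mult.assoc subsetD)
  have zr: "zeta3 * r \<noteq> r" "zeta3\<^sup>2 * r \<noteq> r" "zeta3\<^sup>2 * r \<noteq> zeta3 * r"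
    using zeta3_neq r_neq_0 by (auto simp: power2_eq_square)
  have ne: "(\<lambda>x. x) \<noteq> conj" "(\<lambda>x. x) \<noteq> conj \<circ> conj" "conj \<noteq> conj \<circ> conj"
    using zr conj_r cr2 by (metis comp_apply)+
  have gq: "g \<in> q"
  proof -
    have "g \<in> principal (intO kk) g"
      unfolding principal_mem using is_subringD(2)[OF Ok_subring] by (intro bexI[of _ 1]) auto
    thus ?thesis using q(2) by blast
  qed
  show ?thesis
  proof (rule trivial_inertia_local_unif[OF KO_subring q(1), of ?H "\<lambda>x. x" "intO kk" g 1])
    show "(\<Sum>\<sigma>\<in>?H. \<sigma> x) \<in> intO kk" if "x \<in> KO" for x
      using trace_Ok[OF that] ne by (simp add: add.assoc)
    show "\<exists>y\<in>KO. \<sigma> y - y \<notin> q" if "\<sigma> \<in> ?H" "\<sigma> \<noteq> (\<lambda>x. x)" for \<sigma>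
    proof -
      have "\<sigma> r = zeta3 ^ 1 * r \<or> \<sigma> r = zeta3 ^ 2 * r" using that conj_r cr2 by auto
      hence "\<sigma> r - r \<notin> q"
        using zeta3_diff_notin[OF KO_subring zeta3_KO q(1,3) r_KO r, of 1]
          zeta3_diff_notin[OF KO_subring zeta3_KO q(1,3) r_KO r, of 2] zeta3_neq by auto
      thus ?thesis using r_KO by blast
    qed
    show "\<exists>s\<in>KO. 1 * a = g * s" if "a \<in> q" "a \<in> intO kk" for a
      using that q(2) Ok_sub unfolding principal_def by (auto simp: mult.commute)
    show "\<sigma> (\<sigma> (\<sigma> x)) = x" if "\<sigma> \<in> ?H" "x \<in> KO" for \<sigma> x
      using that conj3 conj(2) KOF by auto
    show "\<sigma> (x * y) = \<sigma> x * \<sigma> y" if "\<sigma> \<in> ?H" "x \<in> KO" "y \<in> KO" for \<sigma> x y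
      using that Hm(3) conj(2) KOF by auto
  qed (use g gq C(1) conj_KO in auto)
qed

text \<open>The norm of \<open>x\<close> is an Eisenstein integer and has a valuation with respect
  to \<open>g\<close>, hence \<open>m\<close> times that with respect to \<open>w\<close>. This
  passes to the factor \<open>x\<close> of the norm.\<close>

lemma local_val_KO_exists:
  assumes q: "prime_ideal_in KO q" and p: "prime_ideal_in (intO kk) (q \<inter> intO kk)"
    "q \<inter> intO kk = principal (intO kk) g" and w: "local_unif KO q w" "g = w ^ m"
    and x: "x \<in> KO" "x \<noteq> 0"
  shows "\<exists>j. local_val KO q w x j"
proof -
  note R = is_subringD[OF KO_subring] and Hm = fhomD[OF KF_subfield conj(1)]
  define y where "y = conj x * conj (conj x)"
  have yO: "y \<in> KO" unfolding y_def by (intro R conj_KO x)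
  have "conj x \<in> KF" "x \<in> KF" using x conj_KO unfolding intO_def by auto
  hence "x * y \<noteq> 0" unfolding y_def using Hm(10) x(2) by simp
  moreover have "x * y \<in> intO kk" unfolding y_def by (rule norm_Ok[OF x(1)])
  ultimately obtain n where "local_val (intO kk) (q \<inter> intO kk) g (x * y) n"
    using Ok_local_val_exists[OF p] by blast
  then obtain u s where "u \<in> intO kk - q" "s \<in> intO kk - q" "u * (x * y) = g ^ n * s"
    unfolding local_val_def by blast
  hence "local_val KO q w (x * y) (m * n)"
    unfolding local_val_def w(2) power_mult using Ok_sub by blast
  from local_val_exists[OF KO_subring q w(1) x(1) yO this] show ?thesis .
qed

end

text \<open>\<open>I\<close> is trivial at \<open>Q\<close>, so the valuation of \<alpha> is
  \<open>b\<close> times that of the ideal \<open>B\<close>. Without unique factorization this is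
  squeezed between two bounds: one from an element of the product, one from containment.\<close>

lemma local_val_ideal_power:
  assumes S: "is_subring S" and Q: "prime_ideal_in S Q" and w: "w \<in> Q" "w \<noteq> 0"
    and ex: "\<And>x. x \<in> S \<Longrightarrow> x \<noteq> 0 \<Longrightarrow> \<exists>j. local_val S Q w x j"
    and \<alpha>: "\<alpha> \<in> S" "\<alpha> \<noteq> 0" "principal S \<alpha> = imult S I (ipow S B b)"
    and I: "I \<subseteq> S" "\<not> I \<subseteq> Q" and B: "ideal_in S B" "B \<noteq> {0}"
  shows "\<exists>n. local_val S Q w \<alpha> (b * n)"
proof -
  note R = is_subringD[OF S] and D = prime_idealD[OF S Q] and C = prime_ideal_compl[OF S Q]
  have "\<exists>g. g \<in> B \<and> g \<noteq> 0" using ideal_inD(2)[OF B(1)] B(2) by blast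
  hence "\<exists>n g. g \<in> B \<and> g \<noteq> 0 \<and> local_val S Q w g n" using ex ideal_inD(1)[OF B(1)] by blast
  \<comment> \<open>\<open>n\<close> is the valuation of \<open>B\<close> at \<open>Q\<close>: the
    least one among its nonzero elements, attained by \<open>g\<close>.\<close>
  then obtain n where n: "\<exists>g. g \<in> B \<and> g \<noteq> 0 \<and> local_val S Q w g n"
    and min: "\<And>m. \<exists>g. g \<in> B \<and> g \<noteq> 0 \<and> local_val S Q w g m \<Longrightarrow> n \<le> m"
    using exists_least_iff[of "\<lambda>n. \<exists>g. g \<in> B \<and> g \<noteq> 0 \<and> local_val S Q w g n"] by (metis not_le)
  obtain g where g: "g \<in> B" "g \<noteq> 0" "local_val S Q w g n" using n by blast
  have wS: "w \<in> S" using w D(2) by blast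
  have "B \<subseteq> local_multiples S Q w n"
  proof
    fix x assume x: "x \<in> B"
    hence xS: "x \<in> S" using ideal_inD(1)[OF B(1)] by blast
    show "x \<in> local_multiples S Q w n"
    proof (cases "x = 0")
      case True
      thus ?thesis using ideal_inD(2)[OF local_multiples_ideal[OF S Q]] by simp
    next
      case False
      then obtain m where m: "local_val S Q w x m" using ex xS by blast
      hence "n \<le> m" using min x False by blast
      then obtain k where k: "m = n + k" using le_Suc_ex by blast
      obtain u s where us: "u \<in> S - Q" "s \<in> S - Q" "u * x = w ^ m * s" using m unfolding local_val_def by blast
      have "u * x = w ^ n * (w ^ k * s)" using us(3) unfolding k power_add by (simp only: mult.assoc)
      moreover have "w ^ k * s \<in> S" using us(2) by (intro R wS) auto
      ultimately show ?thesis unfolding local_multiples_def using xS us(1) by blast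
    qed
  qed
  from local_multiples_ipow[OF S Q this, of b]
  have "imult S I (ipow S B b) \<subseteq> local_multiples S Q w (b * n)"
    using ideal_inD(4)[OF local_multiples_ideal[OF S Q]] I(1)
    by (intro imult_least[OF local_multiples_ideal[OF S Q]]) blast
  moreover have "\<alpha> \<in> principal S \<alpha>" unfolding principal_mem using R(2) by (intro bexI[of _ 1]) auto
  ultimately obtain e s where es: "e \<in> S - Q" "s \<in> S" "e * \<alpha> = w ^ (b * n) * s"
    using \<alpha>(3) unfolding local_multiples_def by blast
  obtain p where p: "p \<in> I" "p \<notin> Q" using I(2) by blast
  have "p * g ^ b \<in> principal S \<alpha>" unfolding \<alpha>(3) by (rule imult_memI[OF p(1) ipow_memI[OF S g(1)]])
  then obtain t where t: "t \<in> S" "p * g ^ b = t * \<alpha>" unfolding principal_mem by blast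
  have pS: "p \<in> S - Q" using p I(1) by blast
  have "local_val S Q w (p * g ^ b) (0 + b * n)"
    by (intro local_val_mult[OF S Q] local_val_unit[OF S Q pS] local_val_power[OF S Q g(3)])
  moreover have "t \<noteq> 0" using t(2) g(2) p D(9) by auto
  ultimately have v: "local_val S Q w (t * \<alpha>) (b * n)" using t(2) by simp
  obtain j where j: "local_val S Q w \<alpha> j" using ex \<alpha> by blast
  obtain i where i: "local_val S Q w t i" using ex t(1) \<open>t \<noteq> 0\<close> by blast
  \<comment> \<open>The element \<open>p * g ^ b\<close> of the product bounds \<open>j\<close> from
    above; the containment in the multiples of \<open>w ^ (b * n)\<close> bounds it from
    below.\<close>
  have ij: "i + j = b * n" using local_val_unique[OF S Q w local_val_mult[OF S Q i j] v] .
  have "s \<noteq> 0" using es \<alpha>(2) D(9) by auto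
  then obtain l where l: "local_val S Q w s l" using ex es(2) by blast
  have "local_val S Q w (w ^ (b * n) * s) (b * n * 1 + l)"
    by (intro local_val_mult[OF S Q] local_val_power[OF S Q] local_val_self[OF S Q] l)
  moreover have "local_val S Q w (e * \<alpha>) (0 + j)"
    by (intro local_val_mult[OF S Q] local_val_unit[OF S Q es(1)] j)
  ultimately have "j = b * n + l" using local_val_unique[OF S Q w] unfolding es(3) by fastforce
  hence "j = b * n" using ij by simp
  thus ?thesis using j by blast
qed

section \<open>The Galois group of the cubic tower\<close>

text \<open>Conjugation multiplies \<open>x\<close> by a cube root of unity and the three
  coordinates by three different ones, so only one coordinate of \<open>x\<close> can be
  nonzero.\<close>

lemma kummer_cube_root:
  assumes F: "is_subfield F" "zeta3 \<in> F" and r: "r ^ 3 \<in> F" "r \<notin> F"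
    and x: "x \<in> adj F r" "x ^ 3 \<in> F"
  shows "\<exists>u\<in>F. \<exists>j<3. x = u * r ^ j"
proof -
  note SF = is_subfieldD[OF F(1)]
  obtain \<psi> where \<psi>: "fhom (adj F r) \<psi>"
    "\<And>u v w. u \<in> F \<Longrightarrow> v \<in> F \<Longrightarrow> w \<in> F \<Longrightarrow> \<psi> (u + v * r + w * r\<^sup>2) = u + (v * zeta3) * r + (w * zeta3\<^sup>2) * r\<^sup>2"
    using kummer_conjugation[OF F r] by blast
  obtain u v w where uvw: "u \<in> F" "v \<in> F" "w \<in> F" "x = u + v * r + w * r\<^sup>2" using x(1) by (rule adjE)
  have "\<psi> (x ^ 3) = x ^ 3" using \<psi>(2)[OF x(2) SF(1,1)] by simp
  hence "\<psi> x ^ 3 = x ^ 3" using fhomD(7)[OF adj_subfield[OF F r(1)] \<psi>(1) x(1)] by simp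
  then obtain i where i: "i < 3" "\<psi> x = zeta3 ^ i * x" using cube_eq_cases by blast
  have "u + (v * zeta3) * r + (w * zeta3\<^sup>2) * r\<^sup>2 = zeta3 ^ i * u + (zeta3 ^ i * v) * r + (zeta3 ^ i * w) * r\<^sup>2"
    using i(2) unfolding uvw(4) \<psi>(2)[OF uvw(1-3)] by (simp add: algebra_simps)
  from adj_unique[OF F r _ _ _ _ _ _ this] have eq: "u = zeta3 ^ i * u" "v * zeta3 = zeta3 ^ i * v" "w * zeta3\<^sup>2 = zeta3 ^ i * w"
    using uvw SF F(2) by auto
  have z: "zeta3 \<noteq> 0" "zeta3 \<noteq> 1" "zeta3\<^sup>2 \<noteq> 1" "zeta3\<^sup>2 \<noteq> zeta3" using zeta3_neq by (auto simp: power2_eq_square)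
  consider "i = 0" | "i = 1" | "i = 2" using i(1) by linarith
  thus ?thesis
  proof cases
    case 1
    hence "x = u * r ^ 0" using eq z uvw(4) by auto
    thus ?thesis using uvw(1) by (intro bexI[of _ u] exI[of _ 0]) auto
  next
    case 2
    hence "x = v * r ^ 1" using eq z uvw(4) by auto
    thus ?thesis using uvw(2) by (intro bexI[of _ v] exI[of _ 1]) auto
  next
    case 3
    hence "x = w * r ^ 2" using eq z uvw(4) by auto
    thus ?thesis using uvw(3) by (intro bexI[of _ w] exI[of _ 2]) auto
  qed
qed

lemma fhom_preimage_subfield:
  assumes "is_subfield E" "is_subfield E'" "fhom E \<psi>"
  shows "is_subfield {x \<in> E. \<psi> x \<in> E'}"
  unfolding is_subfield_def
  by (simp add: is_subfieldD[OF assms(1)] is_subfieldD[OF assms(2)] fhomD[OF assms(1,3)])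

lemma AutD:
  assumes "\<sigma> \<in> Aut F E"
  shows "\<sigma> \<in> extensional E" "bij_betw \<sigma> E E" "fhom E \<sigma>" "\<And>x. x \<in> F \<Longrightarrow> \<sigma> x = x"
    "\<And>x. x \<in> E \<Longrightarrow> \<sigma> x \<in> E"
  using assms unfolding Aut_def fhom_def by (auto simp: bij_betw_def)

lemma AutI:
  assumes "\<sigma> \<in> extensional E" "bij_betw \<sigma> E E" "fhom E \<sigma>" "\<And>x. x \<in> F \<Longrightarrow> \<sigma> x = x"
  shows "\<sigma> \<in> Aut F E"
  using assms unfolding Aut_def fhom_def by auto

lemma fhom_restrict: "is_subfield E \<Longrightarrow> fhom E \<phi> \<Longrightarrow> fhom E (restrict \<phi> E)"
  using is_subfieldD(2,3,5)[of E] unfolding fhom_def by simp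

lemma Aut_comp:
  assumes E: "is_subfield E" "F \<subseteq> E" and s: "\<sigma> \<in> Aut F E" "\<rho> \<in> Aut F E"
  shows "restrict (\<sigma> \<circ> \<rho>) E \<in> Aut F E"
proof (rule AutI)
  show "bij_betw (restrict (\<sigma> \<circ> \<rho>) E) E E"
    using bij_betw_trans[OF AutD(2)[OF s(2)] AutD(2)[OF s(1)]] by simp
  show "fhom E (restrict (\<sigma> \<circ> \<rho>) E)"
    by (rule fhom_restrict[OF E(1)])
      (use AutD(3)[OF s(1)] AutD(3)[OF s(2)] AutD(5)[OF s(2)] in \<open>auto simp: fhom_def\<close>)
  show "restrict (\<sigma> \<circ> \<rho>) E x = x" if "x \<in> F" for x
    using that E(2) AutD(4)[OF s(1)] AutD(4)[OF s(2)] by auto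
qed simp

lemma adj_lin_span: assumes "is_subfield F" shows "adj F r = lin_span F {1, r, r\<^sup>2}"
proof
  have S: "is_subring F" by (rule is_subfield_imp_subring[OF assms])
  have base: "b \<in> lin_span F {1, r, r\<^sup>2}" if "b \<in> {1, r, r\<^sup>2}" for b
    by (rule lin_span_base[OF S _ that]) simp
  have "u * 1 + v * r + w * r\<^sup>2 \<in> lin_span F {1, r, r\<^sup>2}" if "u \<in> F" "v \<in> F" "w \<in> F" for u v w
    by (intro lin_span_add[OF S] lin_span_scale[OF S] base that) auto
  thus "adj F r \<subseteq> lin_span F {1, r, r\<^sup>2}" by (auto elim!: adjE)
  note SF = is_subfieldD[OF assms]
  show "lin_span F {1, r, r\<^sup>2} \<subseteq> adj F r"
  proof (rule lin_span_subset)
    show "0 \<in> adj F r" using adj_superset(1)[OF assms] SF(1) by blast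
    show "x + y \<in> adj F r" if xy: "x \<in> adj F r" "y \<in> adj F r" for x y
    proof -
      obtain u v w where x: "u \<in> F" "v \<in> F" "w \<in> F" "x = u + v * r + w * r\<^sup>2" using xy(1) by (rule adjE)
      obtain u' v' w' where y: "u' \<in> F" "v' \<in> F" "w' \<in> F" "y = u' + v' * r + w' * r\<^sup>2"
        using xy(2) by (rule adjE)
      have "x + y = (u + u') + (v + v') * r + (w + w') * r\<^sup>2" unfolding x y by Groebner_Basis.algebra
      also have "\<dots> \<in> adj F r" by (rule adjI) (intro SF x y)+
      finally show ?thesis .
    qed
    show "a * b \<in> adj F r" if "a \<in> F" "b \<in> {1, r, r\<^sup>2}" for a b
      using that adjI[OF that(1) SF(1,1), of r] adjI[OF SF(1) that(1) SF(1), of r]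
        adjI[OF SF(1,1) that(1), of r] by auto
  qed
qed

text \<open>The setting of the Galois group: up to a cube of k the norm of \<alpha> is
  \<open>r2 ^ 3\<close>, and \<open>t\<close> is a cube root of \<theta>. Ideals enter only in
  \<open>heisenberg_arith\<close>.\<close>

locale heisenberg_tower = kummer r1 for r1 +
  fixes r2 t \<alpha> \<beta> :: complex and c :: nat
  assumes r2_cube: "r2 ^ 3 \<in> intO kk" and r2_notin: "r2 \<notin> adj kk r1"
    and \<alpha>: "\<alpha> \<in> adj kk r1" and \<beta>: "\<beta> \<in> kk" "\<beta> \<noteq> 0"
    and norm_\<alpha>: "\<alpha> * (conj \<alpha> * conj (conj \<alpha>)) = r2 ^ 3 * \<beta> ^ 3"
    and t_cube: "t ^ 3 = zeta3 ^ c * \<alpha>\<^sup>2 * conj \<alpha>"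
begin

abbreviation "K12 \<equiv> adj KF r2"
abbreviation "R \<equiv> adj K12 t"

lemma r2_neq_0: "r2 \<noteq> 0"
  using r2_notin is_subfieldD(1)[OF KF_subfield] by auto

lemma conj_pow: "fhom KF (conj ^^ i)" "\<And>x. x \<in> KF \<Longrightarrow> (conj ^^ i) x \<in> KF"
  "\<And>x. x \<in> kk \<Longrightarrow> (conj ^^ i) x = x" "(conj ^^ i) r1 = zeta3 ^ i * r1"
proof -
  show m: "\<And>x. x \<in> KF \<Longrightarrow> (conj ^^ i) x \<in> KF" for i by (induction i) (auto simp: conj(2))
  show "fhom KF (conj ^^ i)"
    by (induction i) (use m conj(1) in \<open>auto simp: fhom_def\<close>)
  show k: "\<And>x. x \<in> kk \<Longrightarrow> (conj ^^ i) x = x" for i by (induction i) (auto simp: conj_kk)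
  have zk: "zeta3 ^ i \<in> kk" for i by (rule is_subfieldD(7)[OF kk_subfield zeta3_in_kk])
  show "(conj ^^ i) r1 = zeta3 ^ i * r1"
  proof (induction i)
    case (Suc i)
    have "conj (zeta3 ^ i * r1) = zeta3 ^ i * (zeta3 * r1)"
      using fhomD(3)[OF KF_subfield conj(1), of "zeta3 ^ i" r1] zk kk_sub r_in
      by (simp add: conj_kk conj_r subsetD)
    thus ?case using Suc by simp
  qed simp
qed

lemma conj_pow3: "x \<in> KF \<Longrightarrow> (conj ^^ (i + 3)) x = (conj ^^ i) x"
  using conj3 conj_pow(2) by (simp add: numeral_3_eq_3 del: funpow.simps) (simp add: funpow_add)

lemma \<alpha>_conj: "(conj ^^ i) \<alpha> \<in> KF" "(conj ^^ i) \<alpha> \<noteq> 0"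
proof -
  show "(conj ^^ i) \<alpha> \<in> KF" by (rule conj_pow(2)[OF \<alpha>])
  have "\<alpha> \<noteq> 0" using norm_\<alpha> r2_neq_0 \<beta>(2) by auto
  thus "(conj ^^ i) \<alpha> \<noteq> 0" using fhomD(10)[OF KF_subfield conj_pow(1) \<alpha>] by simp
qed

lemma norm_\<alpha>_shift: "(conj ^^ i) \<alpha> * ((conj ^^ (i+1)) \<alpha> * (conj ^^ (i+2)) \<alpha>) = r2 ^ 3 * \<beta> ^ 3"
proof (induction i)
  case (Suc i)
  have "(conj ^^ (i+3)) \<alpha> = (conj ^^ i) \<alpha>" by (rule conj_pow3[OF \<alpha>])
  thus ?case using Suc by (simp add: eval_nat_numeral mult_ac)
qed (use norm_\<alpha> in \<open>simp add: numeral_2_eq_2\<close>)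

text \<open>The conjugate of \<theta> divided by \<theta> is the norm of \<alpha> over \<alpha>^3,
  that is, the cube of \<open>r2 * \<beta> / \<alpha>\<close>. Multiplying the conjugates of this
  quotient, with \<open>r2\<close> kept fixed, makes \<open>T i * t\<close> a cube root of the i-th
  conjugate of \<theta>.\<close>

definition T :: "nat \<Rightarrow> complex" where
  "T i = (\<Prod>k<i. r2 * \<beta> / (conj ^^ k) \<alpha>)"

lemma T_Suc: "T (Suc i) = T i * (r2 * \<beta> / (conj ^^ i) \<alpha>)" and T_0: "T 0 = 1"
  unfolding T_def by auto

lemma T_neq_0: "T i \<noteq> 0"
  unfolding T_def using r2_neq_0 \<beta>(2) \<alpha>_conj(2) by simp

text \<open>Three consecutive factors multiply to \<open>r2 ^ 3 * \<beta> ^ 3\<close> over the norm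
  of \<alpha>, which is 1; so the index of \<open>T\<close> matters only modulo 3.\<close>

lemma T_add3: "T (i + 3) = T i"
proof -
  have "T (i + 3) = T i * (r2 ^ 3 * \<beta> ^ 3 / ((conj ^^ i) \<alpha> * ((conj ^^ (i+1)) \<alpha> * (conj ^^ (i+2)) \<alpha>)))"
    by (simp add: numeral_3_eq_3 T_Suc numeral_2_eq_2 mult_ac del: funpow.simps)
  thus ?thesis unfolding norm_\<alpha>_shift using r2_neq_0 \<beta>(2) by simp
qed

lemma T_mod: "T (i mod 3) = T i"
proof -
  have "T (k * 3 + i) = T i" for k i
  proof (induction k)
    case (Suc k)
    have "T (Suc k * 3 + i) = T ((k * 3 + i) + 3)" by (rule arg_cong[of _ _ T]) simp
    thus ?case unfolding T_add3 using Suc by simp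
  qed simp
  from this[of "i div 3" "i mod 3"] show ?thesis by simp
qed

abbreviation "\<theta> \<equiv> zeta3 ^ c * \<alpha>\<^sup>2 * conj \<alpha>"

lemma \<theta>_in: "\<theta> \<in> KF"
  by (intro is_subfieldD(5,7)[OF KF_subfield] \<alpha> conj(2) subsetD[OF kk_sub zeta3_in_kk])

lemma conj_\<theta>: "(conj ^^ i) \<theta> = zeta3 ^ c * ((conj ^^ i) \<alpha>)\<^sup>2 * (conj ^^ (i+1)) \<alpha>"
proof -
  note H = fhomD[OF KF_subfield conj_pow(1)[of i]] and S = is_subfieldD[OF KF_subfield]
  have z: "zeta3 ^ c \<in> kk" by (rule is_subfieldD(7)[OF kk_subfield zeta3_in_kk])
  hence zK: "zeta3 ^ c \<in> KF" using kk_sub by blast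
  have "(conj ^^ i) \<theta> = zeta3 ^ c * ((conj ^^ i) \<alpha>)\<^sup>2 * (conj ^^ i) (conj \<alpha>)"
    using \<alpha> conj(2)[OF \<alpha>] zK by (simp add: H(3,7) S(5,7) conj_pow(3)[OF z])
  thus ?thesis by (simp add: funpow_swap1)
qed

lemma T_cube: "T i ^ 3 * \<theta> = (conj ^^ i) \<theta>"
proof (induction i)
  case (Suc i)
  have nz: "(conj ^^ i) \<alpha> \<noteq> 0" by (rule \<alpha>_conj)
  have "T (Suc i) ^ 3 * \<theta> = (T i ^ 3 * \<theta>) * (r2 ^ 3 * \<beta> ^ 3) / (conj ^^ i) \<alpha> ^ 3"
    unfolding T_Suc by (simp add: power_mult_distrib power_divide)
  also have "\<dots> = (conj ^^ Suc i) \<theta>"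
    unfolding Suc conj_\<theta> norm_\<alpha>_shift[of i, symmetric] using nz
    by (simp add: field_simps power2_eq_square power3_eq_cube del: funpow.simps)
  finally show ?case .
qed (simp add: T_0)

lemma KF_K12: "KF \<subseteq> K12" "r2 \<in> K12"
  by (rule adj_superset[OF KF_subfield])+

lemma r2_cube_kk: "r2 ^ 3 \<in> kk"
  using r2_cube unfolding intO_def by blast

lemma r2_cube_KF: "r2 ^ 3 \<in> KF"
  using r2_cube kk_sub unfolding intO_def by blast

lemma zeta3_KF: "zeta3 \<in> KF"
  using zeta3_in_kk kk_sub by blast

lemma K12_subfield: "is_subfield K12"
  by (rule adj_subfield[OF KF_subfield zeta3_KF r2_cube_KF])

lemma zeta3_K12: "zeta3 \<in> K12"
  using zeta3_KF KF_K12 by blast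

lemma t_cube_K12: "t ^ 3 \<in> K12"
  using \<theta>_in KF_K12 t_cube by auto

lemma T_in: "T i \<in> K12"
proof -
  have "\<beta> \<in> K12" "(conj ^^ k) \<alpha> \<in> K12" for k using \<beta>(1) kk_sub KF_K12 \<alpha>_conj(1)[of k] by blast+
  thus ?thesis unfolding T_def
    by (intro is_subfieldD(5,9,11)[OF K12_subfield] KF_K12(2))
qed

text \<open>Otherwise \<theta> would be a cube of k(r1) times a power of \<open>r2 ^ 3\<close>.
  Applying \<open>conj\<close> then makes \<open>T 1\<close> a quotient of elements of k(r1) up to a
  root of unity, and \<open>T 1\<close> involves \<open>r2\<close> to the first power, so
  \<open>r2\<close> would lie in k(r1).\<close>

lemma t_notin: "t \<notin> K12"
proof
  assume "t \<in> K12"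
  then obtain u j where u: "u \<in> KF" "t = u * r2 ^ j"
    using kummer_cube_root[OF KF_subfield zeta3_KF r2_cube_KF r2_notin, of t] t_cube \<theta>_in by auto
  note S = is_subfieldD[OF KF_subfield] and H = fhomD[OF KF_subfield conj(1)]
  have th: "\<theta> = u ^ 3 * (r2 ^ 3) ^ j" using u(2) t_cube by (simp add: power_mult_distrib flip: power_mult)
     (simp add: mult.commute)
  have rk: "(r2 ^ 3) ^ j \<in> kk" by (rule is_subfieldD(7)[OF kk_subfield r2_cube_kk])
  have "conj \<theta> = conj (u ^ 3 * (r2 ^ 3) ^ j)" using th by simp
  also have "\<dots> = conj u ^ 3 * (r2 ^ 3) ^ j"
    using H(3)[OF S(7)[OF u(1), of 3] subsetD[OF kk_sub rk]] H(7)[OF u(1)] conj_kk[OF rk] by simp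
  finally have "T 1 ^ 3 * (u ^ 3 * (r2 ^ 3) ^ j) = conj u ^ 3 * (r2 ^ 3) ^ j" using T_cube[of 1] th by simp
  hence "(T 1 * u) ^ 3 = conj u ^ 3" using r2_neq_0 by (simp add: power_mult_distrib)
  then obtain i where i: "T 1 * u = zeta3 ^ i * conj u" using cube_eq_cases by blast
  have "\<theta> \<noteq> 0" using \<alpha>_conj(2)[of 0] \<alpha>_conj(2)[of 1] zeta3_neq by simp
  hence u0: "u \<noteq> 0" using th by auto
  have \<alpha>0: "\<alpha> \<noteq> 0" using \<alpha>_conj(2)[of 0] by simp
  have "r2 = zeta3 ^ i * conj u * \<alpha> / (u * \<beta>)"
    using i u0 \<beta>(2) \<alpha>0 by (simp add: T_def field_simps)
  moreover have "\<beta> \<in> KF" using \<beta>(1) kk_sub by blast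
  hence "zeta3 ^ i * conj u * \<alpha> / (u * \<beta>) \<in> KF" by (intro S zeta3_KF conj(2) u \<alpha>)
  ultimately show False using r2_notin by simp
qed

lemma t_neq_0: "t \<noteq> 0"
  using t_notin is_subfieldD(1)[OF K12_subfield] by auto

lemma R_subfield: "is_subfield R"
  by (rule adj_subfield[OF K12_subfield zeta3_K12 t_cube_K12])

lemma K12_R: "K12 \<subseteq> R" "t \<in> R"
  by (rule adj_superset[OF K12_subfield])+

lemma R_mem: "kk \<subseteq> R" "KF \<subseteq> R" "r1 \<in> R" "r2 \<in> R" "zeta3 \<in> R"
  using kk_sub KF_K12 K12_R r_in zeta3_KF by auto

lemma R_least: assumes "is_subfield E" "kk \<subseteq> E" "r1 \<in> E" "r2 \<in> E" "t \<in> E" shows "R \<subseteq> E"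
  by (intro adj_least assms)

text \<open>An automorphism with \<open>i\<close> on \<open>r1\<close> must send \<open>t\<close> to
  a cube root of the i-th conjugate of \<theta>, whence the factor \<open>T i\<close>. The exponents
  are arbitrary naturals that count modulo 3, so composition needs no reduction.\<close>

definition coords :: "(complex \<Rightarrow> complex) \<Rightarrow> nat \<Rightarrow> nat \<Rightarrow> nat \<Rightarrow> bool" where
  "coords \<sigma> i j l \<longleftrightarrow> \<sigma> \<in> Aut kk R \<and> \<sigma> r1 = zeta3 ^ i * r1 \<and> \<sigma> r2 = zeta3 ^ j * r2 \<and>
    \<sigma> t = zeta3 ^ l * T i * t"

lemma coordsD:
  assumes "coords \<sigma> i j l"
  shows "\<sigma> \<in> Aut kk R" "\<sigma> r1 = zeta3 ^ i * r1" "\<sigma> r2 = zeta3 ^ j * r2" "\<sigma> t = zeta3 ^ l * T i * t"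
  using assms unfolding coords_def by auto

lemma Aut_KF:
  assumes \<sigma>: "\<sigma> \<in> Aut kk R" "\<sigma> r1 = zeta3 ^ i * r1" and x: "x \<in> KF"
  shows "\<sigma> x = (conj ^^ i) x"
  by (rule fhom_adj_eq[OF kk_subfield zeta3_in_kk r3k fhom_subset[OF AutD(3)[OF \<sigma>(1)] R_mem(2)] conj_pow(1)])
    (simp_all add: AutD(4)[OF \<sigma>(1)] conj_pow \<sigma>(2) x)

lemma Aut_coords:
  assumes \<sigma>: "\<sigma> \<in> Aut kk R" obtains i j l where "i < 3" "j < 3" "l < 3" "coords \<sigma> i j l"
proof -
  note H = fhomD[OF R_subfield AutD(3)[OF \<sigma>]]
  have "\<sigma> r1 ^ 3 = r1 ^ 3" using H(7)[OF R_mem(3)] AutD(4)[OF \<sigma> r3k] by metis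
  then obtain i where i: "i < 3" "\<sigma> r1 = zeta3 ^ i * r1" using cube_eq_cases by blast
  have "r2 ^ 3 \<in> kk" using r2_cube unfolding intO_def by blast
  hence "\<sigma> r2 ^ 3 = r2 ^ 3" using H(7)[OF R_mem(4)] AutD(4)[OF \<sigma>] by metis
  then obtain j where j: "j < 3" "\<sigma> r2 = zeta3 ^ j * r2" using cube_eq_cases by blast
  have "\<sigma> t ^ 3 = \<sigma> \<theta>" using H(7)[OF K12_R(2), of 3] t_cube by simp
  also have "\<dots> = T i ^ 3 * \<theta>" unfolding Aut_KF[OF \<sigma> i(2) \<theta>_in] T_cube ..
  also have "\<dots> = (T i * t) ^ 3" unfolding power_mult_distrib t_cube ..
  finally obtain l where "l < 3" "\<sigma> t = zeta3 ^ l * (T i * t)" using cube_eq_cases by blast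
  thus ?thesis using that i j \<sigma> unfolding coords_def by (auto simp: mult.assoc)
qed

lemma coords_unique:
  assumes "coords \<sigma> i j l" "coords \<sigma> i' j' l'"
  shows "i mod 3 = i' mod 3" "j mod 3 = j' mod 3" "l mod 3 = l' mod 3"
proof -
  have inj: "m mod 3 = n mod 3" if "zeta3 ^ m = zeta3 ^ n" for m n
  proof -
    have z: "zeta3 \<noteq> 0" "zeta3 \<noteq> 1" "zeta3\<^sup>2 \<noteq> 1" "zeta3\<^sup>2 \<noteq> zeta3" using zeta3_neq by (auto simp: power2_eq_square)
    have eq: "zeta3 ^ (m mod 3) = zeta3 ^ (n mod 3)" using that zeta3_power_mod by metis
    have "m mod 3 < 3" "n mod 3 < 3" by simp_all
    hence "m mod 3 \<in> {0, 1, 2}" "n mod 3 \<in> {0, 1, 2}" by auto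
    thus ?thesis using eq z by auto
  qed
  note A = coordsD[OF assms(1)] and B = coordsD[OF assms(2)]
  show i: "i mod 3 = i' mod 3" by (rule inj) (use A B r_neq_0 in auto)
  show "j mod 3 = j' mod 3" by (rule inj) (use A B r2_neq_0 in auto)
  have "T i = T i'" using i T_mod by metis
  thus "l mod 3 = l' mod 3" by (intro inj) (use A B t_neq_0 T_neq_0[of i'] in auto)
qed

lemma coords_eq:
  assumes "coords \<sigma> i j l" "coords \<rho> i' j' l'" "i mod 3 = i' mod 3" "j mod 3 = j' mod 3" "l mod 3 = l' mod 3"
  shows "\<sigma> = \<rho>"
proof -
  note A = coordsD[OF assms(1)] and B = coordsD[OF assms(2)]
  have "zeta3 ^ i = zeta3 ^ i'" "zeta3 ^ j = zeta3 ^ j'" "zeta3 ^ l = zeta3 ^ l'" "T i = T i'"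
    using assms(3-5) zeta3_power_mod T_mod by metis+
  hence eq: "\<sigma> r1 = \<rho> r1" "\<sigma> r2 = \<rho> r2" "\<sigma> t = \<rho> t" using A B by auto
  have K: "\<sigma> x = \<rho> x" if "x \<in> KF" for x
    by (rule fhom_adj_eq[where \<phi> = \<sigma> and \<psi> = \<rho>, OF kk_subfield zeta3_in_kk r3k])
      (use that eq(1) AutD(3)[OF A(1)] AutD(3)[OF B(1)] AutD(4)[OF A(1)] AutD(4)[OF B(1)] R_mem fhom_subset in auto)
  have K': "\<sigma> x = \<rho> x" if "x \<in> K12" for x
    by (rule fhom_adj_eq[where \<phi> = \<sigma> and \<psi> = \<rho>, OF KF_subfield zeta3_KF r2_cube_KF])
      (use that K eq(2) AutD(3)[OF A(1)] AutD(3)[OF B(1)] K12_R fhom_subset in auto)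
  have "\<sigma> x = \<rho> x" if "x \<in> R" for x
    by (rule fhom_adj_eq[OF K12_subfield zeta3_K12 t_cube_K12 AutD(3)[OF A(1)] AutD(3)[OF B(1)] K' eq(3) that])
  thus ?thesis using AutD(1)[OF A(1)] AutD(1)[OF B(1)] by (rule extensionalityI[rotated 2])
qed

lemma coords_exist: "\<exists>\<sigma>. coords \<sigma> i j l"
proof -
  have z3: "(zeta3 ^ n) ^ 3 = 1" for n by (metis power_mult mult.commute zeta3_cube power_one)
  have r2k: "r2 ^ 3 \<in> kk" using r2_cube unfolding intO_def by blast
  have "(zeta3 ^ j * r2) ^ 3 = (conj ^^ i) (r2 ^ 3)"
    by (simp add: conj_pow(3)[OF r2k] power_mult_distrib z3)
  then obtain \<phi> where \<phi>: "fhom K12 \<phi>" "\<And>x. x \<in> KF \<Longrightarrow> \<phi> x = (conj ^^ i) x" "\<phi> r2 = zeta3 ^ j * r2"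
    using fhom_extend[OF KF_subfield zeta3_KF r2_cube_KF r2_notin conj_pow(1)] by blast
  have "(zeta3 ^ l * T i * t) ^ 3 = \<phi> (t ^ 3)"
    unfolding power_mult_distrib z3 t_cube \<phi>(2)[OF \<theta>_in] T_cube[symmetric] by simp
  then obtain \<psi> where \<psi>: "fhom R \<psi>" "\<And>x. x \<in> K12 \<Longrightarrow> \<psi> x = \<phi> x" "\<psi> t = zeta3 ^ l * T i * t"
    using fhom_extend[OF K12_subfield zeta3_K12 t_cube_K12 t_notin \<phi>(1)] by blast
  note SR = is_subfieldD[OF R_subfield] and H = fhomD[OF R_subfield \<psi>(1)]
  have \<psi>k: "\<psi> x = x" if "x \<in> kk" for x
    using that \<psi>(2) \<phi>(2) conj_pow(3) kk_sub KF_K12 by (metis subsetD)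
  have \<psi>r1: "\<psi> r1 = zeta3 ^ i * r1" using \<psi>(2) \<phi>(2) conj_pow(4) r_in KF_K12 by (metis subsetD)
  have \<psi>r2: "\<psi> r2 = zeta3 ^ j * r2" using \<psi>(2) \<phi>(3) KF_K12 by simp
  have zR: "zeta3 ^ n \<in> R" "zeta3 ^ n \<in> kk" for n
    using SR(7) R_mem(5) is_subfieldD(7)[OF kk_subfield zeta3_in_kk] by auto
  have "R \<subseteq> {x \<in> R. \<psi> x \<in> R}"
  proof (rule R_least[OF fhom_preimage_subfield[OF R_subfield R_subfield \<psi>(1)]])
    have "zeta3 ^ l * T i * t \<in> R" by (intro SR(5) zR K12_R(2) subsetD[OF K12_R(1) T_in])
    thus "t \<in> {x \<in> R. \<psi> x \<in> R}" using \<psi>(3) K12_R by simp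
  qed (use \<psi>k \<psi>r1 \<psi>r2 R_mem zR SR(5) in auto)
  hence into: "\<psi> ` R \<subseteq> R" by blast
  \<comment> \<open>Surjectivity: the image is a subfield containing k and, after dividing by the
    multipliers, \<open>r1\<close> and \<open>r2\<close>. Only then does it contain
    \<open>T i\<close>, which is needed to recover \<open>t\<close>.\<close>
  have im: "is_subfield (\<psi> ` R)" by (rule fhom_image_subfield[OF R_subfield \<psi>(1)])
  note SI = is_subfieldD[OF im]
  have kI: "kk \<subseteq> \<psi> ` R" using \<psi>k R_mem(1) by (metis image_eqI subsetD subsetI)
  have rI: "r1 \<in> \<psi> ` R" "r2 \<in> \<psi> ` R"
  proof -
    have "\<psi> r1 / zeta3 ^ i \<in> \<psi> ` R" "\<psi> r2 / zeta3 ^ j \<in> \<psi> ` R"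
      by (intro SI(11) imageI R_mem subsetD[OF kI zR(2)])+
    thus "r1 \<in> \<psi> ` R" "r2 \<in> \<psi> ` R" using \<psi>r1 \<psi>r2 zeta3_neq by auto
  qed
  have K12I: "K12 \<subseteq> \<psi> ` R" by (intro adj_least im kI rI)
  have "\<psi> t / (zeta3 ^ l * T i) \<in> \<psi> ` R"
    by (intro SI(5,11) imageI K12_R(2) subsetD[OF kI zR(2)] subsetD[OF K12I T_in])
  hence "t \<in> \<psi> ` R" using \<psi>(3) zeta3_neq T_neq_0 by simp
  hence "R \<subseteq> \<psi> ` R" using im kI rI by (intro R_least) auto
  hence "\<psi> ` R = R" using into by blast
  moreover have "inj_on \<psi> R" by (rule inj_onI) (use H(12) in blast)
  ultimately have "bij_betw \<psi> R R" unfolding bij_betw_def by blast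
  hence "restrict \<psi> R \<in> Aut kk R"
    using fhom_restrict[OF R_subfield \<psi>(1)] \<psi>k R_mem(1) by (intro AutI) auto
  hence "coords (restrict \<psi> R) i j l"
    unfolding coords_def using \<psi>(3) \<psi>r1 \<psi>r2 R_mem K12_R by simp
  thus ?thesis by blast
qed

text \<open>The mixed term \<open>j * i'\<close> makes the group noncommutative: the image of
  \<open>t\<close> under \<rho> contains \<open>T i'\<close>, and each of its \<open>i'\<close>
  factors contains \<open>r2\<close>, which \<sigma> multiplies by \<open>zeta3 ^ j\<close>.\<close>

lemma coords_comp:
  assumes "coords \<sigma> i j l" "coords \<rho> i' j' l'"
  shows "coords (restrict (\<sigma> \<circ> \<rho>) R) (i + i') (j + j') (l + l' + j * i')"
proof -
  note A = coordsD[OF assms(1)] and B = coordsD[OF assms(2)]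
  note H = fhomD[OF R_subfield AutD(3)[OF A(1)]] and S = is_subfieldD[OF R_subfield]
  have zk: "zeta3 ^ n \<in> kk" for n by (rule is_subfieldD(7)[OF kk_subfield zeta3_in_kk])
  have zR: "zeta3 ^ n \<in> R" for n using zk R_mem by blast
  have \<sigma>z: "\<sigma> (zeta3 ^ n) = zeta3 ^ n" for n by (rule AutD(4)[OF A(1) zk])
  have \<beta>R: "\<beta> \<in> R" using \<beta> R_mem by blast
  have \<alpha>R: "(conj ^^ k) \<alpha> \<in> R" for k using \<alpha>_conj(1) R_mem by blast
  have TR: "T k \<in> R" for k using T_in K12_R by blast
  \<comment> \<open>A twisted cocycle relation: \<sigma> shifts the conjugates of \<alpha> by
    \<open>i\<close>, so the factors of \<open>T k\<close> continue those of \<open>T i\<close>, and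
    each picks up \<open>zeta3 ^ j\<close> from \<open>r2\<close>.\<close>
  have \<sigma>T: "T i * \<sigma> (T k) = zeta3 ^ (j * k) * T (i + k)" for k
  proof (induction k)
    case (Suc k)
    have "\<sigma> (T (Suc k)) = \<sigma> (T k) * (\<sigma> r2 * \<sigma> \<beta> / \<sigma> ((conj ^^ k) \<alpha>))"
      unfolding T_Suc by (simp add: H TR R_mem \<beta>R \<alpha>R S del: funpow.simps)
    also have "\<sigma> ((conj ^^ k) \<alpha>) = (conj ^^ (i + k)) \<alpha>"
      unfolding Aut_KF[OF A(1,2) \<alpha>_conj(1)] by (simp add: funpow_add)
    finally have "T i * \<sigma> (T (Suc k)) = (T i * \<sigma> (T k)) * (zeta3 ^ j * r2 * \<beta> / (conj ^^ (i + k)) \<alpha>)"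
      by (simp add: A(3) AutD(4)[OF A(1) \<beta>(1)] mult_ac)
    thus ?case unfolding Suc.IH by (simp add: T_Suc power_add mult_ac del: funpow.simps)
  qed (simp add: H(1) T_0)
  have "\<sigma> (\<rho> t) = zeta3 ^ l' * \<sigma> (T i') * \<sigma> t"
    unfolding B(4) by (simp add: H S zR TR K12_R \<sigma>z)
  also have "\<dots> = zeta3 ^ (l + l') * (T i * \<sigma> (T i')) * t" unfolding A(4) by (simp add: power_add mult_ac)
  also have "\<dots> = zeta3 ^ (l + l' + j * i') * T (i + i') * t" unfolding \<sigma>T by (simp add: power_add mult_ac)
  finally have "\<sigma> (\<rho> t) = zeta3 ^ (l + l' + j * i') * T (i + i') * t" .
  moreover have "\<sigma> (\<rho> r1) = zeta3 ^ (i + i') * r1" "\<sigma> (\<rho> r2) = zeta3 ^ (j + j') * r2"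
    unfolding B(2,3) by (simp_all add: H S zR R_mem \<sigma>z A(2,3) power_add mult_ac)
  ultimately show ?thesis unfolding coords_def
    using Aut_comp[OF R_subfield R_mem(1) A(1) B(1)] R_mem K12_R by simp
qed

lemma coords_id: "coords (restrict id R) 0 0 0"
proof -
  have "restrict id R \<in> Aut kk R"
    by (rule AutI) (use R_mem(1) in \<open>auto simp: fhom_def is_subfieldD[OF R_subfield]\<close>)
  thus ?thesis unfolding coords_def using R_mem K12_R by (simp add: T_0)
qed

text \<open>The third power has coordinates 3 i, 3 j and 3 (l + j i). That the group has exponent 3
  is an assumption of the trace argument.\<close>

lemma Aut_exponent:
  assumes \<sigma>: "\<sigma> \<in> Aut kk R" and x: "x \<in> R" shows "\<sigma> (\<sigma> (\<sigma> x)) = x"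
proof -
  obtain i j l where c: "coords \<sigma> i j l" using \<sigma> by (rule Aut_coords)
  let ?s = "restrict (\<sigma> \<circ> restrict (\<sigma> \<circ> \<sigma>) R) R"
  have "coords ?s (i + (i + i)) (j + (j + j)) (l + (l + l + j * i) + j * (i + i))"
    by (rule coords_comp[OF c coords_comp[OF c c]])
  moreover have "i + (i + i) = 3 * i" "j + (j + j) = 3 * j" "l + (l + l + j * i) + j * (i + i) = 3 * (l + j * i)"
    by (simp_all add: algebra_simps)
  ultimately have "coords ?s (3 * i) (3 * j) (3 * (l + j * i))" by simp
  from coords_eq[OF this coords_id] have "?s = restrict id R" by simp
  from fun_cong[OF this, of x] show ?thesis using x AutD(5)[OF \<sigma>] by simp
qed

lemma finite_Aut: "finite (Aut kk R)"
proof -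
  have "Aut kk R \<subseteq> (\<lambda>(i, j, l). SOME \<sigma>. coords \<sigma> i j l) ` ({..<3} \<times> {..<3} \<times> {..<3})"
  proof
    fix \<sigma> assume "\<sigma> \<in> Aut kk R"
    then obtain i j l where c: "i < 3" "j < 3" "l < 3" "coords \<sigma> i j l" by (rule Aut_coords)
    have "\<sigma> = (SOME \<sigma>. coords \<sigma> i j l)"
      by (rule coords_eq[OF c(4) someI[of "\<lambda>\<sigma>. coords \<sigma> i j l", OF c(4)]]) simp_all
    thus "\<sigma> \<in> (\<lambda>(i, j, l). SOME \<sigma>. coords \<sigma> i j l) ` ({..<3} \<times> {..<3} \<times> {..<3})"
      using c(1-3) by (intro image_eqI[of _ _ "(i, j, l)"]) auto
  qed
  thus ?thesis by (rule finite_subset) simp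
qed

lemma fixed_K12:
  assumes x: "x \<in> R" and f: "\<And>\<sigma>. coords \<sigma> 0 0 1 \<Longrightarrow> \<sigma> x = x" shows "x \<in> K12"
proof -
  obtain \<sigma> where c: "coords \<sigma> 0 0 1" using coords_exist by blast
  note A = coordsD[OF c]
  have h: "\<sigma> t = zeta3 * t" unfolding A(4) T_0 by simp
  have K: "\<sigma> y = y" if "y \<in> KF" for y using Aut_KF[OF A(1,2) that] by simp
  have K': "\<sigma> y = y" if "y \<in> K12" for y
    by (rule fhom_adj_eq[OF KF_subfield zeta3_KF r2_cube_KF fhom_subset[OF AutD(3)[OF A(1)] K12_R(1)], of "\<lambda>x. x"])
      (use K A that in \<open>auto simp: fhom_def\<close>)
  show ?thesis
    by (rule adj_fixed[OF K12_subfield zeta3_K12 t_cube_K12 t_neq_0 order_refl R_subfield AutD(3)[OF A(1)] K' _ x f[OF c]])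
      (simp_all add: h)
qed

lemma fixed_KF:
  assumes x: "x \<in> R" and f: "\<And>\<sigma>. \<sigma> \<in> Aut kk R \<Longrightarrow> \<sigma> r1 = r1 \<Longrightarrow> \<sigma> x = x" shows "x \<in> KF"
proof -
  obtain \<sigma> where c: "coords \<sigma> 0 1 0" using coords_exist by blast
  note A = coordsD[OF c]
  have K: "\<sigma> y = y" if "y \<in> KF" for y using Aut_KF[OF A(1,2) that] by simp
  have x': "x \<in> K12" 
  proof (rule fixed_K12[OF x])
    fix \<rho> assume d: "coords \<rho> 0 0 1"
    show "\<rho> x = x" by (rule f[OF coordsD(1)[OF d]]) (simp add: coordsD(2,3)[OF d])
  qed
  show ?thesis
    by (rule adj_fixed[OF KF_subfield zeta3_KF r2_cube_KF r2_neq_0 K12_R(1) R_subfield AutD(3)[OF A(1)] K _ x' f[OF A(1)]])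
      (simp_all add: A(2,3))
qed

lemma fixed_kk:
  assumes x: "x \<in> R" and f: "\<And>\<sigma>. \<sigma> \<in> Aut kk R \<Longrightarrow> \<sigma> x = x" shows "x \<in> kk"
proof -
  obtain \<sigma> where c: "coords \<sigma> 1 0 0" using coords_exist by blast
  note A = coordsD[OF c]
  have x': "x \<in> KF" by (rule fixed_KF[OF x]) (use f in auto)
  show ?thesis
    by (rule adj_fixed[OF kk_subfield zeta3_in_kk r3k r_neq_0 R_mem(2) R_subfield AutD(3)[OF A(1)] AutD(4)[OF A(1)] _ x' f[OF A(1)]])
      (simp_all add: A(2,3))
qed

text \<open>The lower part of the tower is reordered as k(r2)(r1), so that the automorphism moving
  \<open>r1\<close> and fixing \<open>r2\<close> can be used for the descent.\<close>

lemma fixed_kk_r2: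
  assumes x: "x \<in> R" and f: "\<And>\<sigma>. \<sigma> \<in> Aut kk R \<Longrightarrow> \<sigma> r2 = r2 \<Longrightarrow> \<sigma> x = x" shows "x \<in> adj kk r2"
proof -
  obtain \<sigma> where c: "coords \<sigma> 1 0 0" using coords_exist by blast
  note A = coordsD[OF c]
  have r2k: "r2 ^ 3 \<in> kk" using r2_cube unfolding intO_def by blast
  have F: "is_subfield (adj kk r2)" by (rule adj_subfield[OF kk_subfield zeta3_in_kk r2k])
  have sub: "kk \<subseteq> adj kk r2" "r2 \<in> adj kk r2" by (rule adj_superset[OF kk_subfield])+
  have F': "zeta3 \<in> adj kk r2" "r1 ^ 3 \<in> adj kk r2" using sub zeta3_in_kk r3k by auto
  have E: "is_subfield (adj (adj kk r2) r1)" by (rule adj_subfield[OF F F'])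
  have "K12 \<subseteq> adj (adj kk r2) r1"
    using sub adj_superset[OF F, of r1] by (intro adj_least E) auto
  moreover have "x \<in> K12" 
  proof (rule fixed_K12[OF x])
    fix \<rho> assume d: "coords \<rho> 0 0 1"
    show "\<rho> x = x" by (rule f[OF coordsD(1)[OF d]]) (simp add: coordsD(2,3)[OF d])
  qed
  ultimately have x': "x \<in> adj (adj kk r2) r1" by blast
  have sR: "adj kk r2 \<subseteq> R" "adj (adj kk r2) r1 \<subseteq> R" by (intro adj_least R_subfield R_mem)+
  have K: "\<sigma> y = y" if "y \<in> adj kk r2" for y
    by (rule fhom_adj_eq[OF kk_subfield zeta3_in_kk r2k fhom_subset[OF AutD(3)[OF A(1)] sR(1)], of "\<lambda>x. x"])
      (use A AutD(4)[OF A(1)] that in \<open>auto simp: fhom_def\<close>)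
  show ?thesis
    by (rule adj_fixed[OF F F' r_neq_0 sR(2) R_subfield AutD(3)[OF A(1)] K _ x' f[OF A(1)]])
      (simp_all add: A(2,3))
qed

text \<open>Left composition with \<rho> is an injective self-map of the finite set
  \<open>H\<close>, hence a permutation; closure under composition is enough and inverses are never
  formed.\<close>

lemma trace_invariant:
  assumes H: "H \<subseteq> Aut kk R" "\<And>\<sigma> \<rho>. \<sigma> \<in> H \<Longrightarrow> \<rho> \<in> H \<Longrightarrow> restrict (\<sigma> \<circ> \<rho>) R \<in> H"
    and \<rho>: "\<rho> \<in> H" and x: "x \<in> R"
  shows "\<rho> (\<Sum>\<sigma>\<in>H. \<sigma> x) = (\<Sum>\<sigma>\<in>H. \<sigma> x)"
proof -
  have fin: "finite H" by (rule finite_subset[OF H(1) finite_Aut])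
  have \<rho>A: "\<rho> \<in> Aut kk R" using \<rho> H by blast
  note Hm = fhomD[OF R_subfield AutD(3)[OF \<rho>A]] and S = is_subfieldD[OF R_subfield]
  have m: "\<sigma> x \<in> R" if "\<sigma> \<in> H" "x \<in> R" for \<sigma> x using AutD(5) that H by blast
  have sum: "\<rho> (\<Sum>\<sigma>\<in>A. \<sigma> x) = (\<Sum>\<sigma>\<in>A. \<rho> (\<sigma> x))" if "A \<subseteq> H" for A
    using finite_subset[OF that fin] that
  proof (induction A rule: finite_induct)
    case (insert \<sigma> A)
    have "(\<Sum>\<sigma>\<in>A. \<sigma> x) \<in> R" by (rule S(8)) (use insert.prems m x in blast)
    thus ?case using insert m x by (simp add: Hm(2))
  qed (simp add: Hm(4))
  have inj: "inj_on (\<lambda>\<sigma>. restrict (\<rho> \<circ> \<sigma>) R) H"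
  proof (rule inj_onI)
    fix \<sigma> \<sigma>' assume a: "\<sigma> \<in> H" "\<sigma>' \<in> H" "restrict (\<rho> \<circ> \<sigma>) R = restrict (\<rho> \<circ> \<sigma>') R"
    have ext: "\<sigma> \<in> extensional R" "\<sigma>' \<in> extensional R" using a H AutD(1) by blast+
    show "\<sigma> = \<sigma>'"
    proof (rule extensionalityI[OF ext])
      fix y assume y: "y \<in> R"
      hence "\<rho> (\<sigma> y) = \<rho> (\<sigma>' y)" using fun_cong[OF a(3), of y] by simp
      thus "\<sigma> y = \<sigma>' y" using Hm(12) m a y by blast
    qed
  qed
  have "(\<lambda>\<sigma>. restrict (\<rho> \<circ> \<sigma>) R) ` H = H"
    by (rule endo_inj_surj[OF fin _ inj]) (use H(2) \<rho> in blast)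
  hence "(\<Sum>\<sigma>\<in>H. \<sigma> x) = (\<Sum>\<sigma>\<in>H. restrict (\<rho> \<circ> \<sigma>) R x)"
    using sum.reindex[OF inj, of "\<lambda>\<sigma>. \<sigma> x"] by simp
  thus ?thesis using sum[OF order_refl] x by simp
qed

lemma galois: "galois_ext kk R"
proof -
  note S = is_subfield_imp_subring
  have "KF = lin_span kk {1, r1, r1\<^sup>2}" "K12 = lin_span KF {1, r2, r2\<^sup>2}" "R = lin_span K12 {1, t, t\<^sup>2}"
    by (intro adj_lin_span kk_subfield KF_subfield K12_subfield)+
  then obtain B where B: "finite B" "R = lin_span kk B"
    using lin_span_trans[OF S[OF kk_subfield], of "{1, r1, r1\<^sup>2}" "{1, r2, r2\<^sup>2}"]
      lin_span_trans[OF S[OF kk_subfield], of "(\<lambda>(b,d). b * d) ` ({1, r1, r1\<^sup>2} \<times> {1, r2, r2\<^sup>2})" "{1, t, t\<^sup>2}"]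
    by (metis (no_types, lifting) finite.emptyI finite.insertI finite_SigmaI finite_imageI)
  have "B \<subseteq> R" unfolding B(2) using lin_span_base[OF S[OF kk_subfield] B(1)] by blast
  hence "finite_ext kk R" unfolding finite_ext_def using B unfolding lin_span_def by blast
  moreover have "{x \<in> R. \<forall>\<sigma>\<in>Aut kk R. \<sigma> x = x} = kk"
    using fixed_kk R_mem(1) AutD(4) by blast
  ultimately show ?thesis unfolding galois_ext_def using kk_subfield R_subfield R_mem(1) by blast
qed

end

section \<open>Unipotent matrices over the field with three elements\<close>

text \<open>Arithmetic in the type \<open>3\<close> is modulo 3, so the element listed as 3 in the
  case and sum rules is 0.\<close>

lemma three_eq_0: "(3::3) = 0"
  by simp

lemma exhaust_F3: "(x::3) = 0 \<or> x = 1 \<or> x = 2"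
  using exhaust_3[of x] unfolding three_eq_0 by blast

lemma all_F3: "(\<forall>x::3. P x) \<longleftrightarrow> P 0 \<and> P 1 \<and> P 2"
  using exhaust_F3 by metis

lemma sum_F3: "sum f (UNIV :: 3 set) = f 0 + f 1 + (f 2 :: 'a :: comm_monoid_add)"
  using sum_3[of f] unfolding three_eq_0 by (simp add: add_ac)

lemma F3_neq: "(0::3) \<noteq> 1" "(0::3) \<noteq> 2" "(1::3) \<noteq> 2" "(1::3) \<noteq> 0" "(2::3) \<noteq> 0" "(2::3) \<noteq> 1"
  by simp_all

text \<open>The order on the index type decides which entries of a member of \<open>N3F3\<close>
  vanish: rows and columns are numbered 0, 1, 2.\<close>

lemma F3_less: "(0::3) < 1" "(1::3) < 2" "(0::3) < 2"
  by (simp_all add: less_bit1_def bit1.Rep_0 bit1.Rep_1 bit1.Rep_numeral)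

lemma of_nat_F3_eq_iff: "(of_nat m :: 3) = of_nat n \<longleftrightarrow> m mod 3 = n mod 3"
proof -
  have red: "(of_nat k :: 3) = of_nat (k mod 3)" for k
  proof -
    have "(of_nat k :: 3) = of_nat (3 * (k div 3) + k mod 3)" by simp
    also have "\<dots> = of_nat 3 * of_nat (k div 3) + of_nat (k mod 3)" by (simp only: of_nat_add of_nat_mult)
    also have "(of_nat 3 :: 3) = 0" by simp
    finally show ?thesis by simp
  qed
  have "m mod 3 < 3" "n mod 3 < 3" by simp_all
  hence "m mod 3 \<in> {0, 1, 2}" "n mod 3 \<in> {0, 1, 2}" by auto
  hence "(of_nat (m mod 3) :: 3) = of_nat (n mod 3) \<longleftrightarrow> m mod 3 = n mod 3"
    by (auto simp: F3_neq)
  thus ?thesis using red by metis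
qed

text \<open>The arguments follow the coordinates i, j, l. With \<open>y\<close> in row 0 and
  \<open>x\<close> in row 1, the corner of a product gains \<open>y * x'\<close>, which matches
  \<open>j * i'\<close> in \<open>coords_comp\<close>.\<close>

definition unip :: "3 \<Rightarrow> 3 \<Rightarrow> 3 \<Rightarrow> (3 ^ 3) ^ 3" where
  "unip x y z = (\<chi> a b. if a = b then 1 else if a = 0 \<and> b = 1 then y
     else if a = 1 \<and> b = 2 then x else if a = 0 \<and> b = 2 then z else 0)"

lemma unip_nth: "vec_nth (vec_nth (unip x y z) a) b = (if a = b then 1 else if a = 0 \<and> b = 1 then y
     else if a = 1 \<and> b = 2 then x else if a = 0 \<and> b = 2 then z else 0)"
  unfolding unip_def by simp

lemma unip_mult: "unip x y z ** unip x' y' z' = unip (x + x') (y + y') (z + z' + y * x')"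
  unfolding Finite_Cartesian_Product.vec_eq_iff matrix_matrix_mult_def
  by (simp add: all_F3 sum_F3 unip_nth F3_neq add_ac)

lemma unip_inject: "unip x y z = unip x' y' z' \<longleftrightarrow> x = x' \<and> y = y' \<and> z = z'"
  unfolding Finite_Cartesian_Product.vec_eq_iff by (auto simp: all_F3 unip_nth F3_neq)

lemma unip_carrier: "unip x y z \<in> carrier N3F3"
  unfolding N3F3_def using F3_less by (simp add: all_F3 unip_nth F3_neq less_not_sym)

lemma carrier_unip:
  assumes "A \<in> carrier N3F3" shows "\<exists>x y z. A = unip x y z"
proof -
  have "A = unip (vec_nth (vec_nth A 1) 2) (vec_nth (vec_nth A 0) 1) (vec_nth (vec_nth A 0) 2)"
    using assms F3_less unfolding Finite_Cartesian_Product.vec_eq_iff N3F3_def by (simp add: all_F3 unip_nth F3_neq)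
  thus ?thesis by blast
qed

context heisenberg_tower
begin

definition matrix_of :: "(complex \<Rightarrow> complex) \<Rightarrow> (3 ^ 3) ^ 3" where
  "matrix_of \<sigma> = (SOME A. \<exists>i j l. coords \<sigma> i j l \<and> A = unip (of_nat i) (of_nat j) (of_nat l))"

lemma matrix_of_coords:
  assumes "coords \<sigma> i j l" shows "matrix_of \<sigma> = unip (of_nat i) (of_nat j) (of_nat l)"
  unfolding matrix_of_def
proof (rule someI2)
  show "\<exists>i' j' l'. coords \<sigma> i' j' l' \<and> unip (of_nat i) (of_nat j) (of_nat l) = unip (of_nat i') (of_nat j') (of_nat l')"
    using assms by blast
  fix A assume "\<exists>i j l. coords \<sigma> i j l \<and> A = unip (of_nat i) (of_nat j) (of_nat l)"
  then obtain i' j' l' where *: "coords \<sigma> i' j' l'" "A = unip (of_nat i') (of_nat j') (of_nat l')" by blast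
  show "A = unip (of_nat i) (of_nat j) (of_nat l)"
    unfolding *(2) unip_inject of_nat_F3_eq_iff using coords_unique[OF *(1) assms] by blast
qed

lemma Gal_iso: "Gal kk R \<cong> N3F3"
proof -
  have hom: "matrix_of \<in> hom (Gal kk R) N3F3"
  proof (rule homI)
    fix \<sigma> assume "\<sigma> \<in> carrier (Gal kk R)"
    hence "\<sigma> \<in> Aut kk R" unfolding Gal_def by simp
    then obtain i j l where "coords \<sigma> i j l" by (rule Aut_coords)
    thus "matrix_of \<sigma> \<in> carrier N3F3" using matrix_of_coords unip_carrier by simp
  next
    fix \<sigma> \<rho> assume "\<sigma> \<in> carrier (Gal kk R)" "\<rho> \<in> carrier (Gal kk R)"
    hence *: "\<sigma> \<in> Aut kk R" "\<rho> \<in> Aut kk R" unfolding Gal_def by simp_all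
    obtain i j l where s: "coords \<sigma> i j l" using *(1) by (rule Aut_coords)
    obtain i' j' l' where r: "coords \<rho> i' j' l'" using *(2) by (rule Aut_coords)
    show "matrix_of (\<sigma> \<otimes>\<^bsub>Gal kk R\<^esub> \<rho>) = matrix_of \<sigma> \<otimes>\<^bsub>N3F3\<^esub> matrix_of \<rho>"
      using matrix_of_coords[OF coords_comp[OF s r]] matrix_of_coords[OF s] matrix_of_coords[OF r]
      by (simp add: Gal_def N3F3_def unip_mult)
  qed
  have "bij_betw matrix_of (carrier (Gal kk R)) (carrier N3F3)" unfolding bij_betw_def
  proof
    show "inj_on matrix_of (carrier (Gal kk R))"
    proof (rule inj_onI)
      fix \<sigma> \<rho> assume "\<sigma> \<in> carrier (Gal kk R)" "\<rho> \<in> carrier (Gal kk R)" and eq: "matrix_of \<sigma> = matrix_of \<rho>"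
      hence *: "\<sigma> \<in> Aut kk R" "\<rho> \<in> Aut kk R" unfolding Gal_def by simp_all
      obtain i j l where s: "coords \<sigma> i j l" using *(1) by (rule Aut_coords)
      obtain i' j' l' where r: "coords \<rho> i' j' l'" using *(2) by (rule Aut_coords)
      show "\<sigma> = \<rho>"
        using eq unfolding matrix_of_coords[OF s] matrix_of_coords[OF r] unip_inject of_nat_F3_eq_iff
        by (intro coords_eq[OF s r]) auto
    qed
    show "matrix_of ` carrier (Gal kk R) = carrier N3F3"
    proof
      show "matrix_of ` carrier (Gal kk R) \<subseteq> carrier N3F3" using hom unfolding hom_def by blast
      show "carrier N3F3 \<subseteq> matrix_of ` carrier (Gal kk R)"
      proof
        fix A assume "A \<in> carrier N3F3"
        then obtain x y z where A: "A = unip x y z" using carrier_unip by blast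
        have "\<exists>n. x = of_nat n" for x :: 3
          using exhaust_F3[of x] of_nat_0 of_nat_1 of_nat_numeral[of "Num.Bit0 Num.One"] by metis
        then obtain i j l where "x = of_nat i" "y = of_nat j" "z = of_nat l" by metis
        moreover obtain \<sigma> where \<sigma>: "coords \<sigma> i j l" using coords_exist by blast
        ultimately have "A = matrix_of \<sigma>" using A matrix_of_coords[OF \<sigma>] by simp
        moreover have "\<sigma> \<in> carrier (Gal kk R)" using coordsD(1)[OF \<sigma>] unfolding Gal_def by simp
        ultimately show "A \<in> matrix_of ` carrier (Gal kk R)" by blast
      qed
    qed
  qed
  thus ?thesis unfolding is_iso_def iso_def using hom by blast
qed

end

section \<open>Ramification\<close>

text \<open>Zero constant terms are removed from an integer equation of \<open>x\<close> by
  cancelling \<open>x\<close>; the first nonzero constant term is then a multiple of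
  \<open>x\<close>.\<close>

lemma nonzero_integer_multiple:
  assumes S: "is_subring S" and x: "x \<in> S" "x \<noteq> 0" "alg_int x"
  shows "\<exists>y\<in>S. \<exists>n::int. n \<noteq> 0 \<and> x * y = of_int n"
proof -
  note R = is_subringD[OF S]
  have n: "of_nat n \<in> S" for n by (induction n) (auto intro: R)
  have z: "of_int k \<in> S" for k using n R(6) by (cases k rule: int_cases2) auto
  have mem: "poly (map_poly of_int q) x \<in> S" for q :: "int poly"
    by (induction q) (auto simp: map_poly_pCons z R x(1))
  obtain p :: "int poly" where p: "lead_coeff p = 1" "poly (map_poly of_int p) x = 0"
    using x(3) unfolding alg_int_def by blast
  have "q \<noteq> 0 \<Longrightarrow> poly (map_poly of_int q) x = 0 \<Longrightarrow> ?thesis" for q :: "int poly"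
  proof (induction q)
    case (pCons a q)
    have eq: "of_int a + x * poly (map_poly of_int q) x = 0" 
      using pCons.prems(2) unfolding of_int_hom.map_poly_pCons_hom by simp
    show ?case
    proof (cases "a = 0")
      case True
      thus ?thesis using pCons x(2) eq by auto
    next
      case False
      have "x * (- poly (map_poly of_int q) x) = of_int a"
        using eq by Groebner_Basis.algebra
      thus ?thesis using False R(6)[OF mem] by blast
    qed
  qed simp
  from this[OF _ p(2)] show ?thesis using p(1) by (cases "p = 0") auto
qed

text \<open>Only nonvanishing is not formal: a nonzero element of \<open>Q\<close> has a nonzero
  integer multiple in \<open>Q\<close>, and this integer lies in every subfield.\<close>

lemma prime_ideal_contraction:
  assumes E: "is_subfield E" "is_subfield F" "F \<subseteq> E" and Q: "prime_ideal_in (intO E) Q"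
  shows "prime_ideal_in (intO F) (Q \<inter> intO F)"
proof -
  note SE = intO_subring[OF E(1)] and SF = intO_subring[OF E(2)]
  note D = prime_idealD[OF SE Q] and RF = is_subringD[OF SF]
  have sub: "intO F \<subseteq> intO E" by (rule intO_mono[OF E(3)])
  have "\<exists>x\<in>Q. x \<noteq> 0" using Q D(9) unfolding prime_ideal_in_def by blast
  then obtain x where x: "x \<in> Q" "x \<noteq> 0" by blast
  have "x \<in> intO E" "alg_int x" using x D(2) unfolding intO_def by auto
  then obtain y and n :: int where y: "y \<in> intO E" "n \<noteq> 0" "x * y = of_int n"
    using nonzero_integer_multiple[OF SE _ x(2)] by blast
  have "of_int n \<in> Q" using D(8)[OF y(1) x(1)] y(3) by simp
  moreover have "of_int n \<in> intO F" using is_subfieldD(12)[OF E(2)] unfolding intO_def by simp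
  ultimately have nz: "Q \<inter> intO F \<noteq> {0}" using y(2) by auto
  have "ideal_in (intO F) (Q \<inter> intO F)" unfolding ideal_in_def
  proof (intro conjI ballI)
    show "r * x \<in> Q \<inter> intO F" if "r \<in> intO F" "x \<in> Q \<inter> intO F" for r x
      using that RF(5)[of r x] D(7)[of r x] sub by auto
  qed (use D(5,9) RF(1,3) in auto)
  moreover have "Q \<inter> intO F \<noteq> intO F" using D(3) RF(2) by blast
  moreover have "a \<in> Q \<or> b \<in> Q" if "a \<in> intO F" "b \<in> intO F" "a * b \<in> Q" for a b
    using D(4)[OF _ _ that(3)] that sub by blast
  ultimately show ?thesis unfolding prime_ideal_in_def using nz by blast
qed

lemma kk_denominator: assumes "x \<in> kk" shows "\<exists>n::int. n \<noteq> 0 \<and> of_int n * x \<in> intO kk"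
proof -
  obtain a b where x: "x = complex_of_real a + complex_of_real b * zeta3" "a \<in> \<rat>" "b \<in> \<rat>"
    using kk_coords[OF assms] by blast
  obtain a1 a2 where a: "a2 > 0" "a = of_int a1 / of_int a2" using x(2) by (rule Rats_cases')
  obtain b1 b2 where b: "b2 > 0" "b = of_int b1 / of_int b2" using x(3) by (rule Rats_cases')
  have "of_int (a2 * b2) * x = of_int (a1 * b2) + of_int (b1 * a2) * zeta3"
    unfolding x a(2) b(2) using a(1) b(1) by (simp add: field_simps)
  also have "\<dots> \<in> intO kk"
    using is_subringD(3,5)[OF Ok_subring] intO_zeta3[OF zeta3_in_kk] is_subfieldD(12)[OF kk_subfield]
    by (simp add: intO_def alg_int_ring alg_int_zeta3 is_subfieldD[OF kk_subfield] zeta3_in_kk)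
  finally show ?thesis using a(1) b(1) by (intro exI[of _ "a2 * b2"]) auto
qed

text \<open>Up to a unit, every nontrivial \<open>zeta3 ^ l - 1\<close> is \<open>sqrt_m3\<close>.
  This cancels the denominator of the witness used above 3.\<close>

lemma zeta3_power_minus_1:
  assumes "zeta3 ^ l \<noteq> 1" shows "\<exists>k. zeta3 ^ l - 1 = zeta3 ^ k * sqrt_m3 \<or> zeta3 ^ l - 1 = - (zeta3 ^ k * sqrt_m3)"
proof -
  have "l mod 3 < 3" by simp
  hence "l mod 3 = 0 \<or> l mod 3 = 1 \<or> l mod 3 = 2" by linarith
  hence "zeta3 ^ l = zeta3 \<or> zeta3 ^ l = zeta3\<^sup>2"
    using zeta3_power_mod[of l] assms by (metis power_0 power_one_right)
  moreover have "zeta3 - 1 = - (zeta3\<^sup>2 * sqrt_m3)" "zeta3\<^sup>2 - 1 = zeta3 ^ 1 * sqrt_m3"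
    unfolding sqrt_m3_zeta3 using zeta3_sum by Groebner_Basis.algebra+
  ultimately show ?thesis by metis
qed

text \<open>The witness \<open>y = (x - \<eta>) / sqrt_m3\<close> is integral by the congruence, and its conjugates differ
  by units times \<open>x\<close>.\<close>
lemma inertia_witness_above_3:
  assumes F: "is_subfield F" "zeta3 \<in> F" and \<sigma>: "fhom F \<sigma>" "\<And>x. x \<in> kk \<Longrightarrow> \<sigma> x = x"
    and Q: "prime_ideal_in (intO F) Q"
    and x: "x \<in> intO F" "x \<notin> Q" "\<sigma> x = zeta3 ^ l * x" "zeta3 ^ l \<noteq> 1"
    and \<eta>: "\<eta> \<in> intO F" "\<sigma> \<eta> = \<eta>" "\<eta> ^ 3 - x ^ 3 = s * (3 * sqrt_m3)" "s \<in> intO F"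
  shows "\<exists>y\<in>intO F. \<sigma> y - y \<notin> Q"
proof -
  note S = intO_subring[OF F(1)]
  note R = is_subringD[OF S] and D = prime_idealD[OF S Q] and SF = is_subfieldD[OF F(1)] and H = fhomD[OF F(1) \<sigma>(1)]
  note A = is_subringD[OF is_subring_alg_int, unfolded mem_Collect_eq]
  have lk: "sqrt_m3 \<in> kk" unfolding sqrt_m3_zeta3 by (intro is_subfieldD(2,3,5,13)[OF kk_subfield] zeta3_in_kk)
  have kF: "kk \<subseteq> F" by (rule kk_least[OF F])
  have lF: "sqrt_m3 \<in> F" using lk kF by blast
  define y where "y = (x - \<eta>) / sqrt_m3"
  have xF: "x \<in> F" "\<eta> \<in> F" "s \<in> F" using x \<eta> unfolding intO_def by auto
  have al: "alg_int x" "alg_int \<eta>" "alg_int s" using x \<eta> unfolding intO_def by auto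
  have yF: "y \<in> F" unfolding y_def by (intro SF xF lF)
  have "x = \<eta> + sqrt_m3 * y" unfolding y_def using sqrt_m3_neq_0 by simp
  \<comment> \<open>Substituting \<open>x = \<eta> + sqrt_m3 * y\<close> into the congruence, every
    term is divisible by \<open>3 * sqrt_m3\<close>, since the square of \<open>sqrt_m3\<close> is
    -3; the quotient is a monic cubic for \<open>y\<close>.\<close>
  hence "(3 * sqrt_m3) * (y ^ 3 - \<eta> * sqrt_m3 * y\<^sup>2 - \<eta>\<^sup>2 * y - s) = 0"
    using sqrt_m3_sq \<eta>(3) by Groebner_Basis.algebra
  hence root: "y ^ 3 - \<eta> * sqrt_m3 * y\<^sup>2 - \<eta>\<^sup>2 * y - s = 0" using sqrt_m3_neq_0 by simp
  have "alg_int y"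
  proof (rule alg_int_monic_root)
    let ?p = "[: - s, - (\<eta>\<^sup>2), - (\<eta> * sqrt_m3), 1 :]"
    show "lead_coeff ?p = 1" by simp
    show "poly ?p y = 0" using root by (simp add: algebra_simps power2_eq_square power3_eq_cube)
    have "alg_int (- s)" "alg_int (- (\<eta>\<^sup>2))" "alg_int (- (\<eta> * sqrt_m3))"
      by (intro A al alg_int_sqrt_m3)+
    thus "alg_int (coeff ?p i)" for i by (auto simp: coeff_pCons split: nat.split)
  qed
  hence yO: "y \<in> intO F" using yF unfolding intO_def by simp
  obtain k where k: "zeta3 ^ l - 1 = zeta3 ^ k * sqrt_m3 \<or> zeta3 ^ l - 1 = - (zeta3 ^ k * sqrt_m3)"
    using zeta3_power_minus_1[OF x(4)] by blast
  have "\<sigma> y - y = (zeta3 ^ l - 1) * x / sqrt_m3"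
    unfolding y_def using xF lF \<sigma>(2)[OF lk] by (simp add: H SF x(3) \<eta>(2)) (simp add: left_diff_distrib diff_divide_distrib)
  hence "\<sigma> y - y = zeta3 ^ k * x \<or> \<sigma> y - y = - (zeta3 ^ k * x)" using k sqrt_m3_neq_0 by auto
  moreover have "zeta3 ^ (2 * k) * zeta3 ^ k = (zeta3 ^ 3) ^ k" by (simp flip: power_add power_mult)
  hence "zeta3 ^ (2 * k) * (zeta3 ^ k * x) = x" unfolding zeta3_cube by (simp flip: mult.assoc)
  ultimately have eq: "zeta3 ^ (2 * k) * (\<sigma> y - y) = x \<or> (- (zeta3 ^ (2 * k))) * (\<sigma> y - y) = x"
    by auto
  have "\<sigma> y - y \<notin> Q"
  proof
    assume a: "\<sigma> y - y \<in> Q"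
    have z: "zeta3 ^ (2 * k) \<in> intO F" by (intro R intO_zeta3 F(2))
    from eq show False using D(7)[OF z a] D(7)[OF R(6)[OF z] a] x(2) by auto
  qed
  thus ?thesis using yO by blast
qed

context heisenberg_tower
begin

abbreviation "RO \<equiv> intO R"

lemma RO_subring: "is_subring RO"
  by (rule intO_subring[OF R_subfield])

lemma KO_RO: "KO \<subseteq> RO" and Ok_RO: "intO kk \<subseteq> RO"
  using intO_mono R_mem by blast+

lemma zeta3_RO: "zeta3 \<in> RO"
  by (rule intO_zeta3[OF R_mem(5)])

lemma roots_RO: "r1 \<in> RO" "r2 \<in> RO"
proof -
  show "r1 \<in> RO" using r_KO KO_RO by blast
  show "r2 \<in> RO" using alg_int_root[of r2 3] r2_cube R_mem(4) unfolding intO_def by simp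
qed

lemma Aut_fix_K12:
  assumes \<sigma>: "\<sigma> \<in> Aut kk R" "\<sigma> r1 = r1" "\<sigma> r2 = r2" and x: "x \<in> K12" shows "\<sigma> x = x"
proof -
  have K: "\<sigma> y = y" if "y \<in> KF" for y using Aut_KF[OF \<sigma>(1), of 0] \<sigma>(2) that by simp
  show ?thesis
    by (rule fhom_adj_eq[OF KF_subfield zeta3_KF r2_cube_KF fhom_subset[OF AutD(3)[OF \<sigma>(1)] K12_R(1)], of "\<lambda>x. x"])
      (use K \<sigma> x in \<open>auto simp: fhom_def\<close>)
qed

text \<open>A nontrivial \<sigma> fixing \<open>X\<close> moves \<open>r1\<close> or
  \<open>r2\<close>, or else fixes both and multiplies \<open>t\<close> by a root of unity; hence
  three kinds of witnesses. \<open>X\<close> is empty, \<open>{r1}\<close> or \<open>{r2}\<close> in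
  the applications, and \<open>F\<close> is the corresponding fixed field.\<close>

lemma local_unif_RO:
  assumes Q: "prime_ideal_in RO Q" and X: "X \<subseteq> R"
    and fixed: "\<And>x. x \<in> R \<Longrightarrow> (\<And>\<sigma>. \<sigma> \<in> Aut kk R \<Longrightarrow> (\<And>x. x \<in> X \<Longrightarrow> \<sigma> x = x) \<Longrightarrow> \<sigma> x = x) \<Longrightarrow> x \<in> F"
    and y1: "\<And>\<sigma> i. \<sigma> \<in> Aut kk R \<Longrightarrow> (\<And>x. x \<in> X \<Longrightarrow> \<sigma> x = x) \<Longrightarrow> \<sigma> r1 = zeta3 ^ i * r1 \<Longrightarrow> zeta3 ^ i \<noteq> 1 \<Longrightarrow>
      \<exists>y\<in>RO. \<sigma> y - y \<notin> Q"
    and y2: "\<And>\<sigma> i. \<sigma> \<in> Aut kk R \<Longrightarrow> (\<And>x. x \<in> X \<Longrightarrow> \<sigma> x = x) \<Longrightarrow> \<sigma> r2 = zeta3 ^ i * r2 \<Longrightarrow> zeta3 ^ i \<noteq> 1 \<Longrightarrow>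
      \<exists>y\<in>RO. \<sigma> y - y \<notin> Q"
    and y3: "\<And>\<sigma> l. \<sigma> \<in> Aut kk R \<Longrightarrow> (\<And>x. x \<in> K12 \<Longrightarrow> \<sigma> x = x) \<Longrightarrow> \<sigma> t = zeta3 ^ l * t \<Longrightarrow> zeta3 ^ l \<noteq> 1 \<Longrightarrow>
      \<exists>y\<in>RO. \<sigma> y - y \<notin> Q"
    and w: "w \<in> Q" "w \<noteq> 0" and f: "f \<in> RO - Q" "\<And>a. a \<in> Q \<Longrightarrow> a \<in> intO F \<Longrightarrow> \<exists>s\<in>RO. f * a = w * s"
  shows "local_unif RO Q w"
proof -
  define H where "H = {\<sigma> \<in> Aut kk R. \<forall>x\<in>X. \<sigma> x = x}"
  have HA: "H \<subseteq> Aut kk R" unfolding H_def by blast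
  have Hc: "restrict (\<sigma> \<circ> \<rho>) R \<in> H" if "\<sigma> \<in> H" "\<rho> \<in> H" for \<sigma> \<rho>
    using that Aut_comp[OF R_subfield R_mem(1)] X unfolding H_def by auto
  have ROR: "x \<in> R" "alg_int x" if "x \<in> RO" for x using that unfolding intO_def by auto
  have HRO: "\<sigma> x \<in> RO" if "\<sigma> \<in> H" "x \<in> RO" for \<sigma> x
    using AutD(5)[of \<sigma>] fhom_alg_int[OF R_subfield AutD(3)[of \<sigma>]] that HA ROR[OF that(2)] unfolding intO_def by blast
  have id: "restrict id R \<in> H"
    using coordsD(1)[OF coords_id] X unfolding H_def by auto
  show ?thesis
  proof (rule trivial_inertia_local_unif[OF RO_subring Q, of H "restrict id R" "intO F" w f])
    show "finite H" by (rule finite_subset[OF HA finite_Aut])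
    show "restrict id R \<in> H" by (rule id)
    show "restrict id R x = x" if "x \<in> RO" for x using ROR[OF that] by simp
    show "\<sigma> (x * y) = \<sigma> x * \<sigma> y" if "\<sigma> \<in> H" "x \<in> RO" "y \<in> RO" for \<sigma> x y
      using fhomD(3)[OF R_subfield AutD(3)] that HA ROR by blast
    show "\<sigma> (\<sigma> (\<sigma> x)) = x" if "\<sigma> \<in> H" "x \<in> RO" for \<sigma> x
      using Aut_exponent that HA ROR by blast
    show "(\<Sum>\<sigma>\<in>H. \<sigma> x) \<in> intO F" if x: "x \<in> RO" for x
    proof -
      have s: "(\<Sum>\<sigma>\<in>H. \<sigma> x) \<in> RO" by (rule is_subringD(8)[OF RO_subring]) (rule HRO[OF _ x])
      have "(\<Sum>\<sigma>\<in>H. \<sigma> x) \<in> F"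
      proof (rule fixed[OF ROR(1)[OF s]])
        fix \<rho> assume "\<rho> \<in> Aut kk R" "\<And>x. x \<in> X \<Longrightarrow> \<rho> x = x"
        hence "\<rho> \<in> H" unfolding H_def by blast
        thus "\<rho> (\<Sum>\<sigma>\<in>H. \<sigma> x) = (\<Sum>\<sigma>\<in>H. \<sigma> x)" 
          by (intro trace_invariant[where \<rho> = \<rho>, OF HA Hc _ ROR(1)[OF x]])
      qed
      thus ?thesis using ROR(2)[OF s] unfolding intO_def by blast
    qed
    show "\<exists>y\<in>RO. \<sigma> y - y \<notin> Q" if \<sigma>: "\<sigma> \<in> H" "\<sigma> \<noteq> restrict id R" for \<sigma>
    proof -
      have A: "\<sigma> \<in> Aut kk R" and fX: "\<And>x. x \<in> X \<Longrightarrow> \<sigma> x = x" using \<sigma> unfolding H_def by auto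
      obtain i j l where c: "i < 3" "j < 3" "l < 3" "coords \<sigma> i j l" using A by (rule Aut_coords)
      note C = coordsD[OF c(4)]
      have z: "zeta3 ^ n \<noteq> 1" if "n < 3" "n \<noteq> 0" for n
      proof -
        from that have "n = 1 \<or> n = 2" by linarith
        thus ?thesis using zeta3_neq by auto
      qed
      show ?thesis
      proof (cases "i = 0 \<and> j = 0")
        case True
        have "l \<noteq> 0"
        proof
          assume "l = 0"
          hence "\<sigma> = restrict id R" using coords_eq[OF c(4) coords_id] True by simp
          thus False using \<sigma> by simp
        qed
        hence "zeta3 ^ l \<noteq> 1" using z c by blast
        moreover have "\<sigma> t = zeta3 ^ l * t" using C(4) True T_0 by simp
        moreover have "\<sigma> x = x" if "x \<in> K12" for x
          by (rule Aut_fix_K12[OF A _ _ that]) (use C True in auto)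
        ultimately show ?thesis using y3[OF A] by blast
      next
        case False
        hence "zeta3 ^ i \<noteq> 1 \<or> zeta3 ^ j \<noteq> 1" using z c by blast
        thus ?thesis using y1[OF A fX C(2)] y2[OF A fX C(3)] by blast
      qed
    qed
    show "\<sigma> x \<in> RO" if "\<sigma> \<in> H" "x \<in> RO" for \<sigma> x by (rule HRO[OF that])
    show "\<exists>s\<in>RO. f * a = w * s" if "a \<in> Q" "a \<in> intO F" for a by (rule f(2)[OF that])
  qed (use w f in auto)
qed

lemma inertia_witness_tame:
  assumes Q: "prime_ideal_in RO Q" "3 \<notin> Q" and \<sigma>: "\<sigma> x = zeta3 ^ i * x" "zeta3 ^ i \<noteq> 1"
    and x: "x \<in> RO" "x ^ 3 \<notin> Q"
  shows "\<exists>y\<in>RO. \<sigma> y - y \<notin> Q"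
proof -
  have "x \<notin> Q"
  proof
    assume a: "x \<in> Q"
    have "x ^ 3 = x\<^sup>2 * x" by (simp add: power2_eq_square power3_eq_cube)
    thus False using x prime_idealD(7)[OF RO_subring Q(1) is_subringD(7)[OF RO_subring x(1)] a] by simp
  qed
  thus ?thesis using zeta3_diff_notin[OF RO_subring zeta3_RO Q x(1) _ \<sigma>(2)] x \<sigma>(1) by metis
qed

text \<open>If a conjugate of \<open>\<theta>\<close> has valuation divisible by 3 at \<open>q\<close>, then up to a local cube it is a unit,
  so adjoining \<open>t\<close> does not ramify.\<close>
lemma inertia_witness_local_cube:
  assumes Q: "prime_ideal_in RO Q" "3 \<notin> Q"
    and \<sigma>: "\<sigma> \<in> Aut kk R" "\<And>x. x \<in> K12 \<Longrightarrow> \<sigma> x = x" "\<sigma> t = zeta3 ^ l * t" "zeta3 ^ l \<noteq> 1"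
    and w: "w \<in> KO" "w \<noteq> 0" and v: "local_val KO (Q \<inter> KO) w ((conj ^^ i) \<theta>) (3 * m)"
  shows "\<exists>y\<in>RO. \<sigma> y - y \<notin> Q"
proof -
  note C = prime_ideal_compl[OF RO_subring Q(1)] and S = is_subfieldD[OF K12_subfield]
  obtain u s where us: "u \<in> KO - Q" "s \<in> KO - Q" "u * (conj ^^ i) \<theta> = w ^ (3 * m) * s"
    using v unfolding local_val_def by blast
  have mem: "u \<in> RO - Q" "s \<in> RO - Q" using us KO_RO by auto
  \<comment> \<open>\<open>T i\<close> turns \<theta> into its conjugate and
    \<open>u / w ^ m\<close> strips off the cube of \<open>w ^ m\<close>, so \<open>k * t\<close> is
    a cube root of a unit at \<open>Q\<close>. As \<open>k\<close> lies in \<open>K12\<close>,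
    \<sigma> acts on \<open>k * t\<close> as it does on \<open>t\<close>.\<close>
  define k where "k = u / w ^ m * T i"
  have "u \<in> K12" "w \<in> K12" using us(1) w KF_K12 unfolding intO_def by auto
  hence kK: "k \<in> K12" unfolding k_def by (intro S T_in)
  have "(k * t) ^ 3 = (u / w ^ m) ^ 3 * (T i ^ 3 * \<theta>)" unfolding k_def power_mult_distrib t_cube by simp
  also have "\<dots> = u ^ 3 * (conj ^^ i) \<theta> / (w ^ m) ^ 3" unfolding T_cube by (simp add: power_divide)
  also have "u ^ 3 * (conj ^^ i) \<theta> = u\<^sup>2 * (u * (conj ^^ i) \<theta>)" by (simp add: power2_eq_square power3_eq_cube)
  also have "u\<^sup>2 * (u * (conj ^^ i) \<theta>) / (w ^ m) ^ 3 = u\<^sup>2 * s"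
    unfolding us(3) using w(2) by (simp add: power_mult[symmetric] mult.commute[of m 3])
  finally have cube: "(k * t) ^ 3 = u\<^sup>2 * s" .
  have us2: "u\<^sup>2 * s \<in> RO - Q" by (intro C(2,3) mem)
  have "k * t \<in> R" using is_subfieldD(5)[OF R_subfield] kK K12_R by blast
  moreover have "alg_int (k * t)" using alg_int_root[of "k * t" 3] cube us2 unfolding intO_def by simp
  ultimately have kt: "k * t \<in> RO" unfolding intO_def by blast
  have "\<sigma> (k * t) = zeta3 ^ l * (k * t)"
    using fhomD(3)[OF R_subfield AutD(3)[OF \<sigma>(1)], of k t] kK K12_R \<sigma>(2)[OF kK] \<sigma>(3) by (auto simp: mult_ac)
  thus ?thesis using inertia_witness_tame[OF Q _ \<sigma>(4) kt] cube us2 by auto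
qed

end

lemma principal_self: "is_subring S \<Longrightarrow> a \<in> principal S a"
  unfolding principal_mem using is_subringD(2) by force

lemma zeta3_unit:
  assumes S: "is_subring S" and z: "zeta3 \<in> S" and Q: "prime_ideal_in S Q"
  shows "zeta3 \<in> S - Q"
proof -
  have "zeta3 \<notin> Q"
  proof
    assume "zeta3 \<in> Q"
    from prime_idealD(7)[OF S Q is_subringD(7)[OF S z, of 2] this] have "zeta3\<^sup>2 * zeta3 \<in> Q" .
    moreover have "zeta3\<^sup>2 * zeta3 = zeta3 ^ 3" by (simp add: power2_eq_square power3_eq_cube)
    ultimately show False using prime_idealD(3)[OF S Q] zeta3_cube by simp
  qed
  thus ?thesis using z by blast
qed

section \<open>Explicit uniformizers in k(r) and conjugate primes\<close>

context kummer
begin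

text \<open>The two situations, away from 3, in which a uniformizer in k(r) is explicit:
  \<open>r\<close> is a unit and a generator of the prime below still works, or \<open>r\<close>
  itself is the uniformizer. In both, \<open>conj\<close> changes \<open>w\<close> only by a power
  of \<open>zeta3\<close>.\<close>

definition good_unif :: "complex set \<Rightarrow> complex \<Rightarrow> bool" where
  "good_unif q w \<longleftrightarrow> prime_ideal_in KO q \<and> 3 \<notin> q \<and> w \<noteq> 0 \<and>
    (r \<notin> q \<and> q \<inter> intO kk = principal (intO kk) w \<or> w = r \<and> q \<inter> intO kk = principal (intO kk) (r ^ 3))"

lemma good_unif_local: assumes "good_unif q w" shows "local_unif KO q w"
  using assms tame_local_unif unram_local_unif unfolding good_unif_def by blast

lemma good_unif_val:
  assumes g: "good_unif q w" and x: "x \<in> KO" "x \<noteq> 0"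
  shows "\<exists>j. local_val KO q w x j"
proof -
  have q: "prime_ideal_in KO q" using g unfolding good_unif_def by blast
  have p: "prime_ideal_in (intO kk) (q \<inter> intO kk)"
    by (rule prime_ideal_contraction[OF KF_subfield kk_subfield kk_sub q])
  from g have "q \<inter> intO kk = principal (intO kk) (w ^ 1) \<or> q \<inter> intO kk = principal (intO kk) (w ^ 3)"
    unfolding good_unif_def by auto
  thus ?thesis using local_val_KO_exists[OF q p _ good_unif_local[OF g] refl x] by blast
qed

text \<open>The conjugate prime at which an element has the valuation that its image under
  \<open>conj\<close> has at \<open>q\<close>.\<close>

definition pullback :: "complex set \<Rightarrow> complex set" where
  "pullback q = {x \<in> KO. conj x \<in> q}"

lemma pullback_prime:
  assumes q: "prime_ideal_in KO q" shows "prime_ideal_in KO (pullback q)"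
    and "pullback q \<inter> intO kk = q \<inter> intO kk"
proof -
  note D = prime_idealD[OF KO_subring q] and R = is_subringD[OF KO_subring] and H = fhomD[OF KF_subfield conj(1)]
  have KF: "x \<in> KF" if "x \<in> KO" for x using that unfolding intO_def by blast
  have cm: "conj (x * y) = conj x * conj y" if "x \<in> KO" "y \<in> KO" for x y by (rule H(3)) (use that KF in auto)
  have ca: "conj (x + y) = conj x + conj y" if "x \<in> KO" "y \<in> KO" for x y by (rule H(2)) (use that KF in auto)
  have "ideal_in KO (pullback q)" unfolding ideal_in_def
  proof (intro conjI ballI)
    show "x + y \<in> pullback q" if "x \<in> pullback q" "y \<in> pullback q" for x y
      using that R(3) D(5) ca unfolding pullback_def by auto
    show "z * x \<in> pullback q" if "z \<in> KO" "x \<in> pullback q" for z x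
      using that R(5) D(7)[OF conj_KO] cm unfolding pullback_def by auto
  qed (use H(4) R(1) D(9) in \<open>auto simp: pullback_def\<close>)
  moreover have "1 \<notin> pullback q" using H(1) D(3) unfolding pullback_def by simp
  hence "pullback q \<noteq> KO" using R(2) by blast
  moreover have "a \<in> pullback q \<or> b \<in> pullback q" if "a \<in> KO" "b \<in> KO" "a * b \<in> pullback q" for a b
    using that D(4)[OF conj_KO conj_KO, of a b] cm unfolding pullback_def by auto
  moreover have "pullback q \<noteq> {0}"
  proof -
    have "\<exists>x\<in>q. x \<noteq> 0" using q D(9) unfolding prime_ideal_in_def by blast
    then obtain x where x: "x \<in> q" "x \<noteq> 0" by blast
    hence xO: "x \<in> KO" using D(2) by blast
    have "conj (conj x) \<in> pullback q" unfolding pullback_def using conj3[OF KF[OF xO]] x conj_KO xO by simp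
    moreover have "conj (conj x) \<noteq> 0" using H(10) conj(2) KF[OF xO] x(2) by simp
    ultimately show ?thesis by auto
  qed
  ultimately show "prime_ideal_in KO (pullback q)" unfolding prime_ideal_in_def by blast
  show "pullback q \<inter> intO kk = q \<inter> intO kk"
    unfolding pullback_def using Ok_sub conj_kk unfolding intO_def by auto
qed

lemma pullback_r: assumes "prime_ideal_in KO q" shows "r \<in> pullback q \<longleftrightarrow> r \<in> q"
proof -
  note D = prime_idealD[OF KO_subring assms] and R = is_subringD[OF KO_subring]
  have "zeta3\<^sup>2 * (zeta3 * r) = zeta3 ^ 3 * r" by (simp add: power2_eq_square power3_eq_cube)
  hence "zeta3\<^sup>2 * (zeta3 * r) = r" by (simp add: zeta3_cube)
  hence "zeta3 * r \<in> q \<longleftrightarrow> r \<in> q" using D(7)[OF zeta3_KO] D(7)[OF R(7)[OF zeta3_KO]] by metis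
  thus ?thesis unfolding pullback_def using conj_r r_KO by simp
qed

lemma pullback_good_unif: "good_unif q w \<Longrightarrow> good_unif (pullback q) w"
  using pullback_prime pullback_r subring_numeral[OF Ok_subring, of "Num.Bit1 Num.One"]
  unfolding good_unif_def by blast

text \<open>Applying \<open>conj\<close> to the defining equation of the valuation replaces
  \<open>w\<close> by a power of \<open>zeta3\<close> times \<open>w\<close>, and the root of unity
  is absorbed into the unit.\<close>

lemma local_val_pullback:
  assumes g: "good_unif q w" and x: "x \<in> KO" and v: "local_val KO (pullback q) w x n"
  shows "local_val KO q w (conj x) n"
proof -
  note H = fhomD[OF KF_subfield conj(1)] and R = is_subringD[OF KO_subring]
  have q: "prime_ideal_in KO q" using g unfolding good_unif_def by blast
  note C = prime_ideal_compl[OF KO_subring q]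
  have KF: "x \<in> KF" if "x \<in> KO" for x using that unfolding intO_def by blast
  obtain u s where us: "u \<in> KO - pullback q" "s \<in> KO - pullback q" "u * x = w ^ n * s"
    using v unfolding local_val_def by blast
  have z: "zeta3 ^ k \<in> KO - q" for k by (rule C(3)[OF zeta3_unit[OF KO_subring zeta3_KO q]])
  have wO: "w \<in> KO" using good_unif_local[OF g] prime_idealD(2)[OF KO_subring q] unfolding local_unif_def by blast
  have "\<exists>k. conj w = zeta3 ^ k * w"
  proof -
    consider "w = r" | "q \<inter> intO kk = principal (intO kk) w" using g unfolding good_unif_def by blast
    thus ?thesis
    proof cases
      case 1
      thus ?thesis using conj_r by (metis power_one_right)
    next
      case 2
      hence "w \<in> kk" using principal_self[OF Ok_subring, of w] unfolding intO_def by blast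
      thus ?thesis using conj_kk by (metis mult_1 power_0)
    qed
  qed
  then obtain k where k: "conj w = zeta3 ^ k * w" by blast
  have mem: "conj u \<in> KO - q" "conj s \<in> KO - q" using us conj_KO unfolding pullback_def by auto
  have "conj u * conj x = conj (u * x)" using H(3) us(1) x KF by auto
  also have "\<dots> = conj w ^ n * conj s"
    unfolding us(3) using H(3)[of "w ^ n" s] H(7)[of w n] KF[OF R(7)[OF wO, of n]] KF[OF wO] us(2) KF by auto
  also have "\<dots> = w ^ n * ((zeta3 ^ k) ^ n * conj s)" unfolding k power_mult_distrib by (simp only: mult_ac)
  finally show ?thesis unfolding local_val_def using mem C(2)[OF C(3)[OF z] mem(2)] by blast
qed

end

section \<open>Valuations of \<theta> and ramification in the tower\<close>

locale heisenberg_arith = heisenberg_tower r1 r2 t \<alpha> \<beta> c for r1 r2 t \<alpha> \<beta> c +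
  fixes P B :: "complex set" and a b :: nat and \<eta> s1 s2 s\<theta> :: complex
  assumes p1: "prime_ideal_in (intO kk) (principal (intO kk) (r1 ^ 3))"
    and p2: "prime_ideal_in (intO kk) (principal (intO kk) (r2 ^ 3))"
    and p12: "principal (intO kk) (r1 ^ 3) \<noteq> principal (intO kk) (r2 ^ 3)"
    and cong1: "r1 ^ 3 - 1 = s1 * (3 * sqrt_m3)" "s1 \<in> intO kk"
    and cong2: "r2 ^ 3 - 1 = s2 * (3 * sqrt_m3)" "s2 \<in> intO kk"
    and \<alpha>O: "\<alpha> \<in> KO"
    and P: "prime_ideal_in KO P" "P \<inter> intO kk = principal (intO kk) (r2 ^ 3)"
    and B: "ideal_in KO B" "B \<noteq> {0}" "gen_ideal KO (B \<union> principal KO 3) = KO"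
    and b3: "3 dvd b"
    and fact: "principal KO \<alpha> = imult KO (ipow KO P a) (ipow KO B b)"
    and \<eta>: "\<eta> \<in> KO" "\<eta> ^ 3 - \<theta> = s\<theta> * (3 * sqrt_m3)" "s\<theta> \<in> KO"
begin

abbreviation "p1 \<equiv> principal (intO kk) (r1 ^ 3)"
abbreviation "p2 \<equiv> principal (intO kk) (r2 ^ 3)"

lemma \<alpha>_neq_0: "\<alpha> \<noteq> 0"
  using \<alpha>_conj(2)[of 0] by simp

lemma P_not_subset:
  assumes q: "prime_ideal_in KO q" "q \<inter> intO kk \<noteq> p2" shows "\<not> P \<subseteq> q"
proof
  assume "P \<subseteq> q"
  hence "p2 \<subseteq> q \<inter> intO kk" using P(2) by blast
  thus False
    using Ok_prime_maximal[OF p2 prime_ideal_contraction[OF KF_subfield kk_subfield kk_sub q(1)]] q(2) by blast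
qed

lemma P_power_not_subset:
  assumes q: "prime_ideal_in KO q" "\<not> P \<subseteq> q" shows "\<not> ipow KO P a \<subseteq> q"
proof -
  obtain x where x: "x \<in> P" "x \<notin> q" using q(2) by blast
  have "x \<in> KO" using x prime_idealD(2)[OF KO_subring P(1)] by blast
  hence "x ^ a \<notin> q" using prime_idealD(10)[OF KO_subring q(1)] x by blast
  moreover have "x ^ a \<in> ipow KO P a" by (rule ipow_memI[OF KO_subring x(1)])
  ultimately show ?thesis by blast
qed

text \<open>Away from p2 the power of \<open>P\<close> is trivial at \<open>q\<close>, so only the
  \<open>b\<close>-th power of \<open>B\<close> contributes, and 3 divides \<open>b\<close>.\<close>

lemma \<alpha>_val:
  assumes g: "good_unif q w" "q \<inter> intO kk \<noteq> p2" shows "\<exists>n. local_val KO q w \<alpha> (3 * n)"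
proof -
  have q: "prime_ideal_in KO q" using g unfolding good_unif_def by blast
  have w: "w \<in> q" "w \<noteq> 0" using good_unif_local[OF g(1)] unfolding local_unif_def by auto
  have "ipow KO P a \<subseteq> KO"
    by (rule ideal_inD(1)[OF ipow_ideal[OF KO_subring prime_idealD(1)[OF KO_subring P(1)]]])
  from local_val_ideal_power[OF KO_subring q w good_unif_val[OF g(1)] \<alpha>O \<alpha>_neq_0 fact this
      P_power_not_subset[OF q P_not_subset[OF q g(2)]] B(1,2)]
  obtain n where "local_val KO q w \<alpha> (b * n)" by blast
  moreover obtain b' where "b = 3 * b'" using b3 by (rule dvdE)
  ultimately show ?thesis by (metis mult.assoc)
qed

lemma conj_pow_KO: "x \<in> KO \<Longrightarrow> (conj ^^ i) x \<in> KO"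
  by (induction i) (auto intro: conj_KO)

lemma \<theta>_val:
  assumes g: "good_unif q w" and v: "local_val KO q w ((conj ^^ i) \<alpha>) m" "local_val KO q w ((conj ^^ (i+1)) \<alpha>) n"
  shows "local_val KO q w ((conj ^^ i) \<theta>) (2 * m + n)"
proof -
  have q: "prime_ideal_in KO q" using g unfolding good_unif_def by blast
  note C = prime_ideal_compl[OF KO_subring q] and R = is_subringD[OF KO_subring]
  have z: "zeta3 ^ c \<in> KO - q" by (rule C(3)[OF zeta3_unit[OF KO_subring zeta3_KO q]])
  have "local_val KO q w (zeta3 ^ c * ((conj ^^ i) \<alpha>)\<^sup>2 * (conj ^^ (i+1)) \<alpha>) (0 + 2 * m + n)"
    by (intro local_val_mult[OF KO_subring q] local_val_unit[OF KO_subring q z] local_val_power[OF KO_subring q] v)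
  thus ?thesis unfolding conj_\<theta> by simp
qed

text \<open>Away from p2 both \<alpha> and its conjugate have valuation divisible by 3; for the
  conjugate this is read off at the pullback of \<open>q\<close>, which lies over the same prime of
  k.\<close>

lemma \<theta>_val_generic:
  assumes g: "good_unif q w" "q \<inter> intO kk \<noteq> p2" shows "\<exists>m. local_val KO q w ((conj ^^ 0) \<theta>) (3 * m)"
proof -
  have q: "prime_ideal_in KO q" using g unfolding good_unif_def by blast
  obtain m where m: "local_val KO q w ((conj ^^ 0) \<alpha>) (3 * m)" using \<alpha>_val[OF g] by auto
  obtain n where "local_val KO (pullback q) w \<alpha> (3 * n)"
    using \<alpha>_val[OF pullback_good_unif[OF g(1)]] pullback_prime(2)[OF q] g(2) by blast
  hence n: "local_val KO q w ((conj ^^ (0 + 1)) \<alpha>) (3 * n)" using local_val_pullback[OF g(1) \<alpha>O] by simp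
  have "2 * (3 * m) + 3 * n = 3 * (2 * m + n)" by simp
  thus ?thesis using \<theta>_val[OF g(1) m n] by metis
qed

text \<open>Above \<open>p2\<close> the valuations of the three conjugates of \<open>\<alpha>\<close> add up to 1 modulo 3, so two of them
  agree modulo 3.\<close>
lemma \<theta>_val_p2:
  assumes g: "good_unif q (r2 ^ 3)" shows "\<exists>i m. local_val KO q (r2 ^ 3) ((conj ^^ i) \<theta>) (3 * m)"
proof -
  have q: "prime_ideal_in KO q" using g unfolding good_unif_def by blast
  have w: "r2 ^ 3 \<in> q" "r2 ^ 3 \<noteq> 0" using good_unif_local[OF g] unfolding local_unif_def by auto
  have "\<exists>j. local_val KO q (r2 ^ 3) ((conj ^^ i) \<alpha>) j" for i
    by (rule good_unif_val[OF g conj_pow_KO[OF \<alpha>O] \<alpha>_conj(2)])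
  then obtain v where v: "\<And>i. local_val KO q (r2 ^ 3) ((conj ^^ i) \<alpha>) (v i)" by metis
  \<comment> \<open>\<beta> need not be integral, so the norm equation is multiplied by the cube of
    a denominator \<open>n\<close>, which changes valuations only by a multiple of 3.\<close>
  obtain n :: int where n: "n \<noteq> 0" "of_int n * \<beta> \<in> intO kk" using kk_denominator[OF \<beta>(1)] by blast
  have nO: "of_int n \<in> KO" using is_subfieldD(12)[OF KF_subfield] unfolding intO_def by simp
  obtain vn where vn: "local_val KO q (r2 ^ 3) (of_int n) vn" using good_unif_val[OF g nO] n(1) by auto
  have "of_int n * \<beta> \<in> KO" "of_int n * \<beta> \<noteq> 0" using n \<beta>(2) Ok_sub by auto
  then obtain v\<beta> where v\<beta>: "local_val KO q (r2 ^ 3) (of_int n * \<beta>) v\<beta>" using good_unif_val[OF g] by blast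
  let ?x = "of_int n ^ 3 * ((conj ^^ 0) \<alpha> * ((conj ^^ (0+1)) \<alpha> * (conj ^^ (0+2)) \<alpha>))"
  have v1: "local_val KO q (r2 ^ 3) ?x (3 * vn + (v 0 + (v (0+1) + v (0+2))))"
    by (intro local_val_mult[OF KO_subring q] local_val_power[OF KO_subring q] vn v)
  have v2: "local_val KO q (r2 ^ 3) (r2 ^ 3 * (of_int n * \<beta>) ^ 3) (1 + 3 * v\<beta>)"
    by (intro local_val_mult[OF KO_subring q] local_val_power[OF KO_subring q] local_val_self[OF KO_subring q] v\<beta>)
  have x: "?x = r2 ^ 3 * (of_int n * \<beta>) ^ 3"
    unfolding norm_\<alpha>_shift by (simp add: power_mult_distrib)
  have eq: "3 * vn + (v 0 + (v 1 + v 2)) = 1 + 3 * v\<beta>"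
    using local_val_unique[OF KO_subring q w v1[unfolded x] v2] by (simp add: numeral_2_eq_2)
  have v3: "v 3 = v 0"
    by (rule local_val_unique[OF KO_subring q w, of \<alpha>]) (use v[of 3] v[of 0] conj_pow3[OF \<alpha>, of 0] in auto)
  \<comment> \<open>Modulo 3, \<open>2 * v i + v (i + 1)\<close> is the difference of consecutive
    valuations. If none of the three cyclic differences vanished, the residues would be 0, 1, 2 in
    some order, with sum divisible by 3, against \<open>eq\<close>.\<close>
  have "3 dvd 2 * v 0 + v 1 \<or> 3 dvd 2 * v 1 + v 2 \<or> 3 dvd 2 * v 2 + v 3"
    unfolding v3 using eq by presburger
  hence "\<exists>i. 3 dvd 2 * v i + v (i + 1)" by (metis Suc_eq_plus1 One_nat_def numeral_2_eq_2 numeral_3_eq_3)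
  then obtain i m where "2 * v i + v (i + 1) = 3 * m" unfolding dvd_def by blast
  thus ?thesis using \<theta>_val[OF g v[of i] v[of "i + 1"]] by metis
qed

text \<open>\<open>P\<close> is not inside \<open>q\<close>, because it contains
  \<open>r2 ^ 3\<close>, which is 1 modulo 3; \<open>B\<close> is not, being coprime to 3. So the
  ideal of \<alpha> contains a product of elements outside \<open>q\<close>.\<close>

lemma \<alpha>_unit_above_3:
  assumes q: "prime_ideal_in KO q" "3 \<in> q" shows "\<alpha> \<notin> q"
proof
  assume "\<alpha> \<in> q"
  note D = prime_idealD[OF KO_subring q(1)]
  have sub: "principal KO \<alpha> \<subseteq> q" using D(7)[OF _ \<open>\<alpha> \<in> q\<close>] unfolding principal_def by blast
  have "\<not> P \<subseteq> q"
  proof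
    assume "P \<subseteq> q"
    moreover have "r2 ^ 3 \<in> P" using P(2) principal_self[OF Ok_subring] by blast
    ultimately have "r2 ^ 3 \<in> q" by blast
    moreover have "s2 * sqrt_m3 \<in> KO" unfolding sqrt_m3_zeta3
      by (intro is_subringD(2,3,5)[OF KO_subring] subsetD[OF Ok_sub cong2(2)] zeta3_KO subring_numeral[OF KO_subring])
    from D(7)[OF this q(2)] have "r2 ^ 3 - 1 \<in> q" unfolding cong2(1) by (simp add: mult_ac)
    ultimately have "r2 ^ 3 - (r2 ^ 3 - 1) \<in> q" by (rule D(6))
    thus False using D(3) by simp
  qed
  then obtain x where x: "x \<in> ipow KO P a" "x \<notin> q" using P_power_not_subset[OF q(1)] by blast
  have "\<not> B \<subseteq> q"
  proof
    assume "B \<subseteq> q"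
    moreover have "principal KO 3 \<subseteq> q" using D(7)[OF _ q(2)] unfolding principal_def by blast
    ultimately have "gen_ideal KO (B \<union> principal KO 3) \<subseteq> q" by (intro gen_ideal_least D(1)) blast
    thus False unfolding B(3) using D(3) is_subringD(2)[OF KO_subring] by blast
  qed
  then obtain y where y: "y \<in> B" "y \<notin> q" by blast
  have "x * y ^ b \<in> q" using imult_memI[OF x(1) ipow_memI[OF KO_subring y(1)]] fact sub by blast
  moreover have "x \<in> KO"
    using x ideal_inD(1)[OF ipow_ideal[OF KO_subring prime_idealD(1)[OF KO_subring P(1)]]] by blast
  moreover have "y \<in> KO" using y ideal_inD(1)[OF B(1)] by blast
  ultimately show False
    using prime_ideal_compl(2,3)[OF KO_subring q(1)] x y by blast
qed

text \<open>The pullback of \<open>q\<close> contains 3 as well, so both \<alpha> and its conjugate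
  are units at \<open>q\<close>.\<close>

lemma \<theta>_unit_above_3:
  assumes q: "prime_ideal_in KO q" "3 \<in> q" shows "\<theta> \<notin> q"
proof -
  note C = prime_ideal_compl[OF KO_subring q(1)] and D = prime_idealD[OF KO_subring q(1)]
  have "3 \<in> intO kk" by (rule subring_numeral[OF Ok_subring])
  hence "3 \<in> pullback q" using q(2) pullback_prime(2)[OF q(1)] by blast
  hence "conj \<alpha> \<notin> q"
    using \<alpha>_unit_above_3[OF pullback_prime(1)[OF q(1)]] \<alpha>O unfolding pullback_def by blast
  hence "conj \<alpha> \<in> KO - q" "\<alpha> \<in> KO - q" using \<alpha>_unit_above_3[OF q] \<alpha>O conj_KO by auto
  hence "\<theta> \<in> KO - q" by (intro C(2,3) zeta3_unit[OF KO_subring zeta3_KO q(1)])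
  thus ?thesis by blast
qed

lemma contract_Ok: "prime_ideal_in RO Q \<Longrightarrow> prime_ideal_in (intO kk) (Q \<inter> intO kk)"
  by (rule prime_ideal_contraction[OF R_subfield kk_subfield R_mem(1)])

lemma contract_KO: "prime_ideal_in RO Q \<Longrightarrow> prime_ideal_in KO (Q \<inter> KO)"
  by (rule prime_ideal_contraction[OF R_subfield KF_subfield R_mem(2)])

lemma contract_KO_Ok: "(Q \<inter> KO) \<inter> intO kk = Q \<inter> intO kk"
  using Ok_sub by blast

lemma cube_notin:
  assumes Q: "prime_ideal_in RO Q"
  shows "Q \<inter> intO kk \<noteq> p1 \<Longrightarrow> r1 ^ 3 \<notin> Q" "Q \<inter> intO kk \<noteq> p2 \<Longrightarrow> r2 ^ 3 \<notin> Q"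
proof -
  have *: "r ^ 3 \<notin> Q" if p: "prime_ideal_in (intO kk) (principal (intO kk) (r ^ 3))"
    "Q \<inter> intO kk \<noteq> principal (intO kk) (r ^ 3)" for r
  proof
    assume a: "r ^ 3 \<in> Q"
    have "principal (intO kk) (r ^ 3) \<subseteq> Q \<inter> intO kk"
      using prime_idealD(7)[OF RO_subring Q _ a] Ok_RO prime_idealD(2)[OF Ok_subring p(1)]
      unfolding principal_def by blast
    thus False using Ok_prime_maximal[OF p(1) contract_Ok[OF Q]] p(2) by blast
  qed
  show "Q \<inter> intO kk \<noteq> p1 \<Longrightarrow> r1 ^ 3 \<notin> Q" "Q \<inter> intO kk \<noteq> p2 \<Longrightarrow> r2 ^ 3 \<notin> Q"
    using *[OF p1] *[OF p2] by auto
qed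

lemma three_notin:
  assumes Q: "prime_ideal_in RO Q" and "Q \<inter> intO kk = p1 \<or> Q \<inter> intO kk = p2" shows "3 \<notin> Q"
proof
  assume 3: "3 \<in> Q"
  note D = prime_idealD[OF RO_subring Q]
  have sm: "sqrt_m3 \<in> intO kk"
    unfolding intO_def sqrt_m3_zeta3 using alg_int_sqrt_m3[unfolded sqrt_m3_zeta3]
      is_subfieldD(2,3,5,13)[OF kk_subfield] zeta3_in_kk by simp
  have *: False if "x ^ 3 \<in> Q" "x ^ 3 - 1 = s * (3 * sqrt_m3)" "s \<in> intO kk" for x s
  proof -
    have "s * sqrt_m3 \<in> RO" using is_subringD(5)[OF Ok_subring that(3) sm] Ok_RO by blast
    hence "(s * sqrt_m3) * 3 \<in> Q" using D(7)[OF _ 3] by blast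
    hence "x ^ 3 - 1 \<in> Q" unfolding that(2) by (simp add: mult_ac)
    from D(6)[OF that(1) this] show False using D(3) by simp
  qed
  have "r1 ^ 3 \<in> Q \<or> r2 ^ 3 \<in> Q" using assms(2) principal_self[OF Ok_subring] by blast
  thus False using * cong1 cong2 by blast
qed

lemma good_unif_contract:
  assumes Q: "prime_ideal_in RO Q" "3 \<notin> Q" and w: "w \<noteq> 0"
    "r1 ^ 3 \<notin> Q \<and> Q \<inter> intO kk = principal (intO kk) w \<or> w = r1 \<and> Q \<inter> intO kk = p1"
  shows "good_unif (Q \<inter> KO) w"
proof -
  have "r1 \<notin> Q" if "r1 ^ 3 \<notin> Q"
  proof
    assume "r1 \<in> Q"
    have "r1 ^ 3 = r1\<^sup>2 * r1" by (simp add: power2_eq_square power3_eq_cube)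
    thus False using that prime_idealD(7)[OF RO_subring Q(1) is_subringD(7)[OF RO_subring roots_RO(1)] \<open>r1 \<in> Q\<close>]
      by simp
  qed
  thus ?thesis unfolding good_unif_def contract_KO_Ok using contract_KO[OF Q(1)] Q(2) w by blast
qed

text \<open>The uniformizer \<open>g\<close> already lies in k, so every nontrivial automorphism
  needs a witness. Above 3 the witnesses come from the congruences modulo
  \<open>3 * sqrt_m3\<close>; elsewhere \<open>r1\<close> and \<open>r2\<close> are units and
  \<theta> has valuation divisible by 3.\<close>

lemma unramified:
  assumes Q: "prime_ideal_in RO Q" and p: "Q \<inter> intO kk \<noteq> p1" "Q \<inter> intO kk \<noteq> p2"
  shows "ram_index RO Q (Q \<inter> intO kk) = 1"
proof -
  note D = prime_idealD[OF RO_subring Q]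
  obtain g where g: "g \<in> Q \<inter> intO kk" "g \<noteq> 0" "Q \<inter> intO kk = principal (intO kk) g"
    using contract_Ok[OF Q] by (rule Ok_prime_generator)
  note nc = cube_notin(1)[OF Q p(1)] cube_notin(2)[OF Q p(2)]
  have tQ: "t \<in> RO"
    using alg_int_root[of t 3] t_cube conj_KO \<alpha>O K12_R(2) is_subringD(5,7)[OF KO_subring] zeta3_KO
    unfolding intO_def by (simp add: alg_int_ring)
  have "local_unif RO Q g"
  proof (rule local_unif_RO[OF Q, of "{}" kk g 1])
    have above3: "\<exists>y\<in>RO. \<sigma> y - y \<notin> Q" if "3 \<in> Q" "\<sigma> \<in> Aut kk R" "\<sigma> x = zeta3 ^ i * x" "zeta3 ^ i \<noteq> 1"
      "x \<in> RO" "x ^ 3 \<notin> Q" "h \<in> RO" "\<sigma> h = h" "h ^ 3 - x ^ 3 = s * (3 * sqrt_m3)" "s \<in> RO" for \<sigma> x i h s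
    proof (rule inertia_witness_above_3[OF R_subfield R_mem(5) AutD(3)[OF that(2)] AutD(4)[OF that(2)] Q that(5) _ that(3,4) that(7,8,9,10)])
      show "x \<notin> Q"
      proof
        assume "x \<in> Q"
        have "x ^ 3 = x\<^sup>2 * x" by (simp add: power2_eq_square power3_eq_cube)
        thus False using that(6) D(7)[OF is_subringD(7)[OF RO_subring that(5)] \<open>x \<in> Q\<close>] by simp
      qed
    qed
    show "\<exists>y\<in>RO. \<sigma> y - y \<notin> Q" if "\<sigma> \<in> Aut kk R" "\<sigma> r1 = zeta3 ^ i * r1" "zeta3 ^ i \<noteq> 1" for \<sigma> i
    proof (cases "3 \<in> Q")
      case True
      \<comment> \<open>Since \<open>r1 ^ 3\<close> is congruent to 1, the number 1 plays the role
        of \<eta>; every automorphism fixes it.\<close>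
      have "1 ^ 3 - r1 ^ 3 = (- s1) * (3 * sqrt_m3)" using cong1(1) by (simp add: algebra_simps)
      moreover have "- s1 \<in> RO" using cong1(2) Ok_RO is_subringD(6)[OF RO_subring] by blast
      ultimately show ?thesis
        using above3[OF True that roots_RO(1) nc(1) is_subringD(2)[OF RO_subring]]
          fhomD(1)[OF R_subfield AutD(3)[OF that(1)]] by blast
    next
      case False
      thus ?thesis using inertia_witness_tame[where \<sigma> = \<sigma> and x = r1, OF Q False that(2,3) roots_RO(1) nc(1)] by blast
    qed
    show "\<exists>y\<in>RO. \<sigma> y - y \<notin> Q" if "\<sigma> \<in> Aut kk R" "\<sigma> r2 = zeta3 ^ i * r2" "zeta3 ^ i \<noteq> 1" for \<sigma> i
    proof (cases "3 \<in> Q")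
      case True
      have "1 ^ 3 - r2 ^ 3 = (- s2) * (3 * sqrt_m3)" using cong2(1) by (simp add: algebra_simps)
      moreover have "- s2 \<in> RO" using cong2(2) Ok_RO is_subringD(6)[OF RO_subring] by blast
      ultimately show ?thesis
        using above3[OF True that roots_RO(2) nc(2) is_subringD(2)[OF RO_subring]]
          fhomD(1)[OF R_subfield AutD(3)[OF that(1)]] by blast
    next
      case False
      thus ?thesis using inertia_witness_tame[where \<sigma> = \<sigma> and x = r2, OF Q False that(2,3) roots_RO(2) nc(2)] by blast
    qed
    show "\<exists>y\<in>RO. \<sigma> y - y \<notin> Q" if s: "\<sigma> \<in> Aut kk R" "\<And>x. x \<in> K12 \<Longrightarrow> \<sigma> x = x" "\<sigma> t = zeta3 ^ l * t" "zeta3 ^ l \<noteq> 1" for \<sigma> l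
    proof (cases "3 \<in> Q")
      case True
      have "3 \<in> Q \<inter> KO" using True subring_numeral[OF KO_subring] by blast
      hence "\<theta> \<notin> Q \<inter> KO" by (rule \<theta>_unit_above_3[OF contract_KO[OF Q]])
      moreover have "\<theta> \<in> KO" by (intro is_subringD(5,7)[OF KO_subring] zeta3_KO \<alpha>O conj_KO)
      ultimately have nt: "t ^ 3 \<notin> Q" unfolding t_cube by blast
      have e: "\<eta> \<in> RO" "\<sigma> \<eta> = \<eta>" "s\<theta> \<in> RO"
        using \<eta> KO_RO s(2) KF_K12 unfolding intO_def by auto
      show ?thesis
        by (rule above3[OF True s(1,3,4) tQ nt e(1,2) _ e(3)]) (use \<eta>(2) t_cube in simp)
    next
      case False
      have gu: "good_unif (Q \<inter> KO) g" by (rule good_unif_contract[OF Q False g(2)]) (use nc g in blast)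
      have "(Q \<inter> KO) \<inter> intO kk \<noteq> p2" unfolding contract_KO_Ok by (rule p(2))
      then obtain m where m: "local_val KO (Q \<inter> KO) g ((conj ^^ 0) \<theta>) (3 * m)"
        using \<theta>_val_generic[OF gu] by blast
      have gO: "g \<in> KO" using g(1) Ok_sub by blast
      show ?thesis by (rule inertia_witness_local_cube[OF Q False s gO g(2) m])
    qed
    show "\<exists>s\<in>RO. 1 * a = g * s" if "a \<in> Q" "a \<in> intO kk" for a
      using that g(3) Ok_RO unfolding principal_def by (auto simp: mult.commute)
  qed (use g fixed_kk prime_ideal_compl(1)[OF RO_subring Q] in auto)
  thus ?thesis
  proof (rule ram_index_local_unif[OF RO_subring Q])
    show "g ^ 1 \<in> Q \<inter> intO kk" using g(1) by simp
    show "\<exists>s\<in>RO. x = s * g ^ 1" if "x \<in> Q \<inter> intO kk" for x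
      using that Ok_RO unfolding g(3) principal_def by auto
  qed
qed

text \<open>The prime is generated locally by \<open>r1\<close>, whose cube generates p1; this gives
  index 3. Automorphisms over \<open>KF\<close> can move only \<open>r2\<close>, a unit at
  \<open>Q\<close>, and \<open>t\<close>, for which \<theta> has valuation divisible by 3 because
  \<open>Q\<close> is not above p2.\<close>

lemma ramified_p1:
  assumes Q: "prime_ideal_in RO Q" and p: "Q \<inter> intO kk = p1"
  shows "ram_index RO Q (Q \<inter> intO kk) = 3"
proof -
  note D = prime_idealD[OF RO_subring Q]
  have n3: "3 \<notin> Q" using three_notin[OF Q] p by blast
  have np2: "Q \<inter> intO kk \<noteq> p2" using p p12 by simp
  note nc = cube_notin(2)[OF Q np2]
  have gu: "good_unif (Q \<inter> KO) r1" by (rule good_unif_contract[OF Q n3 r_neq_0]) (use p in blast)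
  obtain e where e: "e \<in> KO - (Q \<inter> KO)" "\<And>x. x \<in> Q \<inter> KO \<Longrightarrow> \<exists>s\<in>KO. e * x = r1 * s" and rQ: "r1 \<in> Q"
    using good_unif_local[OF gu] unfolding local_unif_def by blast
  have "local_unif RO Q r1"
  proof (rule local_unif_RO[OF Q, of "{r1}" KF r1 e])
    show "\<exists>y\<in>RO. \<sigma> y - y \<notin> Q" if "\<sigma> \<in> Aut kk R" "\<And>x. x \<in> {r1} \<Longrightarrow> \<sigma> x = x" "\<sigma> r1 = zeta3 ^ i * r1" "zeta3 ^ i \<noteq> 1" for \<sigma> i
      using that r_neq_0 by auto
    show "\<exists>y\<in>RO. \<sigma> y - y \<notin> Q" if "\<sigma> r2 = zeta3 ^ i * r2" "zeta3 ^ i \<noteq> 1" for \<sigma> i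
      by (rule inertia_witness_tame[where \<sigma> = \<sigma> and x = r2, OF Q n3 that roots_RO(2) nc])
    show "\<exists>y\<in>RO. \<sigma> y - y \<notin> Q" if s: "\<sigma> \<in> Aut kk R" "\<And>x. x \<in> K12 \<Longrightarrow> \<sigma> x = x" "\<sigma> t = zeta3 ^ l * t" "zeta3 ^ l \<noteq> 1" for \<sigma> l
    proof -
      have "(Q \<inter> KO) \<inter> intO kk \<noteq> p2" unfolding contract_KO_Ok by (rule np2)
      then obtain m where m: "local_val KO (Q \<inter> KO) r1 ((conj ^^ 0) \<theta>) (3 * m)"
        using \<theta>_val_generic[OF gu] by blast
      show ?thesis by (rule inertia_witness_local_cube[OF Q n3 s r_KO r_neq_0 m])
    qed
    show "\<exists>s\<in>RO. e * a = r1 * s" if "a \<in> Q" "a \<in> KO" for a using e(2)[of a] that KO_RO by blast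
    show "x \<in> KF" if "x \<in> R" "\<And>\<sigma>. \<sigma> \<in> Aut kk R \<Longrightarrow> (\<And>x. x \<in> {r1} \<Longrightarrow> \<sigma> x = x) \<Longrightarrow> \<sigma> x = x" for x
      by (rule fixed_KF[OF that(1)]) (use that(2) in blast)
  qed (use e rQ r_neq_0 KO_RO R_mem in auto)
  thus ?thesis
  proof (rule ram_index_local_unif[OF RO_subring Q])
    show "r1 ^ 3 \<in> Q \<inter> intO kk" unfolding p by (rule principal_self[OF Ok_subring])
    show "\<exists>s\<in>RO. x = s * r1 ^ 3" if "x \<in> Q \<inter> intO kk" for x
      using that Ok_RO unfolding p principal_def by auto
  qed
qed

text \<open>Two subfields are in play: the uniformizer \<open>r2\<close> lives in k(r2), whereas the
  valuations of the conjugates of \<theta> are taken in k(r1), where p2 does not ramify and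
  \<open>r2 ^ 3\<close> is a uniformizer.\<close>

lemma ramified_p2:
  assumes Q: "prime_ideal_in RO Q" and p: "Q \<inter> intO kk = p2"
  shows "ram_index RO Q (Q \<inter> intO kk) = 3"
proof -
  note D = prime_idealD[OF RO_subring Q]
  have n3: "3 \<notin> Q" using three_notin[OF Q] p by blast
  have np1: "Q \<inter> intO kk \<noteq> p1" using p p12 by simp
  note nc = cube_notin(1)[OF Q np1]
  interpret K2: kummer r2
    by unfold_locales (use r2_cube r2_notin kk_sub in auto)
  have sub: "adj kk r2 \<subseteq> R" by (intro adj_least R_subfield R_mem)
  let ?q = "Q \<inter> intO (adj kk r2)"
  have "local_unif (intO (adj kk r2)) ?q r2"
  proof (rule K2.tame_local_unif)
    show "prime_ideal_in (intO (adj kk r2)) ?q"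
      by (rule prime_ideal_contraction[OF R_subfield K2.KF_subfield sub Q])
    show "?q \<inter> intO kk = p2" using p K2.Ok_sub by blast
    show "3 \<notin> ?q" using n3 by blast
  qed
  then obtain e where e: "e \<in> intO (adj kk r2) - ?q" "\<And>x. x \<in> ?q \<Longrightarrow> \<exists>s\<in>intO (adj kk r2). e * x = r2 * s"
    and rQ: "r2 \<in> Q"
    unfolding local_unif_def by blast
  note K2RO = intO_mono[OF sub]
  have r20: "r2 ^ 3 \<noteq> 0" using r2_neq_0 by simp
  have gu: "good_unif (Q \<inter> KO) (r2 ^ 3)" by (rule good_unif_contract[OF Q n3 r20]) (use p nc in blast)
  have "local_unif RO Q r2"
  proof (rule local_unif_RO[OF Q, of "{r2}" "adj kk r2" r2 e])
    show "\<exists>y\<in>RO. \<sigma> y - y \<notin> Q" if "\<sigma> r1 = zeta3 ^ i * r1" "zeta3 ^ i \<noteq> 1" for \<sigma> i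
      by (rule inertia_witness_tame[where \<sigma> = \<sigma> and x = r1, OF Q n3 that roots_RO(1) nc])
    show "\<exists>y\<in>RO. \<sigma> y - y \<notin> Q" if "\<sigma> \<in> Aut kk R" "\<And>x. x \<in> {r2} \<Longrightarrow> \<sigma> x = x" "\<sigma> r2 = zeta3 ^ i * r2" "zeta3 ^ i \<noteq> 1" for \<sigma> i
      using that r2_neq_0 by auto
    show "\<exists>y\<in>RO. \<sigma> y - y \<notin> Q" if s: "\<sigma> \<in> Aut kk R" "\<And>x. x \<in> K12 \<Longrightarrow> \<sigma> x = x" "\<sigma> t = zeta3 ^ l * t" "zeta3 ^ l \<noteq> 1" for \<sigma> l
    proof -
      obtain i m where m: "local_val KO (Q \<inter> KO) (r2 ^ 3) ((conj ^^ i) \<theta>) (3 * m)"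
        using \<theta>_val_p2[OF gu] by blast
      show ?thesis by (rule inertia_witness_local_cube[OF Q n3 s subsetD[OF Ok_sub r2_cube] r20 m])
    qed
    show "\<exists>s\<in>RO. e * a = r2 * s" if "a \<in> Q" "a \<in> intO (adj kk r2)" for a using e(2)[of a] that K2RO by blast
    show "x \<in> adj kk r2" if "x \<in> R" "\<And>\<sigma>. \<sigma> \<in> Aut kk R \<Longrightarrow> (\<And>x. x \<in> {r2} \<Longrightarrow> \<sigma> x = x) \<Longrightarrow> \<sigma> x = x" for x
      by (rule fixed_kk_r2[OF that(1)]) (use that(2) in blast)
  qed (use e rQ r2_neq_0 K2RO R_mem in auto)
  thus ?thesis
  proof (rule ram_index_local_unif[OF RO_subring Q])
    show "r2 ^ 3 \<in> Q \<inter> intO kk" unfolding p by (rule principal_self[OF Ok_subring])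
    show "\<exists>s\<in>RO. x = s * r2 ^ 3" if "x \<in> Q \<inter> intO kk" for x
      using that Ok_RO unfolding p principal_def by auto
  qed
qed

end

section \<open>Generation of R by cube roots of the conjugates of \<theta>\<close>

context heisenberg_tower
begin

lemma T_1_cube: "T 1 ^ 3 * \<theta> = conj \<theta>" and T_2_cube: "T 2 ^ 3 * \<theta> = conj (conj \<theta>)"
  using T_cube[of 1] T_cube[of 2] by (simp_all add: numeral_2_eq_2)

lemma r2_eq_T: "r2 = T 1 * \<alpha> / \<beta>"
  using \<alpha>_conj(2)[of 0] \<beta>(2) by (simp add: T_def)

text \<open>If \<open>conj\<close> fixed \<theta>, then \<open>T 1\<close> would be a cube root of
  unity, and \<open>r2\<close>, which is \<open>T 1\<close> times an element of k(r1), would lie in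
  k(r1).\<close>

lemma \<theta>_notin_kk: "\<theta> \<notin> kk"
proof
  assume "\<theta> \<in> kk"
  hence "T 1 ^ 3 * \<theta> = \<theta>" using T_1_cube conj_kk by simp
  moreover have "\<theta> \<noteq> 0" using \<alpha>_conj(2)[of 0] \<alpha>_conj(2)[of 1] zeta3_neq by simp
  ultimately have "T 1 ^ 3 = 1 ^ 3" by (metis mult_cancel_right1 power_one)
  then obtain i where "T 1 = zeta3 ^ i * 1" using cube_eq_cases by blast
  hence "T 1 \<in> KF" using is_subfieldD(7)[OF KF_subfield zeta3_KF] by simp
  hence "T 1 * \<alpha> / \<beta> \<in> KF" using \<alpha> \<beta>(1) kk_sub by (intro is_subfieldD(5,11)[OF KF_subfield]) auto
  hence "r2 \<in> KF" by (subst r2_eq_T)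
  thus False using r2_notin by simp
qed

text \<open>Any cube roots of the conjugates are \<open>T i * t\<close> up to powers of
  \<open>zeta3\<close>, hence in \<open>R\<close>. Conversely the cubes recover \<open>r1\<close>,
  the first root recovers \<open>t\<close>, and the quotient of the first two recovers
  \<open>T 1\<close>, hence \<open>r2\<close>.\<close>

lemma gen_field_conjugates:
  assumes t1: "t1 ^ 3 = \<theta>" and t2: "t2 ^ 3 = conj \<theta>" and t3: "t3 ^ 3 = conj (conj \<theta>)"
  shows "gen_field {zeta3, t1, t2, t3} = R"
proof
  have zR: "zeta3 ^ i \<in> R" for i by (rule is_subfieldD(7)[OF R_subfield R_mem(5)])
  have TR: "zeta3 ^ i * (T k * t) \<in> R" for i k
    by (intro is_subfieldD(5)[OF R_subfield] zR subsetD[OF K12_R(1) T_in] K12_R(2))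
  have e1: "t1 ^ 3 = (T 0 * t) ^ 3" using t1 t_cube by (simp add: T_0)
  have e2: "t2 ^ 3 = (T 1 * t) ^ 3" unfolding t2 T_1_cube[symmetric] power_mult_distrib t_cube ..
  have e3: "t3 ^ 3 = (T 2 * t) ^ 3" unfolding t3 T_2_cube[symmetric] power_mult_distrib t_cube ..
  have "t1 \<in> R" "t2 \<in> R" "t3 \<in> R"
    using cube_eq_cases[OF e1] cube_eq_cases[OF e2] cube_eq_cases[OF e3] TR by metis+
  thus "gen_field {zeta3, t1, t2, t3} \<subseteq> R" using R_mem by (intro gen_field_least R_subfield) auto
  let ?L = "gen_field {zeta3, t1, t2, t3}"
  have L: "is_subfield ?L" by (rule gen_field_subfield)
  note S = is_subfieldD[OF L]
  have mem: "zeta3 \<in> ?L" "t1 \<in> ?L" "t2 \<in> ?L" "t3 \<in> ?L"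
    using gen_field_superset[of "{zeta3, t1, t2, t3}"] by auto
  have kL: "kk \<subseteq> ?L" by (rule kk_least[OF L mem(1)])
  have zL: "zeta3 ^ i \<in> ?L" for i by (rule S(7)[OF mem(1)])
  obtain u v w where uvw: "u \<in> kk" "v \<in> kk" "w \<in> kk" "\<theta> = u + v * r1 + w * r1\<^sup>2"
    using \<theta>_in by (rule adjE)
  have c1: "conj \<theta> = u + (v * zeta3) * r1 + (w * zeta3\<^sup>2) * r1\<^sup>2" unfolding uvw(4) by (rule conj(3)[OF uvw(1-3)])
  have c2: "conj (conj \<theta>) = u + (v * zeta3\<^sup>2) * r1 + (w * zeta3) * r1\<^sup>2" unfolding uvw(4) by (rule conj2[OF uvw(1-3)])
  \<comment> \<open>Lagrange resolvents of \<theta> isolate its coordinates at r1 and r1^2. They do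
    not both vanish, since \<theta> is not in k, and either one yields \<open>r1\<close>.\<close>
  have a1: "3 * v * r1 = t1 ^ 3 + zeta3\<^sup>2 * t2 ^ 3 + zeta3 * t3 ^ 3"
    unfolding t1 t2 t3 unfolding c2 unfolding c1 unfolding uvw(4) using zeta3_sum by Groebner_Basis.algebra
  have a2: "3 * w * r1\<^sup>2 = t1 ^ 3 + zeta3 * t2 ^ 3 + zeta3\<^sup>2 * t3 ^ 3"
    unfolding t1 t2 t3 unfolding c2 unfolding c1 unfolding uvw(4) using zeta3_sum by Groebner_Basis.algebra
  have b1: "3 * v * r1 \<in> ?L" unfolding a1 by (intro S mem)
  have b2: "3 * w * r1\<^sup>2 \<in> ?L" unfolding a2 by (intro S mem)
  have r1L: "r1 \<in> ?L"
  proof (cases "v = 0")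
    case False
    have "(3 * v * r1) / (3 * v) \<in> ?L" by (intro S(11) S(5) b1 S(13) subsetD[OF kL uvw(2)])
    thus ?thesis using False by simp
  next
    case True
    have w0: "w \<noteq> 0" using \<theta>_notin_kk uvw True by auto
    have "r1 ^ 3 * (3 * w) / (3 * w * r1\<^sup>2) \<in> ?L"
      by (intro S(11) b2) (intro S(5) S(13) subsetD[OF kL uvw(3)] subsetD[OF kL r3k])
    moreover have "r1 ^ 3 * (3 * w) / (3 * w * r1\<^sup>2) = r1"
      using w0 r_neq_0 by (simp add: power2_eq_square power3_eq_cube)
    ultimately show ?thesis by simp
  qed
  have KL: "KF \<subseteq> ?L" by (rule adj_least[OF L kL r1L])
  obtain i where "T 0 * t = zeta3 ^ i * t1" using cube_eq_cases[OF e1[symmetric]] by blast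
  hence "t = zeta3 ^ i * t1" by (simp add: T_0)
  hence tL: "t \<in> ?L" using S(5)[OF zL mem(2)] by simp
  obtain j where "T 1 * t = zeta3 ^ j * t2" using cube_eq_cases[OF e2[symmetric]] by blast
  hence "T 1 = zeta3 ^ j * t2 / t" using t_neq_0 by (simp add: field_simps)
  hence "T 1 \<in> ?L" using S(11)[OF S(5)[OF zL mem(3)] tL] by simp
  hence r2L: "r2 \<in> ?L"
    by (subst r2_eq_T) (intro S(11) S(5) subsetD[OF KL \<alpha>] subsetD[OF kL \<beta>(1)])
  show "R \<subseteq> ?L" by (rule R_least[OF L kL r1L r2L tL])
qed

lemma gen_field_R: "gen_field {zeta3, r1, r2, t} = R"
proof
  show "gen_field {zeta3, r1, r2, t} \<subseteq> R" using R_mem K12_R by (intro gen_field_least R_subfield) auto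
  have L: "is_subfield (gen_field {zeta3, r1, r2, t})" by (rule gen_field_subfield)
  have mem: "{zeta3, r1, r2, t} \<subseteq> gen_field {zeta3, r1, r2, t}" by (rule gen_field_superset)
  show "R \<subseteq> gen_field {zeta3, r1, r2, t}"
    using mem kk_least[OF L] by (intro R_least L) auto
qed

end

context kummer
begin

lemma gen_field_KF: "gen_field {zeta3, r} = KF"
proof
  show "gen_field {zeta3, r} \<subseteq> KF" using r_in zeta3_in_kk kk_sub by (intro gen_field_least KF_subfield) auto
  have L: "is_subfield (gen_field {zeta3, r})" by (rule gen_field_subfield)
  have mem: "{zeta3, r} \<subseteq> gen_field {zeta3, r}" by (rule gen_field_superset)
  show "KF \<subseteq> gen_field {zeta3, r}"
    using mem kk_least[OF L] by (intro adj_least L) auto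
qed

lemma conj_eq:
  assumes "\<tau> \<in> Aut kk KF" "\<tau> r = zeta3 * r" "x \<in> KF" shows "\<tau> x = conj x"
  by (rule fhom_adj_eq[OF kk_subfield zeta3_in_kk r3k AutD(3)[OF assms(1)] conj(1) _ _ assms(3)])
    (simp_all add: AutD(4)[OF assms(1)] conj_kk conj_r assms(2))

text \<open>The norm is a product over the set of automorphisms, so this set is listed explicitly;
  its three members must also be shown distinct for the product to have three factors.\<close>

lemma rel_norm_KF:
  assumes \<tau>: "\<tau> \<in> Aut kk KF" "\<tau> r = zeta3 * r" and x: "x \<in> KF"
  shows "rel_norm kk KF x = x * (conj x * conj (conj x))"
proof -
  note ext = fhom_adj_eq[OF kk_subfield zeta3_in_kk r3k]
  let ?i = "restrict id KF" and ?t2 = "restrict (\<tau> \<circ> \<tau>) KF"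
  have i: "?i \<in> Aut kk KF"
    by (rule AutI) (use kk_sub in \<open>auto simp: fhom_def is_subfieldD[OF KF_subfield]\<close>)
  have t2: "?t2 \<in> Aut kk KF" by (rule Aut_comp[OF KF_subfield kk_sub \<tau>(1,1)])
  have zK: "zeta3 \<in> KF" using zeta3_in_kk kk_sub by blast
  have t2r: "?t2 r = zeta3\<^sup>2 * r"
    using fhomD(3)[OF KF_subfield AutD(3)[OF \<tau>(1)] zK r_in] r_in \<tau>(2) AutD(4)[OF \<tau>(1) zeta3_in_kk]
    by (simp add: power2_eq_square)
  have eq: "\<sigma> = \<rho>" if "\<sigma> \<in> Aut kk KF" "\<rho> \<in> Aut kk KF" "\<sigma> r = \<rho> r" for \<sigma> \<rho>
  proof (rule extensionalityI[OF AutD(1)[OF that(1)] AutD(1)[OF that(2)]])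
    show "\<sigma> y = \<rho> y" if y: "y \<in> KF" for y
      by (rule ext[OF AutD(3)[OF \<open>\<sigma> \<in> _\<close>] AutD(3)[OF \<open>\<rho> \<in> _\<close>] _ \<open>\<sigma> r = \<rho> r\<close> y])
        (simp add: AutD(4)[OF \<open>\<sigma> \<in> _\<close>] AutD(4)[OF \<open>\<rho> \<in> _\<close>])
  qed
  have "Aut kk KF = {?i, \<tau>, ?t2}"
  proof
    show "Aut kk KF \<subseteq> {?i, \<tau>, ?t2}"
    proof
      fix \<sigma> assume s: "\<sigma> \<in> Aut kk KF"
      have "\<sigma> r ^ 3 = r ^ 3"
        using fhomD(7)[OF KF_subfield AutD(3)[OF s] r_in, of 3] AutD(4)[OF s r3k] by simp
      then obtain n where n: "n < 3" "\<sigma> r = zeta3 ^ n * r" using cube_eq_cases by blast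
      consider "n = 0" | "n = 1" | "n = 2" using n(1) by linarith
      hence "\<sigma> r = ?i r \<or> \<sigma> r = \<tau> r \<or> \<sigma> r = ?t2 r"
        by cases (use n(2) r_in \<tau>(2) t2r in auto)
      thus "\<sigma> \<in> {?i, \<tau>, ?t2}" using eq[OF s i] eq[OF s \<tau>(1)] eq[OF s t2] by blast
    qed
  qed (use i \<tau> t2 in auto)
  moreover have "?i \<noteq> \<tau> \<and> ?i \<noteq> ?t2 \<and> \<tau> \<noteq> ?t2"
  proof -
    have ir: "?i r = r" using r_in by simp
    have "zeta3 * r \<noteq> r" "zeta3\<^sup>2 * r \<noteq> r" "zeta3\<^sup>2 * r \<noteq> zeta3 * r"
      using zeta3_neq r_neq_0 by (auto simp: power2_eq_square)
    thus ?thesis using ir t2r \<tau>(2) by metis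
  qed
  ultimately have "rel_norm kk KF x = ?i x * (\<tau> x * ?t2 x)" unfolding rel_norm_def by simp
  also have "\<dots> = x * (conj x * conj (conj x))"
    using x conj_eq[OF \<tau> x] conj_eq[OF \<tau> conj(2)[OF x]] by simp
  finally show ?thesis .
qed

end

text \<open>Otherwise \<open>r2\<close> would be an element of k times a power of \<open>r1\<close>.
  Cubing and comparing valuations at the prime of \<open>r2 ^ 3\<close>, where \<open>r1 ^ 3\<close>
  is a unit, gives 1 on one side and 0 on the other modulo 3.\<close>

lemma cube_root_notin_kummer:
  assumes r1: "kummer r1" and p1: "prime_ideal_in (intO kk) (principal (intO kk) (r1 ^ 3))"
    and p2: "prime_ideal_in (intO kk) (principal (intO kk) (r2 ^ 3))"
    and ne: "principal (intO kk) (r1 ^ 3) \<noteq> principal (intO kk) (r2 ^ 3)"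
  shows "r2 \<notin> adj kk r1"
proof
  assume r2: "r2 \<in> adj kk r1"
  interpret kummer r1 by (rule r1)
  let ?p = "principal (intO kk) (r2 ^ 3)"
  note D = prime_idealD[OF Ok_subring p2]
  have gp: "r2 ^ 3 \<in> ?p" by (rule principal_self[OF Ok_subring])
  have gO: "r2 ^ 3 \<in> intO kk" using gp D(2) by blast
  have g0: "r2 ^ 3 \<noteq> 0"
  proof
    assume "r2 ^ 3 = 0"
    hence "?p \<subseteq> {0}" unfolding principal_def by auto
    thus False using p2 D(9) unfolding prime_ideal_in_def by blast
  qed
  have "r1 ^ 3 \<notin> ?p"
  proof
    assume "r1 ^ 3 \<in> ?p"
    hence "principal (intO kk) (r1 ^ 3) \<subseteq> ?p" using D(7) unfolding principal_def[of _ "r1 ^ 3"] by blast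
    thus False using Ok_prime_maximal[OF p1 p2] ne by blast
  qed
  hence r1u: "r1 ^ 3 \<in> intO kk - ?p" using r3 by blast
  have "r2 ^ 3 \<in> kk" using gO unfolding intO_def by blast
  then obtain u j where u: "u \<in> kk" "r2 = u * r1 ^ j"
    using kummer_cube_root[OF kk_subfield zeta3_in_kk r3k r_notin r2] by blast
  obtain n :: int where n: "n \<noteq> 0" "of_int n * u \<in> intO kk" using kk_denominator[OF u(1)] by blast
  have nO: "of_int n \<in> intO kk" using is_subfieldD(12)[OF kk_subfield] unfolding intO_def by simp
  have "of_int n * u \<noteq> 0" using n(1) u(2) g0 by auto
  then obtain vu where vu: "local_val (intO kk) ?p (r2 ^ 3) (of_int n * u) vu"
    using Ok_local_val_exists[OF p2 refl n(2)] by blast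
  obtain vn where vn: "local_val (intO kk) ?p (r2 ^ 3) (of_int n) vn"
    using Ok_local_val_exists[OF p2 refl nO] n(1) by auto
  have "local_val (intO kk) ?p (r2 ^ 3) (of_int n ^ 3 * r2 ^ 3) (3 * vn + 1)"
    by (intro local_val_mult[OF Ok_subring p2] local_val_power[OF Ok_subring p2] vn local_val_self[OF Ok_subring p2])
  moreover have "local_val (intO kk) ?p (r2 ^ 3) ((of_int n * u) ^ 3 * (r1 ^ 3) ^ j) (3 * vu + j * 0)"
    by (intro local_val_mult[OF Ok_subring p2] local_val_power[OF Ok_subring p2] vu local_val_unit[OF Ok_subring p2 r1u])
  moreover have "of_int n ^ 3 * r2 ^ 3 = (of_int n * u) ^ 3 * (r1 ^ 3) ^ j"
    unfolding u(2) power_mult_distrib power_mult[symmetric] by (simp add: mult.commute[of j 3])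
  ultimately have "3 * vn + 1 = 3 * vu + j * 0"
    by (intro local_val_unique[OF Ok_subring p2 gp g0, of "of_int n ^ 3 * r2 ^ 3"]) simp_all
  thus False by presburger
qed

theorem theorem4p10:
  fixes \<pi>1 \<pi>2 r1 r2 t :: complex and p1 p2 P :: "complex set" and \<tau> :: "complex \<Rightarrow> complex"
  defines "Ok \<equiv> intO kk"
  defines "K1 \<equiv> gen_field {zeta3, r1}"
  defines "R \<equiv> gen_field {zeta3, r1, r2, t}"
  assumes p1: "prime_ideal_in Ok p1" "3 \<notin> p1" "ideal_norm Ok p1 mod 9 = 1"
  assumes p2: "prime_ideal_in Ok p2" "3 \<notin> p2" "ideal_norm Ok p2 mod 9 = 1"
  assumes p12: "p1 \<noteq> p2"
  assumes pi1: "\<pi>1 \<in> Ok" "p1 = principal Ok \<pi>1" "\<pi>1 - 1 \<in> principal Ok (3 * sqrt_m3)"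
  assumes pi2: "\<pi>2 \<in> Ok" "p2 = principal Ok \<pi>2" "\<pi>2 - 1 \<in> principal Ok (3 * sqrt_m3)"
  assumes cube1: "local_cube Ok p2 \<pi>1"
  assumes cube2: "local_cube Ok p1 \<pi>2"
  assumes r1: "r1 ^ 3 = \<pi>1" and r2: "r2 ^ 3 = \<pi>2"
  assumes tau: "\<tau> \<in> Aut kk K1" "\<tau> r1 = zeta3 * r1"
  assumes P: "prime_ideal_in (intO K1) P" "P \<inter> Ok = p2"
  assumes adm: "admissible \<pi>2 K1 \<tau> P \<theta>"
  assumes t: "t ^ 3 = \<theta>"
  shows "(\<forall>t1 t2 t3. t1 ^ 3 = \<theta> \<and> t2 ^ 3 = \<tau> \<theta> \<and> t3 ^ 3 = \<tau> (\<tau> \<theta>)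
            \<longrightarrow> R = gen_field {zeta3, t1, t2, t3})
    \<and> galois_ext kk R
    \<and> (\<forall>Q. prime_ideal_in (intO R) Q \<and> Q \<inter> Ok \<noteq> p1 \<and> Q \<inter> Ok \<noteq> p2
            \<longrightarrow> ram_index (intO R) Q (Q \<inter> Ok) = 1)
    \<and> (\<forall>Q. prime_ideal_in (intO R) Q \<and> (Q \<inter> Ok = p1 \<or> Q \<inter> Ok = p2)
            \<longrightarrow> ram_index (intO R) Q (Q \<inter> Ok) = 3)
    \<and> Gal kk R \<cong> N3F3"
proof -
  have p1_eq: "p1 = principal (intO kk) (r1 ^ 3)" and p2_eq: "p2 = principal (intO kk) (r2 ^ 3)"
    using pi1(2) pi2(2) r1 r2 unfolding Ok_def by simp_all
  have pr1: "prime_ideal_in (intO kk) (principal (intO kk) (r1 ^ 3))"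
    and pr2: "prime_ideal_in (intO kk) (principal (intO kk) (r2 ^ 3))"
    using p1(1) p2(1) unfolding Ok_def p1_eq p2_eq by simp_all
  have r10: "r1 \<noteq> 0"
  proof
    assume "r1 = 0"
    hence "principal (intO kk) (r1 ^ 3) \<subseteq> {0}" unfolding principal_def by auto
    thus False using pr1 prime_idealD(9)[OF Ok_subring pr1] unfolding prime_ideal_in_def by blast
  qed
  \<comment> \<open>\<tau> fixes every element of \<open>kk\<close> but multiplies the nonzero
    \<open>r1\<close> by \<open>zeta3\<close>.\<close>
  have "r1 \<notin> kk"
  proof
    assume "r1 \<in> kk"
    hence "zeta3 * r1 = r1" using AutD(4)[OF tau(1)] tau(2) by simp
    thus False using r10 zeta3_neq by simp
  qed
  then interpret K: kummer r1
    by unfold_locales (use pi1(1) r1 in \<open>simp_all add: Ok_def\<close>)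
  have K1: "K1 = adj kk r1" unfolding K1_def by (rule K.gen_field_KF)
  note \<tau> = tau[unfolded K1]
  obtain c \<alpha> \<beta> a b B \<eta> where
    \<alpha>: "\<alpha> \<in> intO K1" "\<theta> = zeta3 ^ c * \<alpha>\<^sup>2 * \<tau> \<alpha>"
    and \<beta>: "\<beta> \<in> kk" "rel_norm kk K1 \<alpha> = \<pi>2 * \<beta> ^ 3"
    and B: "3 dvd b" "ideal_in (intO K1) B" "B \<noteq> {0}" "gen_ideal (intO K1) (B \<union> principal (intO K1) 3) = intO K1"
      "principal (intO K1) \<alpha> = imult (intO K1) (ipow (intO K1) P a) (ipow (intO K1) B b)"
    and \<eta>: "\<eta> \<in> intO K1" "\<eta> ^ 3 - \<theta> \<in> principal (intO K1) (3 * sqrt_m3)"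
    using adm unfolding admissible_def by blast
  have \<alpha>K: "\<alpha> \<in> adj kk r1" using \<alpha>(1) unfolding K1 intO_def by blast
  have \<theta>: "\<theta> = zeta3 ^ c * \<alpha>\<^sup>2 * K.conj \<alpha>" using \<alpha>(2) K.conj_eq[OF \<tau> \<alpha>K] by simp
  have norm: "\<alpha> * (K.conj \<alpha> * K.conj (K.conj \<alpha>)) = r2 ^ 3 * \<beta> ^ 3"
    using \<beta>(2) K.rel_norm_KF[OF \<tau> \<alpha>K] r2 K1 by simp
  \<comment> \<open>The ideal of \<alpha> is a product of powers of nonzero ideals and so contains a
    nonzero product of elements.\<close>
  have \<alpha>0: "\<alpha> \<noteq> 0"
  proof
    assume "\<alpha> = 0"
    hence zero: "principal (intO K1) \<alpha> \<subseteq> {0}" unfolding principal_def by auto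
    have S: "is_subring (intO K1)" unfolding K1 by (rule K.KO_subring)
    obtain x where x: "x \<in> P" "x \<noteq> 0" using P(1) prime_idealD(9)[OF S P(1)] unfolding prime_ideal_in_def by blast
    obtain y where y: "y \<in> B" "y \<noteq> 0" using B(3) ideal_inD(2)[OF B(2)] by blast
    have "x ^ a * y ^ b \<in> principal (intO K1) \<alpha>"
      unfolding B(5) by (intro imult_memI ipow_memI[OF S] x y)
    thus False using zero x y by auto
  qed
  have "K.conj \<alpha> \<noteq> 0" "K.conj (K.conj \<alpha>) \<noteq> 0"
    using fhomD(10)[OF K.KF_subfield K.conj(1)] \<alpha>0 \<alpha>K K.conj(2) by auto
  hence \<beta>0: "\<beta> \<noteq> 0" using norm \<alpha>0 by auto
  have r2n: "r2 \<notin> adj kk r1"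
    by (rule cube_root_notin_kummer[OF K.kummer_axioms pr1 pr2]) (use p12 p1_eq p2_eq in simp)
  obtain s1 where s1: "r1 ^ 3 - 1 = s1 * (3 * sqrt_m3)" "s1 \<in> intO kk"
    using pi1(3) r1 unfolding principal_mem Ok_def by auto
  obtain s2 where s2: "r2 ^ 3 - 1 = s2 * (3 * sqrt_m3)" "s2 \<in> intO kk"
    using pi2(3) r2 unfolding principal_mem Ok_def by auto
  obtain s\<theta> where s\<theta>: "\<eta> ^ 3 - \<theta> = s\<theta> * (3 * sqrt_m3)" "s\<theta> \<in> intO K1"
    using \<eta>(2) unfolding principal_mem by auto
  interpret A: heisenberg_arith r1 r2 t \<alpha> \<beta> c P B a b \<eta> s1 s2 s\<theta>
  proof unfold_locales
    show "r2 ^ 3 \<in> intO kk" using pi2(1) r2 unfolding Ok_def by simp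
    show "t ^ 3 = zeta3 ^ c * \<alpha>\<^sup>2 * K.conj \<alpha>" using t \<theta> by simp
    show "principal (intO kk) (r1 ^ 3) \<noteq> principal (intO kk) (r2 ^ 3)" using p12 p1_eq p2_eq by simp
    show "\<eta> ^ 3 - zeta3 ^ c * \<alpha>\<^sup>2 * K.conj \<alpha> = s\<theta> * (3 * sqrt_m3)" using s\<theta>(1) \<theta> by simp
    show "P \<inter> intO kk = principal (intO kk) (r2 ^ 3)" using P(2) p2_eq unfolding Ok_def by simp
  qed (use r2n \<alpha>K \<beta>(1) \<beta>0 norm pr1 pr2 s1 s2 s\<theta>(2) \<alpha>(1) P(1) B \<eta>(1) in \<open>simp_all add: K1\<close>)
  have R: "R = A.R" unfolding R_def by (rule A.gen_field_R)
  have \<theta>K: "\<theta> \<in> adj kk r1" unfolding \<theta> by (rule A.\<theta>_in)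
  have "\<tau> \<theta> = K.conj \<theta>" "\<tau> (\<tau> \<theta>) = K.conj (K.conj \<theta>)"
    using K.conj_eq[OF \<tau> \<theta>K] K.conj_eq[OF \<tau> K.conj(2)[OF \<theta>K]] by simp_all
  hence "\<forall>t1 t2 t3. t1 ^ 3 = \<theta> \<and> t2 ^ 3 = \<tau> \<theta> \<and> t3 ^ 3 = \<tau> (\<tau> \<theta>) \<longrightarrow> R = gen_field {zeta3, t1, t2, t3}"
    using A.gen_field_conjugates[folded \<theta>] unfolding R by metis
  moreover have "galois_ext kk R" unfolding R by (rule A.galois)
  moreover have "ram_index (intO R) Q (Q \<inter> Ok) = 1"
    if "prime_ideal_in (intO R) Q" "Q \<inter> Ok \<noteq> p1" "Q \<inter> Ok \<noteq> p2" for Q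
    using A.unramified that unfolding R Ok_def p1_eq p2_eq by blast
  moreover have "ram_index (intO R) Q (Q \<inter> Ok) = 3"
    if "prime_ideal_in (intO R) Q" "Q \<inter> Ok = p1 \<or> Q \<inter> Ok = p2" for Q
    using A.ramified_p1 A.ramified_p2 that unfolding R Ok_def p1_eq p2_eq by blast
  moreover have "Gal kk R \<cong> N3F3" unfolding R by (rule A.Gal_iso)
  ultimately show ?thesis by blast
qed

end
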